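(* Let $(\rho^n,u^n)$ be a sequence of finite energy approximate solutions of the isentropic Euler equations with geometry $A$ (as defined in the context). For any $T>0$ there exists a constant $C>0$ such that $$\sup_n\iint_{[0,T]\times\Omega}(\rho^n)^{\gamma+1}A^2\,dx\,dt\le C.$$
   Context: Constants and geometry: $\gamma>1$, $\theta:=(\gamma-1)/2$, $\kappa:=\theta^2/\gamma$, $\lambda:=(3-\gamma)/(2(\gamma-1))$, $P(\rho)=\kappa\rho^\gamma$, $U(\rho)=\frac{\kappa}{\gamma-1}\rho^\gamma$. $A$ is continuously differentiable and either (nozzle flow) $\Omega=\mathbb R$, $A:\mathbb R\to[\underline A,\overline A]$ with positive constants $\underline A<\overline A$, or (spherical symmetry) $\Omega=(0,\infty)$, $A(x)=x^\alpha$ with $\alpha>0$. Moreover $(\partial_xA)_-\in L^1\cap L^\infty(\Omega)$, with $(b)_-:=-\min\{b,0\}$. The Euler equations with geometry $A$ are $\partial_t(\rho A)+\partial_x(\rho uA)=0$, $\partial_t(\rho uA)+\partial_x(\rho u^2A)+A\partial_xP(\rho)=0$. With $(b)_+:=\max\{b,0\}$, $\chi(s|\rho,u):=(\rho^{2\theta}-(s-u)^2)_+^\lambda$, $\sigma(s|\rho,u):=(\theta s+(1-\theta)u)\chi(s|\rho,u)$, and $(\eta_\psi,q_\psi):=\int_{\mathbb R}\psi(s)(\chi,\sigma)(s|\cdot)\,ds$, an entropy solution satisfies, for all convex $\psi\in C^2(\mathbb R)$ of subquadratic growth, in the distribution sense, $\partial_t(\eta_\psi A)+\partial_x(q_\psi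 A)+(\rho u\,\partial_\rho\eta_\psi-q_\psi)(\partial_xA)\le0$ (this contains the Euler equations, by taking $\psi$ constant or linear). Finite energy approximate solutions: let $A^n(x):=(x+1/n)^\alpha$ in the spherically symmetric case and $A^n:=A$ in the nozzle case; $M^n[\rho]:=\int_\Omega\rho A^n\,dx$, $E^n[\rho,u]:=\int_\Omega(\frac12\rho u^2+U(\rho))A^n\,dx$. Let $(\overline\rho,\overline u)$, $\overline\rho\ge0$, be initial data with finite mass $\overline M:=\int_\Omega\overline\rho A\,dx$ and finite energy $\overline E:=\int_\Omega(\frac12\overline\rho\,\overline u^2+U(\overline\rho))A\,dx$. Let $(\overline\rho^n,\overline u^n)$ be measurable with $\overline\rho^n\ge0$ such that: (i) they are bounded and compactly supported in the closure $\bar\Omega$; (ii) $(\overline\rho^n,\overline u^n)\to(\overline\rho,\overline u)$ in measure; (iii) $M^n[\overline\rho^n]=\overline M$ for all $n$; (iv) $\sup_nE^n[\overline\rho^n,\overline u^n]\le2\overline E$ and $E^n[\overline\rho^n,\overline u^n]\to\overline E$. Then $(\rho^n,u^n)$ is a sequence of entropy solutions of the Euler equations with geometry $A^n$ and initial data $(\overline\rho^n,\overline u^n)$ such that: for each $n$, $(\rho^n,u^n)$ is bounded in $L^\infty([0,\infty)\times\Omega)$ and has compact support in space for all times; $M^n[\rho^n](t)=M^n[\overline\rho^n]$ for a.e. $t$; the total energy $E^n[\rho^n,u^n](t)$ is nonincreasing in time, in particular $E^n[\rho^n,u^n](t)\le E^n[\overline\rho^n,\overline u^n]$ for a.e. $t$.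 In the spherically symmetric case the momentum $\rho^nu^nA^n$ vanishes at $x=0$. *)

theory Defs
  imports "HOL-Analysis.Analysis" "HOL-Library.Landau_Symbols"
begin

section \<open>Constants, pressure and internal energy\<close>

definition theta :: "real \<Rightarrow> real"
  where "theta \<gamma> = (\<gamma> - 1) / 2"

definition kappa :: "real \<Rightarrow> real"
  where "kappa \<gamma> = (theta \<gamma>)\<^sup>2 / \<gamma>"

definition lam :: "real \<Rightarrow> real"
  where "lam \<gamma> = (3 - \<gamma>) / (2 * (\<gamma> - 1))"

definition pressure :: "real \<Rightarrow> real \<Rightarrow> real"
  where "pressure \<gamma> r = kappa \<gamma> * r powr \<gamma>"

definition internal_energy :: "real \<Rightarrow> real \<Rightarrow> real"
  where "internal_energy \<gamma> r = kappa \<gamma> / (\<gamma> - 1) * r powr \<gamma>"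

definition neg_part :: "real \<Rightarrow> real"
  where "neg_part b = - min b 0"


section \<open>Geometries\<close>

text \<open>
  A nozzle is given by its cross section on the whole line; spherical symmetry is given by
  the exponent of the weight, on the half line. Weights are only relevant on the domain.
\<close>

datatype geometry = Nozzle "real \<Rightarrow> real" | Spherical real

primrec domain :: "geometry \<Rightarrow> real set" where
  "domain (Nozzle A) = UNIV"
| "domain (Spherical \<alpha>) = {0<..}"

primrec weight :: "geometry \<Rightarrow> real \<Rightarrow> real" where
  "weight (Nozzle A) = A"
| "weight (Spherical \<alpha>) = (\<lambda>x. x powr \<alpha>)"

text \<open>The regularized weights, used for \<open>n \<ge> 1\<close> only (division by zero for \<open>n = 0\<close>).\<close>

primrec approx_weight :: "geometry \<Rightarrow> nat \<Rightarrow> real \<Rightarrow> real" where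
  "approx_weight (Nozzle A) n = A"
| "approx_weight (Spherical \<alpha>) n = (\<lambda>x. (x + 1 / real n) powr \<alpha>)"

primrec weight_range_ok :: "geometry \<Rightarrow> bool" where
  "weight_range_ok (Nozzle A) \<longleftrightarrow> (\<exists>a b. 0 < a \<and> a < b \<and> (\<forall>x. A x \<in> {a..b}))"
| "weight_range_ok (Spherical \<alpha>) \<longleftrightarrow> 0 < \<alpha>"

definition admissible_geometry :: "geometry \<Rightarrow> bool" where
  "admissible_geometry G \<longleftrightarrow>
     weight_range_ok G \<and>
     weight G C1_differentiable_on domain G \<and>
     set_integrable lebesgue (domain G) (\<lambda>x. neg_part (deriv (weight G) x)) \<and>
     (\<exists>B. AE x\<in>domain G in lebesgue. neg_part (deriv (weight G) x) \<le> B)"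


section \<open>Smooth functions and test functions\<close>

text \<open>
  \<open>C\<^sup>k\<close> functions on a Euclidean space: a function is \<open>C\<^bsup>k+1\<^esup>\<close> iff it is differentiable
  and all its directional derivatives are \<open>C\<^sup>k\<close>.
\<close>

primrec Ck :: "nat \<Rightarrow> ('a::euclidean_space \<Rightarrow> real) \<Rightarrow> bool" where
  "Ck 0 f \<longleftrightarrow> continuous_on UNIV f"
| "Ck (Suc k) f \<longleftrightarrow>
     (\<exists>f'. (\<forall>x. (f has_derivative f' x) (at x)) \<and> (\<forall>h. Ck k (\<lambda>x. f' x h)))"

definition test_function :: "'a::euclidean_space set \<Rightarrow> ('a \<Rightarrow> real) \<Rightarrow> bool" where
  "test_function S \<phi> \<longleftrightarrow>
     (\<forall>k. Ck k \<phi>) \<and> compact (closure {z. \<phi> z \<noteq> 0}) \<and> closure {z. \<phi> z \<noteq> 0} \<subseteq> S"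


section \<open>Entropies and entropy solutions\<close>

text \<open>
  Since \<open>0 powr a = 0\<close> for every \<open>a\<close> (also for \<open>a \<le> 0\<close>), the kernel vanishes outside of
  the open interval \<open>(s - u)\<^sup>2 < \<rho>\<^bsup>2\<theta>\<^esup>\<close> for every \<open>\<gamma> > 1\<close>.
\<close>

definition chi :: "real \<Rightarrow> real \<Rightarrow> real \<Rightarrow> real \<Rightarrow> real" where
  "chi \<gamma> s r v = (max (r powr (2 * theta \<gamma>) - (s - v)\<^sup>2) 0) powr lam \<gamma>"

definition sigma :: "real \<Rightarrow> real \<Rightarrow> real \<Rightarrow> real \<Rightarrow> real" where
  "sigma \<gamma> s r v = (theta \<gamma> * s + (1 - theta \<gamma>) * v) * chi \<gamma> s r v"

definition eta :: "real \<Rightarrow> (real \<Rightarrow> real) \<Rightarrow> real \<Rightarrow> real \<Rightarrow> real" where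
  "eta \<gamma> \<psi> r v = (LINT s|lborel. \<psi> s * chi \<gamma> s r v)"

definition entropy_flux :: "real \<Rightarrow> (real \<Rightarrow> real) \<Rightarrow> real \<Rightarrow> real \<Rightarrow> real" where
  "entropy_flux \<gamma> \<psi> r v = (LINT s|lborel. \<psi> s * sigma \<gamma> s r v)"

text \<open>
  The coefficient of \<open>\<partial>\<^sub>xA\<close>. The derivative in \<open>\<rho>\<close> is taken at fixed velocity; at the vacuum
  \<open>\<rho> = 0\<close> its value is irrelevant because of the factor \<open>\<rho>\<close>.
\<close>

definition geometric_source :: "real \<Rightarrow> (real \<Rightarrow> real) \<Rightarrow> real \<Rightarrow> real \<Rightarrow> real" where
  "geometric_source \<gamma> \<psi> r v =
     r * v * deriv (\<lambda>r'. eta \<gamma> \<psi> r' v) r - entropy_flux \<gamma> \<psi> r v"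

text \<open>Subquadratic growth is \<open>\<psi>(s) = o(s\<^sup>2)\<close> as \<open>\<bar>s\<bar> \<rightarrow> \<infinity>\<close>.\<close>

definition entropy_generator :: "(real \<Rightarrow> real) \<Rightarrow> bool" where
  "entropy_generator \<psi> \<longleftrightarrow>
     Ck 2 \<psi> \<and> convex_on UNIV \<psi> \<and> \<psi> \<in> o[at_infinity](\<lambda>s. s\<^sup>2)"

text \<open>
  \<open>r\<close>, \<open>v\<close> are density and velocity as functions of \<open>(t, x)\<close>, \<open>r0\<close>, \<open>v0\<close> their initial data.
  The test functions are not required to vanish at \<open>t = 0\<close>, so that the inequality includes
  the initial condition; in \<open>x\<close> they are supported in the open set \<open>\<Omega>\<close>.
  The predicate is used for bounded \<open>r\<close>, \<open>v\<close>, \<open>r0\<close>, \<open>v0\<close>, for which all integrals exist.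
\<close>

definition entropy_solution ::
  "real \<Rightarrow> real set \<Rightarrow> (real \<Rightarrow> real) \<Rightarrow> (real \<Rightarrow> real) \<Rightarrow> (real \<Rightarrow> real) \<Rightarrow>
   (real \<times> real \<Rightarrow> real) \<Rightarrow> (real \<times> real \<Rightarrow> real) \<Rightarrow> bool" where
  "entropy_solution \<gamma> \<Omega> A r0 v0 r v \<longleftrightarrow>
     r \<in> borel_measurable (lebesgue_on ({0..} \<times> \<Omega>)) \<and>
     v \<in> borel_measurable (lebesgue_on ({0..} \<times> \<Omega>)) \<and>
     (AE z\<in>{0..} \<times> \<Omega> in lebesgue. 0 \<le> r z) \<and>
     (\<forall>\<psi> \<phi>. entropy_generator \<psi> \<longrightarrow> test_function (UNIV \<times> \<Omega>) \<phi> \<longrightarrow> (\<forall>z. 0 \<le> \<phi> z) \<longrightarrow>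
        0 \<le> (LINT z:{0..} \<times> \<Omega>|lebesgue.
                eta \<gamma> \<psi> (r z) (v z) * A (snd z) * deriv (\<lambda>t. \<phi> (t, snd z)) (fst z)
              + entropy_flux \<gamma> \<psi> (r z) (v z) * A (snd z) * deriv (\<lambda>x. \<phi> (fst z, x)) (snd z)
              - geometric_source \<gamma> \<psi> (r z) (v z) * deriv A (snd z) * \<phi> z)
          + (LINT x:\<Omega>|lebesgue. eta \<gamma> \<psi> (r0 x) (v0 x) * A x * \<phi> (0, x)))"


section \<open>Finite energy approximate solutions\<close>

definition total_mass :: "real set \<Rightarrow> (real \<Rightarrow> real) \<Rightarrow> (real \<Rightarrow> real) \<Rightarrow> ennreal" where
  "total_mass \<Omega> A r = (\<integral>\<^sup>+x\<in>\<Omega>. ennreal (r x * A x) \<partial>lebesgue)"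

definition total_energy ::
  "real \<Rightarrow> real set \<Rightarrow> (real \<Rightarrow> real) \<Rightarrow> (real \<Rightarrow> real) \<Rightarrow> (real \<Rightarrow> real) \<Rightarrow> ennreal" where
  "total_energy \<gamma> \<Omega> A r v =
     (\<integral>\<^sup>+x\<in>\<Omega>. ennreal ((1 / 2 * r x * (v x)\<^sup>2 + internal_energy \<gamma> (r x)) * A x) \<partial>lebesgue)"

definition tendsto_in_measure ::
  "'a measure \<Rightarrow> (nat \<Rightarrow> 'a \<Rightarrow> 'b::metric_space) \<Rightarrow> ('a \<Rightarrow> 'b) \<Rightarrow> bool" where
  "tendsto_in_measure M f g \<longleftrightarrow>
     (\<forall>\<epsilon>>0. (\<lambda>n. emeasure M {x \<in> space M. \<epsilon> < dist (f n x) (g x)}) \<longlonglongrightarrow> 0)"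

definition finite_energy_data ::
  "real \<Rightarrow> geometry \<Rightarrow> (real \<Rightarrow> real) \<Rightarrow> (real \<Rightarrow> real) \<Rightarrow> bool" where
  "finite_energy_data \<gamma> G r v \<longleftrightarrow>
     r \<in> borel_measurable (lebesgue_on (domain G)) \<and>
     v \<in> borel_measurable (lebesgue_on (domain G)) \<and>
     (AE x\<in>domain G in lebesgue. 0 \<le> r x) \<and>
     total_mass (domain G) (weight G) r < \<infinity> \<and>
     total_energy \<gamma> (domain G) (weight G) r v < \<infinity>"

definition approximate_data ::
  "real \<Rightarrow> geometry \<Rightarrow> (real \<Rightarrow> real) \<Rightarrow> (real \<Rightarrow> real) \<Rightarrow>
   (nat \<Rightarrow> real \<Rightarrow> real) \<Rightarrow> (nat \<Rightarrow> real \<Rightarrow> real) \<Rightarrow> bool" where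
  "approximate_data \<gamma> G r v rn vn \<longleftrightarrow>
     (\<forall>n\<ge>1. rn n \<in> borel_measurable (lebesgue_on (domain G)) \<and>
             vn n \<in> borel_measurable (lebesgue_on (domain G)) \<and>
             (AE x\<in>domain G in lebesgue. 0 \<le> rn n x) \<and>
             (\<exists>B. AE x\<in>domain G in lebesgue. \<bar>rn n x\<bar> \<le> B \<and> \<bar>vn n x\<bar> \<le> B) \<and>
             (\<exists>R. AE x\<in>domain G in lebesgue. R < \<bar>x\<bar> \<longrightarrow> rn n x = 0 \<and> vn n x = 0)) \<and>
     tendsto_in_measure (lebesgue_on (domain G)) (\<lambda>n x. (rn n x, vn n x)) (\<lambda>x. (r x, v x)) \<and>
     (\<forall>n\<ge>1. total_mass (domain G) (approx_weight G n) (rn n)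
           = total_mass (domain G) (weight G) r) \<and>
     (SUP n\<in>{1..}. total_energy \<gamma> (domain G) (approx_weight G n) (rn n) (vn n))
       \<le> 2 * total_energy \<gamma> (domain G) (weight G) r v \<and>
     (\<lambda>n. total_energy \<gamma> (domain G) (approx_weight G n) (rn n) (vn n))
       \<longlonglongrightarrow> total_energy \<gamma> (domain G) (weight G) r v"

text \<open>
  A bounded function of \<open>(t, x)\<close> with \<open>x > 0\<close> has zero boundary values at \<open>x = 0\<close> if its averages
  over the layers \<open>0 < x < \<epsilon>\<close> vanish in the limit, as distributions in time. (A weak solution
  need not have pointwise boundary values.)
\<close>

definition vanishes_at_origin :: "(real \<times> real \<Rightarrow> real) \<Rightarrow> bool" where
  "vanishes_at_origin m \<longleftrightarrow>
     (\<forall>\<tau>. test_function {0<..} \<tau> \<longrightarrow>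
        ((\<lambda>\<epsilon>. (1 / \<epsilon>) * (LINT z:{0..} \<times> {0<..<\<epsilon>}|lebesgue. m z * \<tau> (fst z))) \<longlongrightarrow> 0)
          (at_right 0))"

primrec boundary_condition :: "geometry \<Rightarrow> (real \<times> real \<Rightarrow> real) \<Rightarrow> bool" where
  "boundary_condition (Nozzle A) m \<longleftrightarrow> True"
| "boundary_condition (Spherical \<alpha>) m \<longleftrightarrow> vanishes_at_origin m"

text \<open>
  Functions of time obtained from \<open>\<rho>\<^sup>n\<close>, \<open>u\<^sup>n\<close> are determined up to null sets only; being
  nonincreasing is therefore required outside of a null set of times.
\<close>

definition finite_energy_approximate_solutions ::
  "real \<Rightarrow> geometry \<Rightarrow> (real \<Rightarrow> real) \<Rightarrow> (real \<Rightarrow> real) \<Rightarrow>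
   (nat \<Rightarrow> real \<Rightarrow> real) \<Rightarrow> (nat \<Rightarrow> real \<Rightarrow> real) \<Rightarrow>
   (nat \<Rightarrow> real \<times> real \<Rightarrow> real) \<Rightarrow> (nat \<Rightarrow> real \<times> real \<Rightarrow> real) \<Rightarrow> bool" where
  "finite_energy_approximate_solutions \<gamma> G r0 v0 r0n v0n \<rho> u \<longleftrightarrow>
     finite_energy_data \<gamma> G r0 v0 \<and>
     approximate_data \<gamma> G r0 v0 r0n v0n \<and>
     (\<forall>n\<ge>1.
        entropy_solution \<gamma> (domain G) (approx_weight G n) (r0n n) (v0n n) (\<rho> n) (u n) \<and>
        (\<exists>B. AE z\<in>{0..} \<times> domain G in lebesgue. \<bar>\<rho> n z\<bar> \<le> B \<and> \<bar>u n z\<bar> \<le> B) \<and>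
        (AE t\<in>{0..} in lebesgue. \<exists>R. AE x\<in>domain G in lebesgue.
           R < \<bar>x\<bar> \<longrightarrow> \<rho> n (t, x) = 0 \<and> u n (t, x) = 0) \<and>
        (AE t\<in>{0..} in lebesgue.
           total_mass (domain G) (approx_weight G n) (\<lambda>x. \<rho> n (t, x))
           = total_mass (domain G) (approx_weight G n) (r0n n)) \<and>
        (\<exists>N\<in>null_sets lebesgue. antimono_on ({0..} - N)
           (\<lambda>t. total_energy \<gamma> (domain G) (approx_weight G n)
                  (\<lambda>x. \<rho> n (t, x)) (\<lambda>x. u n (t, x)))) \<and>
        (AE t\<in>{0..} in lebesgue.
           total_energy \<gamma> (domain G) (approx_weight G n) (\<lambda>x. \<rho> n (t, x)) (\<lambda>x. u n (t, x))
           \<le> total_energy \<gamma> (domain G) (approx_weight G n) (r0n n) (v0n n)) \<and>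
        boundary_condition G (\<lambda>z. \<rho> n z * u n z * approx_weight G n (snd z)))"

end

theory Submission
  imports Defs
begin

text \<open>
  Write \<open>m = \<rho>A\<close>, \<open>p = \<rho>uA\<close>, \<open>q = (\<rho>u\<^sup>2 + P)A\<close> and \<open>S = P \<partial>\<^sub>xA\<close>, so that \<open>qm - p\<^sup>2\<close> is
  a constant times \<open>\<rho>\<^bsup>\<gamma>+1\<^esup>A\<^sup>2\<close>. Formally one tests the momentum equation \<open>\<partial>\<^sub>tp + \<partial>\<^sub>xq = S\<close> with
  \<open>F(t, x) = \<integral> m(t, y) dy\<close> over \<open>y < x\<close>. Since \<open>\<partial>\<^sub>xF = m\<close> and, by conservation of mass, \<open>\<partial>\<^sub>tF = -p\<close>,
  this yields the integral of \<open>qm - p\<^sup>2\<close>; the remaining terms are controlled by mass and energy,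
  because \<open>0 \<le> F \<le> M\<close> and only the negative part of \<open>\<partial>\<^sub>xA\<close> has the wrong sign.

  As \<open>F\<close> is not an admissible test function, variables are doubled: the momentum equation in \<open>(t, x)\<close>
  and the mass equation in \<open>(s, y)\<close> are tested with products of \<open>J(t - s) H(x - y)\<close> and cutoffs, where
  \<open>J\<close> is a mollifier and \<open>H\<close> a mollified Heaviside function, and integrated against \<open>m(s, y)\<close> and
  \<open>p(t, x)\<close>. The terms with \<open>J'\<close> cancel, and the diagonal term survives as \<open>\<epsilon> \<rightarrow> 0\<close>.
\<close>

section \<open>Smooth functions and cutoffs\<close>

text \<open>The cancellation leaves the prices of the cutoffs. The one in \<open>t\<close> costs its
  variation times the momentum bound. The one in \<open>x\<close> costs only its downward slope,
  since \<open>q\<close> and \<open>m\<close> are nonnegative; its left flank may be arbitrarily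
  steep. The cutoff \<open>d\<close> in \<open>y\<close> is forced by test functions with support
  inside the open set \<open>\<Omega>\<close>. Its slope produces the mass flux through the left
  end, the term that depends on the geometry: in spherical symmetry it disappears in the limit
  because the momentum vanishes at the origin, in a nozzle because the cutoff is moved to minus
  infinity and its slope tends to zero. The right flank of \<open>d\<close> is harmless, as
  \<open>H(x - y)\<close> vanishes for \<open>y\<close> beyond \<open>x\<close>. Pointwise bounds on
  the approximate solutions may depend on \<open>n\<close>; they serve integrability and passages to
  the limit. The final constant is built from mass, energy, \<open>T\<close> and a number
  \<open>K\<close> with \<open>- A' \<le> K * A\<close>, all independent of
  \<open>n\<close>.\<close>

lemma Ck_const [simp]: "Ck k (\<lambda>_. c)"
proof (induction k arbitrary: c)
  case (Suc k)
  show ?case by (auto intro!: exI[of _ "\<lambda>_ _. 0"] Suc derivative_intros)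
qed auto

lemma Ck_add: "Ck k f \<Longrightarrow> Ck k g \<Longrightarrow> Ck k (\<lambda>x. f x + g x)"
proof (induction k arbitrary: f g)
  case 0
  then show ?case by (auto intro: continuous_intros)
next
  case (Suc k)
  then obtain f' g' where *: "\<forall>x. (f has_derivative f' x) (at x)" "\<forall>h. Ck k (\<lambda>x. f' x h)"
    "\<forall>x. (g has_derivative g' x) (at x)" "\<forall>h. Ck k (\<lambda>x. g' x h)"
    by auto
  show ?case
    using * Suc.IH by (auto intro!: exI[of _ "\<lambda>x h. f' x h + g' x h"] derivative_eq_intros)
qed

lemma Ck_Suc_imp: "Ck (Suc k) f \<Longrightarrow> Ck k f"
proof (induction k arbitrary: f)
  case 0
  then show ?case
    by (auto simp: continuous_on_eq_continuous_at intro: has_derivative_continuous)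
next
  case (Suc k)
  then obtain f' where *: "\<forall>x. (f has_derivative f' x) (at x)" "\<forall>h. Ck (Suc k) (\<lambda>x. f' x h)"
    by auto
  then show ?case using Suc.IH by (auto simp del: Ck.simps(2) simp: Ck.simps(2)[of k f])
qed

lemma Ck_mult: "Ck k f \<Longrightarrow> Ck k g \<Longrightarrow> Ck k (\<lambda>x. f x * g x)"
proof (induction k arbitrary: f g)
  case 0
  then show ?case by (auto intro: continuous_intros)
next
  case (Suc k)
  then obtain f' g' where *: "\<forall>x. (f has_derivative f' x) (at x)" "\<forall>h. Ck k (\<lambda>x. f' x h)"
    "\<forall>x. (g has_derivative g' x) (at x)" "\<forall>h. Ck k (\<lambda>x. g' x h)"
    by auto
  have "Ck k f" "Ck k g" using Suc.prems by (auto intro: Ck_Suc_imp simp del: Ck.simps)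
  then have "\<forall>h. Ck k (\<lambda>x. f x * g' x h + f' x h * g x)"
    using * Suc.IH by (auto intro!: Ck_add)
  moreover have "\<forall>x. ((\<lambda>x. f x * g x) has_derivative (\<lambda>h. f x * g' x h + f' x h * g x)) (at x)"
    using * by (auto intro!: derivative_eq_intros)
  ultimately show ?case by (auto intro!: exI[of _ "\<lambda>x h. f x * g' x h + f' x h * g x"])
qed

text \<open>A general bounded linear map between Euclidean spaces covers rescalings and reflections
  of the line as well as the two projections of the plane in \<open>smooth_tensor\<close>.\<close>

lemma Ck_affine:
  fixes L :: "'a::euclidean_space \<Rightarrow> 'b::euclidean_space"
  assumes "bounded_linear L"
  shows "Ck k f \<Longrightarrow> Ck k (\<lambda>x. f (L x + b))"
proof (induction k arbitrary: f)
  case 0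
  have "continuous_on UNIV (\<lambda>x. L x + b)"
    by (intro continuous_on_add linear_continuous_on[OF assms] continuous_on_const)
  with 0 show ?case
    using continuous_on_compose2[of UNIV f UNIV "\<lambda>x. L x + b"] by simp
next
  case (Suc k)
  then obtain f' where *: "\<forall>x. (f has_derivative f' x) (at x)" "\<forall>h. Ck k (\<lambda>x. f' x h)"
    by auto
  have "((\<lambda>x. f (L x + b)) has_derivative (\<lambda>h. f' (L x + b) (L h))) (at x)" for x
  proof (rule has_derivative_compose[of "\<lambda>x. L x + b" L])
    show "((\<lambda>x. L x + b) has_derivative L) (at x)"
      using has_derivative_add[OF bounded_linear_imp_has_derivative[OF assms] has_derivative_const] by simp
    show "(f has_derivative f' (L x + b)) (at (L x + b))" using * by blast
  qed
  moreover have "Ck k (\<lambda>x. f' (L x + b) (L h))" for h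
    using Suc.IH[of "\<lambda>x. f' x (L h)"] *(2) by blast
  ultimately show ?case unfolding Ck.simps by (intro exI[of _ "\<lambda>x h. f' (L x + b) (L h)"]) blast
qed

definition smooth :: "('a::euclidean_space \<Rightarrow> real) \<Rightarrow> bool"
  where "smooth f \<longleftrightarrow> (\<forall>k. Ck k f)"

lemma smooth_const [simp]: "smooth (\<lambda>_. c)"
  by (simp add: smooth_def)

lemma smooth_mult: "smooth f \<Longrightarrow> smooth g \<Longrightarrow> smooth (\<lambda>x. f x * g x)"
  by (simp add: smooth_def Ck_mult)

lemma smooth_affine:
  assumes "smooth f"
  shows "smooth (\<lambda>x::real. f (a * x + b))"
  using assms Ck_affine[of "\<lambda>x. a * x" _ f b] by (simp add: smooth_def bounded_linear_mult_right)

lemma smooth_reflect: "smooth f \<Longrightarrow> smooth (\<lambda>x::real. f (a - x))"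
  using smooth_affine[of f "-1" a] by simp

lemma smooth_tensor:
  fixes a b :: "real \<Rightarrow> real"
  assumes "smooth a" "smooth b"
  shows "smooth (\<lambda>z::real \<times> real. a (fst z) * b (snd z))"
  using assms Ck_affine[of "fst :: real \<times> real \<Rightarrow> real" _ a 0] Ck_affine[of "snd :: real \<times> real \<Rightarrow> real" _ b 0]
  by (simp add: smooth_def bounded_linear_fst bounded_linear_snd Ck_mult)

lemma Ck_real_Suc:
  fixes f :: "real \<Rightarrow> real"
  assumes "\<And>x. (f has_real_derivative D x) (at x)" "Ck k D"
  shows "Ck (Suc k) f"
proof -
  have "\<forall>x. (f has_derivative (\<lambda>h. D x * h)) (at x)"
    using assms(1) by (simp add: has_field_derivative_def)
  then show ?thesis using Ck_mult[OF assms(2) Ck_const] by auto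
qed

lemma Ck_deriv:
  fixes f :: "real \<Rightarrow> real"
  assumes "Ck (Suc k) f"
  shows "(f has_real_derivative deriv f x) (at x)" "Ck k (deriv f)"
proof -
  obtain f' where *: "\<forall>x. (f has_derivative f' x) (at x)" "\<forall>h. Ck k (\<lambda>x. f' x h)"
    using assms by auto
  have D: "(f has_real_derivative f' x 1) (at x)" for x
  proof -
    interpret bounded_linear "f' x" using * has_derivative_bounded_linear by blast
    have "f' x h = f' x 1 * h" for h using scaleR[of h 1] by (metis mult.commute mult.right_neutral real_scaleR_def)
    then have "f' x = (*) (f' x 1)" by (rule ext)
    then show ?thesis using *(1) unfolding has_field_derivative_def by metis
  qed
  then have "deriv f = (\<lambda>x. f' x 1)" by (auto intro: DERIV_imp_deriv)
  then show "(f has_real_derivative deriv f x) (at x)" "Ck k (deriv f)"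
    using D * by simp_all
qed

lemma smooth_has_deriv:
  fixes f :: "real \<Rightarrow> real"
  shows "smooth f \<Longrightarrow> (f has_real_derivative deriv f x) (at x)"
  by (auto simp: smooth_def intro: Ck_deriv)

lemma smooth_deriv:
  fixes f :: "real \<Rightarrow> real"
  shows "smooth f \<Longrightarrow> smooth (deriv f)"
  by (auto simp: smooth_def intro: Ck_deriv)

lemma smooth_antideriv:
  fixes f :: "real \<Rightarrow> real"
  assumes "\<And>x. (f has_real_derivative D x) (at x)" "smooth D"
  shows "smooth f"
  using assms Ck_real_Suc[of f D] Ck_Suc_imp unfolding smooth_def by blast

lemma smooth_continuous_on: "smooth f \<Longrightarrow> continuous_on A f"
  by (metis Ck.simps(1) continuous_on_subset smooth_def top_greatest)

lemma smooth_measurable: "smooth f \<Longrightarrow> f \<in> borel_measurable borel"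
  by (auto intro: borel_measurable_continuous_onI smooth_continuous_on)

lemma test_function_smooth: "test_function S f \<Longrightarrow> smooth f"
  by (simp add: test_function_def smooth_def)

lemma test_functionI:
  assumes "smooth f" "compact K" "K \<subseteq> S" "\<And>x. x \<notin> K \<Longrightarrow> f x = 0"
  shows "test_function S f"
proof -
  have "closure {x. f x \<noteq> 0} \<subseteq> K"
    using assms by (intro closure_minimal) (auto simp: compact_imp_closed)
  moreover from this have "compact (closure {x. f x \<noteq> 0})"
    using compact_Int_closed[OF \<open>compact K\<close> closed_closure] by (metis inf.absorb2)
  ultimately show ?thesis
    using assms by (auto simp: test_function_def smooth_def)
qed

section \<open>A flat function, a bump supported in the unit interval, and its primitive\<close>

definition flat_exp :: "nat \<Rightarrow> real \<Rightarrow> real"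
  where "flat_exp k x = (if x > 0 then inverse x ^ k * exp (- inverse x) else 0)"

lemma tendsto_flat_exp: "(flat_exp k \<longlongrightarrow> 0) (at_right 0)"
proof -
  have "((\<lambda>y::real. y ^ k / exp y) \<longlongrightarrow> 0) at_top"
    by (rule tendsto_power_div_exp_0)
  then have "((\<lambda>x. inverse x ^ k / exp (inverse x)) \<longlongrightarrow> 0) (at_right (0::real))"
    by (rule filterlim_compose[OF _ filterlim_inverse_at_top_right])
  moreover have "eventually (\<lambda>x. inverse x ^ k / exp (inverse x) = flat_exp k x) (at_right (0::real))"
    using eventually_at_right_less[of 0]
    by eventually_elim (simp add: flat_exp_def exp_minus divide_inverse)
  ultimately show ?thesis by (rule Lim_transform_eventually)
qed

text \<open>The powers in front of the exponential are built in because differentiating exp(-1/x)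
  produces them: the linear span of the family is closed under differentiation, so
  \<open>smooth_flat_exp\<close> needs a single induction for all \<open>k\<close> at once.\<close>

lemma flat_exp_has_deriv:
  "(flat_exp k has_real_derivative flat_exp (k + 2) x - real k * flat_exp (k + 1) x) (at x)"
proof -
  consider "x > 0" | "x < 0" | "x = 0" by linarith
  then show ?thesis
  proof cases
    case 1
    have "((\<lambda>x. inverse x ^ k * exp (- inverse x)) has_real_derivative
      inverse x ^ k * (exp (- inverse x) * (inverse x)\<^sup>2)
      + real k * (- ((inverse x)\<^sup>2)) * inverse x ^ (k - 1) * exp (- inverse x)) (at x)"
      using 1 by (auto intro!: derivative_eq_intros simp: power2_eq_square)
    \<comment> \<open>\<open>k - 1\<close> is truncated subtraction, hence the case distinction; for
      \<open>k = 0\<close> the term carries the factor zero.\<close>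
    moreover have "inverse x ^ k * (exp (- inverse x) * (inverse x)\<^sup>2)
      + real k * (- ((inverse x)\<^sup>2)) * inverse x ^ (k - 1) * exp (- inverse x)
      = flat_exp (k + 2) x - real k * flat_exp (k + 1) x"
      using 1 by (cases k) (simp_all add: flat_exp_def algebra_simps power2_eq_square)
    ultimately have "((\<lambda>x. inverse x ^ k * exp (- inverse x)) has_real_derivative
      flat_exp (k + 2) x - real k * flat_exp (k + 1) x) (at x)" by (rule DERIV_cong)
    moreover have "\<forall>\<^sub>F y in nhds x. flat_exp k y = inverse y ^ k * exp (- inverse y)"
      using eventually_nhds_in_open[of "{0<..}" x] 1
      by (auto elim!: eventually_mono simp: flat_exp_def)
    ultimately show ?thesis
      using DERIV_cong_ev[of x x "flat_exp k" "\<lambda>x. inverse x ^ k * exp (- inverse x)"] by blast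
  next
    case 2
    have "\<forall>\<^sub>F y in nhds x. flat_exp k y = 0"
      using eventually_nhds_in_open[of "{..<0}" x] 2
      by (auto elim!: eventually_mono simp: flat_exp_def)
    then show ?thesis
      using 2 by (subst DERIV_cong_ev[OF refl _ refl, where g="\<lambda>_. 0"]) (auto simp: flat_exp_def)
  next
    case 3
    have "((\<lambda>y. (flat_exp k y - flat_exp k 0) / (y - 0)) \<longlongrightarrow> 0) (at 0)"
    proof (rule filterlim_split_at)
      show "((\<lambda>y. (flat_exp k y - flat_exp k 0) / (y - 0)) \<longlongrightarrow> 0) (at_left 0)"
        by (rule tendsto_eventually) 
          (auto simp: flat_exp_def eventually_at_filter intro!: always_eventually)
      \<comment> \<open>For \<open>y > 0\<close> the difference quotient at the origin is the next
        member of the family, whose limit is already known.\<close>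
      have "eventually (\<lambda>y. flat_exp (Suc k) y = (flat_exp k y - flat_exp k 0) / (y - 0)) (at_right 0)"
        using eventually_at_right_less[of 0]
        by eventually_elim (simp add: flat_exp_def divide_inverse)
      then show "((\<lambda>y. (flat_exp k y - flat_exp k 0) / (y - 0)) \<longlongrightarrow> 0) (at_right 0)"
        using tendsto_flat_exp by (rule Lim_transform_eventually[rotated])
    qed
    then show ?thesis
      using 3 by (simp add: has_field_derivative_iff flat_exp_def)
  qed
qed

lemma smooth_flat_exp: "smooth (flat_exp k)"
proof -
  have "Ck n (flat_exp k)" for n
  proof (induction n arbitrary: k)
    case 0
    show ?case
      using DERIV_isCont[OF flat_exp_has_deriv]
      by (auto simp: continuous_on_eq_continuous_at)
  next
    case (Suc n)
    have "Ck n (\<lambda>x. flat_exp (k + 2) x + - real k * flat_exp (k + 1) x)"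
      by (intro Ck_add Ck_mult Ck_const Suc)
    then show ?case
      using flat_exp_has_deriv by (intro Ck_real_Suc) auto
  qed
  then show ?thesis by (simp add: smooth_def)
qed

text \<open>The support lies to the right of zero on purpose: the mollified Heaviside function then
  vanishes for all arguments \<open>x \<le> 0\<close>, so that \<open>H(x - y)\<close> never sees
  points \<open>y\<close> beyond \<open>x\<close>.\<close>

definition raw_bump :: "real \<Rightarrow> real"
  where "raw_bump x = flat_exp 0 x * flat_exp 0 (1 - x)"

definition bump :: "real \<Rightarrow> real"
  where "bump x = raw_bump x / (LINT y|lborel. raw_bump y)"

definition step :: "real \<Rightarrow> real"
  where "step x = (LINT y:{0..x}|lborel. bump y)"

lemma smooth_raw_bump: "smooth raw_bump"
  unfolding raw_bump_def[abs_def] by (intro smooth_mult smooth_flat_exp smooth_reflect)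

lemma raw_bump_pos: "0 < raw_bump x \<longleftrightarrow> 0 < x \<and> x < 1"
  by (auto simp: raw_bump_def flat_exp_def)

lemma raw_bump_nonneg: "0 \<le> raw_bump x"
  by (auto simp: raw_bump_def flat_exp_def)

lemma raw_bump_eq_0: "\<not> (0 < x \<and> x < 1) \<Longrightarrow> raw_bump x = 0"
  using raw_bump_pos[of x] raw_bump_nonneg[of x] by linarith

lemma integrable_continuous_compact_support:
  fixes f :: "'a::euclidean_space \<Rightarrow> real"
  assumes "continuous_on UNIV f" "compact K" "\<And>x. x \<notin> K \<Longrightarrow> f x = 0"
  shows "integrable lborel f"
proof -
  have "set_integrable lborel K f"
    unfolding set_integrable_def using assms by (intro borel_integrable_compact) (auto intro: continuous_on_subset)
  moreover have "(\<lambda>x. indicat_real K x *\<^sub>R f x) = f"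
    using assms(3) by (fastforce simp: fun_eq_iff indicator_def)
  ultimately show ?thesis by (simp add: set_integrable_def)
qed

lemma integrable_raw_bump: "integrable lborel raw_bump"
  by (rule integrable_continuous_compact_support[of _ "{0..1}"])
    (auto intro!: smooth_continuous_on smooth_raw_bump raw_bump_eq_0)

lemma integral_raw_bump_pos: "0 < (LINT y|lborel. raw_bump y)"
proof (rule ccontr)
  assume "\<not> ?thesis"
  moreover have "0 \<le> (LINT y|lborel. raw_bump y)" by (simp add: raw_bump_nonneg)
  ultimately have "(LINT y|lborel. raw_bump y) = 0" by linarith
  then have "AE x in lborel. raw_bump x = 0"
    using integral_nonneg_eq_0_iff_AE[OF integrable_raw_bump] raw_bump_nonneg by simp
  then have "AE x in lborel. x \<notin> {0<..<1::real}"
    by (elim AE_mp) (intro AE_I2 impI, metis raw_bump_pos greaterThanLessThan_iff less_irrefl)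
  then have "{0<..<1::real} \<in> null_sets lborel"
    by (subst (asm) AE_iff_null_sets[symmetric]) auto
  then show False by (simp add: null_sets_def)
qed

lemma smooth_bump: "smooth bump"
proof -
  have "smooth (\<lambda>x. inverse (LINT y|lborel. raw_bump y) * raw_bump x)"
    by (intro smooth_mult smooth_const smooth_raw_bump)
  then show ?thesis by (simp add: bump_def[abs_def] divide_inverse mult.commute)
qed

lemma bump_nonneg: "0 \<le> bump x"
  using integral_raw_bump_pos raw_bump_nonneg by (simp add: bump_def)

lemma bump_eq_0: "x \<le> 0 \<or> 1 \<le> x \<Longrightarrow> bump x = 0"
  by (auto simp: bump_def intro: raw_bump_eq_0)

lemma integrable_bump: "integrable lborel bump"
  unfolding bump_def[abs_def] by (intro integrable_divide_zero integrable_raw_bump)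

lemma integral_bump: "(LINT x|lborel. bump x) = 1"
  using integral_raw_bump_pos by (simp add: bump_def[abs_def])

lemma step_le_0: "x \<le> 0 \<Longrightarrow> step x = 0"
  by (auto simp: step_def set_lebesgue_integral_def indicator_def bump_eq_0 
    intro!: integral_eq_zero_AE AE_I2)

lemma step_ge_1: "1 \<le> x \<Longrightarrow> step x = 1"
proof -
  assume "1 \<le> x"
  then have "indicat_real {0..x} y *\<^sub>R bump y = bump y" for y
    using bump_eq_0[of y] by (cases "y \<in> {0..x}") auto
  then show ?thesis unfolding step_def set_lebesgue_integral_def by (simp only: integral_bump)
qed

lemma step_has_deriv: "(step has_real_derivative bump x) (at x)"
proof -
  \<comment> \<open>The lower limit 0 in \<open>step\<close> is moved to \<open>-b\<close>, so that
    \<open>x\<close> is an interior point of the window in which the fundamental theorem is applied;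
    nothing changes, as \<open>bump\<close> vanishes to the left of zero.\<close>
  define b where "b = \<bar>x\<bar> + 1"
  have "((\<lambda>u. LBINT y=ereal (-b)..u. bump y) has_vector_derivative bump x) (at x within {-b..b})"
    by (rule interval_integral_FTC2) (auto simp: b_def intro!: smooth_continuous_on smooth_bump)
  then have 1: "((\<lambda>u. LBINT y=ereal (-b)..u. bump y) has_real_derivative bump x) (at x)"
    by (subst (asm) at_within_interior) 
      (auto simp: b_def has_real_derivative_iff_has_vector_derivative)
  have "step u = (LBINT y=ereal (-b)..u. bump y)" if "u \<in> {-b<..<b}" for u
  proof -
    have "(LBINT y=ereal (-b)..u. bump y) = (LINT y:{-b..u}|lborel. bump y)"
      using that by (subst interval_integral_Icc) auto
    also have "\<dots> = step u"
      unfolding step_def set_lebesgue_integral_def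
      using that by (intro Bochner_Integration.integral_cong) (auto simp: indicator_def bump_eq_0 b_def)
    finally show ?thesis by simp
  qed
  then have "\<forall>\<^sub>F u in nhds x. step u = (LBINT y=ereal (-b)..u. bump y)"
    using eventually_nhds_in_open[of "{-b<..<b}" x] by (rule eventually_mono[rotated]) (auto simp: b_def)
  then show ?thesis
    using 1 by (subst DERIV_cong_ev[OF refl _ refl])
qed

lemma smooth_step: "smooth step"
  using step_has_deriv smooth_bump by (rule smooth_antideriv)

lemma deriv_step: "deriv step = bump"
  using step_has_deriv by (auto intro: DERIV_imp_deriv)

lemma step_mono: "x \<le> y \<Longrightarrow> step x \<le> step y"
  by (rule DERIV_nonneg_imp_nondecreasing) (auto intro: step_has_deriv bump_nonneg)

lemma step_nonneg: "0 \<le> step x"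
  using step_mono[of "min x 0" x] by (simp add: step_le_0)

lemma step_le_1: "step x \<le> 1"
  using step_mono[of x "max x 1"] by (simp add: step_ge_1)

lemma compact_support_bounded:
  fixes f :: "real \<Rightarrow> real"
  assumes "continuous_on UNIV f" "\<And>x. x \<notin> {a..b} \<Longrightarrow> f x = 0"
  obtains B where "B > 0" "\<And>x. \<bar>f x\<bar> \<le> B"
proof -
  have "bounded (f ` {a..b})"
    using assms(1) by (intro compact_imp_bounded compact_continuous_image) 
      (auto intro: continuous_on_subset)
  then obtain B where "B > 0" "\<forall>x\<in>{a..b}. \<bar>f x\<bar> \<le> B"
    by (auto simp: bounded_pos)
  then show ?thesis using that assms(2) by (metis abs_zero less_imp_le)
qed

lemma bump_bounded: obtains B where "B > 0" "\<And>x. bump x \<le> B"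
  using compact_support_bounded[of bump 0 1] smooth_bump bump_eq_0
  by (metis abs_le_D1 atLeastAtMost_iff linear smooth_continuous_on)

lemma bump_deriv_bounded: obtains B where "B > 0" "\<And>x. \<bar>deriv bump x\<bar> \<le> B"
proof (rule compact_support_bounded[of "deriv bump" 0 1])
  show "deriv bump x = 0" if "x \<notin> {0..1}" for x
  proof -
    have "\<forall>\<^sub>F y in nhds x. bump y = 0"
      using that
      by (intro eventually_mono[OF eventually_nhds_in_open[of "- {0..1}" x]]) (auto simp: bump_eq_0)
    then have "deriv bump x = deriv (\<lambda>_. 0) x" by (intro deriv_cong_ev) auto
    then show ?thesis by simp
  qed
qed (auto intro!: smooth_continuous_on smooth_deriv smooth_bump)

section \<open>Iterated integrals and integrability for the Lebesgue-Borel measure\<close>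

lemma lborel_Fubini:
  fixes f :: "'a::euclidean_space \<times> 'b::euclidean_space \<Rightarrow> real"
  assumes "integrable lborel f"
  shows "(LINT x|lborel. LINT y|lborel. f (x, y)) = (LINT z|lborel. f z)"
    and "(LINT y|lborel. LINT x|lborel. f (x, y)) = (LINT z|lborel. f z)"
proof -
  have *: "integrable (lborel \<Otimes>\<^sub>M lborel) f" using assms by (simp add: lborel_prod)
  show "(LINT x|lborel. LINT y|lborel. f (x, y)) = (LINT z|lborel. f z)"
    using lborel_pair.integral_fst'[OF *] by (simp add: lborel_prod)
  have "integrable (lborel \<Otimes>\<^sub>M lborel) (case_prod (\<lambda>x y. f (x, y)))" using * by simp
  from lborel_pair.integral_snd[OF this]
  show "(LINT y|lborel. LINT x|lborel. f (x, y)) = (LINT z|lborel. f z)"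
    by (simp add: lborel_prod)
qed

lemma nn_integral_lborel_iterate:
  fixes u :: "'a::euclidean_space \<times> 'b::euclidean_space \<Rightarrow> ennreal"
  assumes "u \<in> borel_measurable borel"
  shows "(\<integral>\<^sup>+z. u z \<partial>lborel) = (\<integral>\<^sup>+x. \<integral>\<^sup>+y. u (x, y) \<partial>lborel \<partial>lborel)"
  using lborel.nn_integral_fst[of u lborel] assms by (simp add: lborel_prod)

lemma integrable_bounded_support:
  fixes f :: "'a::euclidean_space \<Rightarrow> real"
  assumes [measurable]: "f \<in> borel_measurable borel"
    and "\<And>x. \<bar>f x\<bar> \<le> B" "\<And>x. R < norm x \<Longrightarrow> f x = 0"
  shows "integrable lborel f"
proof (rule Bochner_Integration.integrable_bound)
  show "integrable lborel (\<lambda>x. B * indicat_real (cball 0 R) x)"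
    by (intro integrable_mult_right integrable_real_indicator)
      (use emeasure_lborel_cball_finite[of 0 R] in auto)
  show "AE x in lborel. norm (f x) \<le> norm (B * indicat_real (cball 0 R) x)"
  proof (intro AE_I2)
    fix x
    show "norm (f x) \<le> norm (B * indicat_real (cball 0 R) x)"
      using assms(2)[of x] assms(3)[of x] by (cases "norm x \<le> R") (auto simp: not_le)
  qed
qed simp

section \<open>Moments of the entropy kernel\<close>

text \<open>The profile of \<open>chi\<close> at density one and velocity zero. By scaling, the
  entropies needed below reduce to its moments.\<close>

definition kernel :: "real \<Rightarrow> real \<Rightarrow> real"
  where "kernel \<gamma> z = (max (1 - z\<^sup>2) 0) powr lam \<gamma>"

definition moment :: "nat \<Rightarrow> real \<Rightarrow> real"
  where "moment k \<gamma> = (LINT z|lborel. z ^ k * kernel \<gamma> z)"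

lemma kernel_measurable [measurable]: "kernel \<gamma> \<in> borel_measurable borel"
  unfolding kernel_def[abs_def] by measurable

lemma kernel_nonneg: "0 \<le> kernel \<gamma> z"
  by (simp add: kernel_def)

lemma kernel_eq_0: "1 \<le> \<bar>z\<bar> \<Longrightarrow> kernel \<gamma> z = 0"
  using abs_square_le_1[of z] one_le_power[of "\<bar>z\<bar>" 2] by (simp add: kernel_def max_def)

lemma kernel_pos: "\<bar>z\<bar> < 1 \<Longrightarrow> 0 < kernel \<gamma> z"
  using abs_square_less_1[of z] by (simp add: kernel_def max_def)

text \<open>For \<gamma> > 3 the exponent is negative and the kernel is singular at both ends of its
  support. Since \<open>lam \<gamma> = 1 / (\<gamma> - 1) - 1 / 2\<close> exceeds -1/2, the
  substitution z = 2t - 1 gives a convergent Beta integral.\<close>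

lemma integrable_kernel:
  assumes "\<gamma> > 1"
  shows "integrable lborel (kernel \<gamma>)"
proof -
  define l where "l = lam \<gamma>"
  have "l = 1 / (\<gamma> - 1) - 1 / 2"
    using assms by (simp add: l_def lam_def divide_simps)
  then have l: "l > -1" using assms by (smt (verit) divide_pos_pos field_sum_of_halves)
  have "set_integrable lborel {0..1} (\<lambda>t. t powr (l + 1 - 1) * (1 - t) powr (l + 1 - 1))"
    using l by (intro integrable_Beta) auto
  then have "integrable lborel (\<lambda>t. 4 powr l * (indicat_real {0..1} t * (t powr l * (1 - t) powr l)))"
    by (simp add: set_integrable_def)
  moreover have "4 powr l * (indicat_real {0..1} t * (t powr l * (1 - t) powr l)) = kernel \<gamma> (-1 + 2 * t)" for t
  proof (cases "t \<in> {0..1}")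
    case True
    have "1 - (2 * t - 1)\<^sup>2 = 4 * (t * (1 - t))" by (simp add: power2_eq_square algebra_simps)
    moreover have "0 \<le> t * (1 - t)" using True by simp
    ultimately show ?thesis using True by (simp add: kernel_def max_absorb1 powr_mult l_def)
  next
    case False
    then show ?thesis by (subst kernel_eq_0) auto
  qed
  ultimately have "integrable lborel (\<lambda>t. kernel \<gamma> (-1 + 2 * t))" by simp
  then show ?thesis by (subst (asm) lborel_integrable_real_affine_iff) auto
qed

lemma integrable_moment:
  assumes "\<gamma> > 1"
  shows "integrable lborel (\<lambda>z. z ^ k * kernel \<gamma> z)"
proof (rule Bochner_Integration.integrable_bound[OF integrable_kernel[OF assms]])
  show "AE z in lborel. norm (z ^ k * kernel \<gamma> z) \<le> norm (kernel \<gamma> z)"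
  proof (intro AE_I2)
    fix z :: real
    show "norm (z ^ k * kernel \<gamma> z) \<le> norm (kernel \<gamma> z)"
    proof (cases "\<bar>z\<bar> < 1")
      case True
      then have "\<bar>z\<bar> ^ k \<le> 1" by (simp add: power_le_one)
      then show ?thesis by (simp add: abs_mult power_abs kernel_nonneg mult_left_le_one_le)
    qed (simp add: kernel_eq_0)
  qed
qed simp

lemma moment_even_pos:
  assumes "\<gamma> > 1" "even k"
  shows "0 < moment k \<gamma>"
proof (rule ccontr)
  have nn: "0 \<le> z ^ k * kernel \<gamma> z" for z :: real
    using assms by (simp add: kernel_nonneg zero_le_even_power)
  assume "\<not> ?thesis"
  moreover have "0 \<le> moment k \<gamma>" by (simp add: moment_def nn)
  ultimately have "moment k \<gamma> = 0" by linarith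
  then have "AE z in lborel. z ^ k * kernel \<gamma> z = 0"
    using integral_nonneg_eq_0_iff_AE[OF integrable_moment[OF assms(1)]] nn by (simp add: moment_def)
  then have "AE z in lborel. z \<notin> {0<..<1::real}"
  proof (elim AE_mp, intro AE_I2 impI notI)
    fix z :: real assume "z ^ k * kernel \<gamma> z = 0" "z \<in> {0<..<1}"
    then show False using kernel_pos[of z \<gamma>] by auto
  qed
  then have "{0<..<1::real} \<in> null_sets lborel"
    by (subst (asm) AE_iff_null_sets[symmetric]) auto
  then show False by (simp add: null_sets_def)
qed

text \<open>The kernel is even, so reflection changes the sign of the integral.\<close>

lemma moment_1: "moment 1 \<gamma> = 0"
proof -
  have "moment 1 \<gamma> = - moment 1 \<gamma>"
    unfolding moment_def
    by (subst lborel_integral_real_affine[of "-1" _ 0]) (simp_all add: kernel_def)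
  then show ?thesis by simp
qed

text \<open>The exponents are tuned so that
  \<open>theta \<gamma> + 2 * theta \<gamma> * lam \<gamma> = 1\<close>: the Jacobian
  \<open>r powr theta \<gamma>\<close> of the substitution and the scaling factor of
  \<open>chi\<close> multiply to \<open>r\<close>. This is why an entropy is the density times a
  weighted integral of its generator around \<open>v\<close>.\<close>

lemma integral_chi:
  assumes "\<gamma> > 1" "r > 0"
  shows "(LINT s|lborel. f s * chi \<gamma> s r v)
    = r * (LINT z|lborel. f (v + r powr theta \<gamma> * z) * kernel \<gamma> z)"
proof -
  define R where "R = r powr theta \<gamma>"
  have R: "R > 0" "R\<^sup>2 = r powr (2 * theta \<gamma>)"
    using assms by (simp_all add: R_def powr_power)
  have e: "R * R\<^sup>2 powr lam \<gamma> = r"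
  proof -
    have "theta \<gamma> + 2 * theta \<gamma> * lam \<gamma> = 1"
      using assms by (simp add: theta_def lam_def field_simps)
    then have "r powr theta \<gamma> * r powr (2 * theta \<gamma> * lam \<gamma>) = r"
      using assms by (simp flip: powr_add)
    then show ?thesis
      unfolding R by (simp add: R_def powr_powr)
  qed
  have c: "chi \<gamma> (v + R * z) r v = R\<^sup>2 powr lam \<gamma> * kernel \<gamma> z" for z
  proof -
    have "max (R\<^sup>2 - (R * z)\<^sup>2) 0 = R\<^sup>2 * max (1 - z\<^sup>2) 0"
      using mult_left_mono[of 1 "z\<^sup>2" "R\<^sup>2"] mult_left_mono[of "z\<^sup>2" 1 "R\<^sup>2"]
      by (cases "z\<^sup>2 \<le> 1") (simp_all add: power_mult_distrib max_def algebra_simps)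
    then show ?thesis
      by (simp add: chi_def kernel_def R powr_mult flip: R(2))
  qed
  have "(LINT s|lborel. f s * chi \<gamma> s r v) = R * (LINT z|lborel. f (v + R * z) * chi \<gamma> (v + R * z) r v)"
    using R by (subst lborel_integral_real_affine[of R _ v]) auto
  also have "\<dots> = R * (LINT z|lborel. R\<^sup>2 powr lam \<gamma> * (f (v + R * z) * kernel \<gamma> z))"
    unfolding c by (simp only: mult.left_commute)
  also have "\<dots> = r * (LINT z|lborel. f (v + R * z) * kernel \<gamma> z)"
    by (subst integral_mult_right_zero) (simp only: e mult.assoc[symmetric])
  finally show ?thesis by (simp add: R_def)
qed

text \<open>Expanded around \<open>s = v\<close>, the integrands of \<open>eta\<close> and
  \<open>entropy_flux\<close> for constant and linear generators are \<open>chi\<close> times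
  polynomials of degree at most two. The odd moment drops out, and the second one carries
  \<open>r * r powr (2 * theta \<gamma>) = r powr \<gamma>\<close>, which is where the pressure
  comes from.\<close>

lemma integral_quadratic_chi:
  assumes "\<gamma> > 1" "r \<ge> 0"
  shows "(LINT s|lborel. (a + b * (s - v) + c * (s - v)\<^sup>2) * chi \<gamma> s r v)
    = a * moment 0 \<gamma> * r + c * moment 2 \<gamma> * r powr \<gamma>"
proof (cases "r = 0")
  case True
  have "chi \<gamma> s 0 v = 0" for s by (simp add: chi_def)
  then show ?thesis using True by simp
next
  case False
  define R where "R = r powr theta \<gamma>"
  define g where "g k z = z ^ k * kernel \<gamma> z" for k and z :: real
  have g: "integrable lborel (g k)" "(LINT z|lborel. g k z) = moment k \<gamma>" for k
    using integrable_moment[OF assms(1), of k] unfolding g_def[abs_def] moment_def by auto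
  have r: "r > 0" using False assms by simp
  have e: "r * R\<^sup>2 = r powr \<gamma>"
  proof -
    have "r * R\<^sup>2 = r powr (1 + 2 * theta \<gamma>)"
      using r by (simp add: R_def powr_power powr_add)
    moreover have "1 + 2 * theta \<gamma> = \<gamma>" by (simp add: theta_def field_simps)
    ultimately show ?thesis by simp
  qed
  have "(LINT s|lborel. (a + b * (s - v) + c * (s - v)\<^sup>2) * chi \<gamma> s r v)
    = r * (LINT z|lborel. (a + b * (R * z) + c * (R * z)\<^sup>2) * kernel \<gamma> z)"
    by (subst integral_chi[OF assms(1) r]) (simp add: R_def)
  also have "(LINT z|lborel. (a + b * (R * z) + c * (R * z)\<^sup>2) * kernel \<gamma> z)
    = (LINT z|lborel. a * g 0 z + b * R * g 1 z + c * R\<^sup>2 * g 2 z)"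
    by (intro Bochner_Integration.integral_cong) (auto simp: g_def algebra_simps power2_eq_square)
  also have "\<dots> = a * moment 0 \<gamma> + b * R * moment 1 \<gamma> + c * R\<^sup>2 * moment 2 \<gamma>"
    using g by simp
  also have "r * \<dots> = a * moment 0 \<gamma> * r + c * moment 2 \<gamma> * r powr \<gamma>"
    unfolding moment_1 e[symmetric] by (simp add: algebra_simps)
  finally show ?thesis .
qed

text \<open>Divided by \<open>moment 0 \<gamma>\<close>, these are \<open>k\<close> times density,
  momentum (twice) and momentum flux, with the pressure coefficient in the form of a ratio of
  moments.\<close>

lemma
  assumes "\<gamma> > 1" "r \<ge> 0"
  shows eta_const: "eta \<gamma> (\<lambda>_. k) r v = k * moment 0 \<gamma> * r"
    and eta_linear: "eta \<gamma> (\<lambda>s. k * s) r v = k * moment 0 \<gamma> * (r * v)"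
    and entropy_flux_const: "entropy_flux \<gamma> (\<lambda>_. k) r v = k * moment 0 \<gamma> * (r * v)"
    and entropy_flux_linear: "entropy_flux \<gamma> (\<lambda>s. k * s) r v
      = k * (moment 0 \<gamma> * (r * v\<^sup>2) + theta \<gamma> * moment 2 \<gamma> * r powr \<gamma>)"
proof -
  note I = integral_quadratic_chi[OF assms, of _ _ v]
  show "eta \<gamma> (\<lambda>_. k) r v = k * moment 0 \<gamma> * r"
    using I[of k 0 0] by (simp add: eta_def)
  have "eta \<gamma> (\<lambda>s. k * s) r v
    = (LINT s|lborel. (k * v + k * (s - v) + 0 * (s - v)\<^sup>2) * chi \<gamma> s r v)"
    unfolding eta_def by (intro Bochner_Integration.integral_cong) (auto simp: algebra_simps)
  then show "eta \<gamma> (\<lambda>s. k * s) r v = k * moment 0 \<gamma> * (r * v)"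
    unfolding I by simp
  have "entropy_flux \<gamma> (\<lambda>_. k) r v
    = (LINT s|lborel. (k * v + k * theta \<gamma> * (s - v) + 0 * (s - v)\<^sup>2) * chi \<gamma> s r v)"
    unfolding entropy_flux_def
    by (intro Bochner_Integration.integral_cong) (auto simp: sigma_def algebra_simps)
  then show "entropy_flux \<gamma> (\<lambda>_. k) r v = k * moment 0 \<gamma> * (r * v)"
    unfolding I by simp
  have "entropy_flux \<gamma> (\<lambda>s. k * s) r v = (LINT s|lborel.
    (k * v\<^sup>2 + k * v * (1 + theta \<gamma>) * (s - v) + k * theta \<gamma> * (s - v)\<^sup>2) * chi \<gamma> s r v)"
    unfolding entropy_flux_def
    by (intro Bochner_Integration.integral_cong)
      (auto simp: sigma_def algebra_simps power2_eq_square)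
  then show "entropy_flux \<gamma> (\<lambda>s. k * s) r v
      = k * (moment 0 \<gamma> * (r * v\<^sup>2) + theta \<gamma> * moment 2 \<gamma> * r powr \<gamma>)"
    unfolding I by (simp add: algebra_simps)
qed

lemma
  assumes "\<gamma> > 1" "r \<ge> 0"
  shows geometric_source_const: "geometric_source \<gamma> (\<lambda>_. k) r v = 0"
    and geometric_source_linear: "geometric_source \<gamma> (\<lambda>s. k * s) r v
      = - (k * (theta \<gamma> * moment 2 \<gamma> * r powr \<gamma>))"
proof -
  \<comment> \<open>The formula for \<open>eta\<close> is available for nonnegative densities only,
    so the derivative is computed in a neighbourhood of a positive \<open>r\<close>. For
    \<open>r = 0\<close> the factor \<open>r\<close> in \<open>geometric_source\<close> removes the
    derivative.\<close>
  have D: "deriv (\<lambda>r'. f r') r = c" if "r > 0" "\<And>r'. r' \<ge> 0 \<Longrightarrow> f r' = c * r'" for f c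
  proof -
    have "\<forall>\<^sub>F r' in nhds r. f r' = c * r'"
      using that by (intro eventually_mono[OF eventually_nhds_in_open[of "{0<..}" r]]) auto
    then have "deriv f r = deriv (\<lambda>r'. c * r') r" by (intro deriv_cong_ev) auto
    also have "\<dots> = c" by (rule DERIV_imp_deriv) (auto intro!: derivative_eq_intros)
    finally show ?thesis by simp
  qed
  have "r = 0 \<or> r > 0" using assms by auto
  then show "geometric_source \<gamma> (\<lambda>_. k) r v = 0"
    using D[of "\<lambda>r'. eta \<gamma> (\<lambda>_. k) r' v" "k * moment 0 \<gamma>"] assms
    by (auto simp: geometric_source_def entropy_flux_const eta_const)
  show "geometric_source \<gamma> (\<lambda>s. k * s) r v = - (k * (theta \<gamma> * moment 2 \<gamma> * r powr \<gamma>))"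
    using \<open>r = 0 \<or> r > 0\<close> D[of "\<lambda>r'. eta \<gamma> (\<lambda>s. k * s) r' v" "k * moment 0 \<gamma> * v"] assms
    by (auto simp: geometric_source_def entropy_flux_linear eta_linear)
      (auto simp: algebra_simps power2_eq_square)
qed

text \<open>Affine functions are convex for either sign of \<open>k\<close>. This freedom turns the
  entropy inequality into the two equations for mass and momentum.\<close>

lemma
  shows entropy_generator_const: "entropy_generator (\<lambda>_. k)"
    and entropy_generator_linear: "entropy_generator (\<lambda>s. k * s)"
proof -
  have C: "Ck 2 (\<lambda>_::real. k)" "Ck 2 (\<lambda>s::real. k * s)"
  proof -
    show "Ck 2 (\<lambda>_::real. k)" by simp
    have "Ck (Suc (Suc 0)) (\<lambda>s::real. k * s)"
      by (rule Ck_real_Suc[of _ "\<lambda>_. k"]) (auto intro!: derivative_eq_intros simp del: Ck.simps(2))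
    then show "Ck 2 (\<lambda>s::real. k * s)" by (simp only: numeral_2_eq_2)
  qed
  have "(\<lambda>_. k) \<in> o[at_infinity](\<lambda>s::real. s\<^sup>2)" "(\<lambda>s. k * s) \<in> o[at_infinity](\<lambda>s::real. s\<^sup>2)"
  proof -
    have 1: "((\<lambda>s::real. inverse s) \<longlongrightarrow> 0) at_infinity" by (rule tendsto_inverse_0)
    have e: "eventually (\<lambda>s::real. s \<noteq> 0) at_infinity"
      unfolding eventually_at_infinity by (rule exI[of _ 1]) auto
    show "(\<lambda>s. k * s) \<in> o[at_infinity](\<lambda>s::real. s\<^sup>2)"
    proof (rule smalloI_tendsto)
      have "((\<lambda>s. k * inverse s) \<longlongrightarrow> k * 0) at_infinity" by (intro tendsto_intros 1)
      moreover have "eventually (\<lambda>s. k * inverse s = k * s / s\<^sup>2) at_infinity"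
        using e by eventually_elim (simp add: field_simps power2_eq_square)
      ultimately show "((\<lambda>s. k * s / s\<^sup>2) \<longlongrightarrow> 0) at_infinity"
        by (auto intro: Lim_transform_eventually)
    qed (use e in \<open>auto elim: eventually_mono\<close>)
    show "(\<lambda>_. k) \<in> o[at_infinity](\<lambda>s::real. s\<^sup>2)"
    proof (rule smalloI_tendsto)
      have "((\<lambda>s. k * (inverse s * inverse s)) \<longlongrightarrow> k * (0 * 0)) at_infinity" by (intro tendsto_intros 1)
      moreover have "eventually (\<lambda>s. k * (inverse s * inverse s) = k / s\<^sup>2) at_infinity"
        using e by eventually_elim (simp add: field_simps power2_eq_square)
      ultimately show "((\<lambda>s. k / s\<^sup>2) \<longlongrightarrow> 0) at_infinity"
        by (auto intro: Lim_transform_eventually)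
    qed (use e in \<open>auto elim: eventually_mono\<close>)
  qed
  moreover have "convex_on UNIV (\<lambda>_::real. k)" "convex_on UNIV (\<lambda>s::real. k * s)"
    by (auto simp: convex_on_const algebra_simps intro!: convex_onI)
  ultimately show "entropy_generator (\<lambda>_. k)" "entropy_generator (\<lambda>s. k * s)"
    using C by (simp_all add: entropy_generator_def)
qed

section \<open>Mollification\<close>

text \<open>\<open>measurable_on\<close> supplies the continuous functions. Truncating them at
  \<open>G\<close> does not disturb the limit, because \<open>g\<close> itself stays in that range,
  and provides the majorant for dominated convergence.\<close>

lemma bounded_measurable_ae_continuous_limit:
  fixes g :: "'a::euclidean_space \<Rightarrow> real"
  assumes "g \<in> borel_measurable borel" "\<And>x. \<bar>g x\<bar> \<le> G"
  obtains h where "\<And>n. continuous_on UNIV (h n)" "\<And>n x. \<bar>h n x\<bar> \<le> G"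
    "AE x in lborel. (\<lambda>n::nat. h n x) \<longlonglongrightarrow> g x"
proof -
  have "g measurable_on UNIV"
    using assms by (intro lebesgue_measurable_imp_measurable_on_real) (auto intro: measurable_completion)
  then obtain N h where N: "negligible N" and h: "\<And>n. continuous_on UNIV (h n)"
    "\<And>x. x \<notin> N \<Longrightarrow> (\<lambda>n. h n x) \<longlonglongrightarrow> g x"
    by (auto simp: measurable_on_def)
  define k where "k n x = max (- G) (min G (h n x))" for n :: nat and x
  have G: "0 \<le> G" using assms(2)[of undefined] by linarith
  have "AE x in lebesgue. x \<notin> N"
    using N by (intro AE_not_in) (simp add: negligible_iff_null_sets)
  then have "AE x in lborel. x \<notin> N" by (simp add: AE_completion_iff)
  then have "AE x in lborel. (\<lambda>n. k n x) \<longlonglongrightarrow> g x"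
  proof (elim AE_mp, intro AE_I2 impI)
    fix x assume "x \<notin> N"
    then have "(\<lambda>n. k n x) \<longlonglongrightarrow> max (- G) (min G (g x))"
      unfolding k_def by (intro tendsto_intros h)
    then show "(\<lambda>n. k n x) \<longlonglongrightarrow> g x" using assms(2)[of x] by (simp add: abs_le_iff)
  qed
  moreover have "continuous_on UNIV (k n)" for n
    unfolding k_def[abs_def] by (intro continuous_intros h)
  ultimately show ?thesis using that[of k] G by (auto simp: k_def)
qed

lemma lborel_integral_affine:
  fixes f :: "'a::euclidean_space \<Rightarrow> real"
  assumes [measurable]: "f \<in> borel_measurable borel" and "c \<noteq> 0"
  shows "(LINT x|lborel. f x) = \<bar>c\<bar> ^ DIM('a) * (LINT x|lborel. f (t + c *\<^sub>R x))"
  by (subst lborel_affine[OF assms(2), of t])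
    (simp add: ennreal_power integral_density integral_distr)

text \<open>Continuity of translations, tested against a bounded function of bounded support. As
  \<open>g\<close> is only measurable, \<open>g (x - h k)\<close> may fail to converge pointwise; a
  continuous approximation \<open>c n\<close>, close to \<open>g\<close> in the mean on a ball, is
  inserted and the error divided into three parts.\<close>

lemma tendsto_integral_translation:
  fixes f g :: "'a::euclidean_space \<Rightarrow> real"
  assumes [measurable]: "f \<in> borel_measurable borel" "g \<in> borel_measurable borel"
    and f: "\<And>x. \<bar>f x\<bar> \<le> F" "\<And>x. R < norm x \<Longrightarrow> f x = 0" and g: "\<And>x. \<bar>g x\<bar> \<le> G"
    and h: "h \<longlonglongrightarrow> 0"
  shows "(\<lambda>k. LINT x|lborel. f x * g (x - h k)) \<longlonglongrightarrow> (LINT x|lborel. f x * g x)"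
proof (rule LIMSEQ_I)
  fix e :: real assume e: "e > 0"
  have F: "0 \<le> F" using f(1)[of 0] by linarith
  have G: "0 \<le> G" using g[of 0] by linarith
  obtain c where c: "\<And>n. continuous_on UNIV (c n)" "\<And>n x. \<bar>c n x\<bar> \<le> G"
    "AE x in lborel. (\<lambda>n::nat. c n x) \<longlonglongrightarrow> g x"
    using bounded_measurable_ae_continuous_limit[OF assms(2) g] by blast
  have [measurable]: "c n \<in> borel_measurable borel" for n
    using c(1) by (rule borel_measurable_continuous_onI)
  \<comment> \<open>The radius \<open>R + 1\<close> accommodates all shifts of norm at most one:
    \<open>x - d\<close> is in this ball whenever \<open>f x\<close> is nonzero.\<close>
  let ?I = "indicat_real (cball 0 (R + 1))"
  define E where "E n = (LINT x|lborel. F * (?I x * \<bar>g x - c n x\<bar>))" for n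
  have Ib: "integrable lborel (\<lambda>x::'a. K * ?I x)" for K :: real
    using emeasure_lborel_cball_finite[of "0::'a" "R + 1"]
    by (intro integrable_mult_right integrable_real_indicator) auto
  have [measurable]: "cball (0::'a) (R + 1) \<in> sets borel" by (intro borel_closed closed_cball)
  have "E \<longlonglongrightarrow> (LINT x::'a|lborel. 0)"
    unfolding E_def
  proof (rule integral_dominated_convergence)
    show "integrable lborel (\<lambda>x::'a. F * (2 * G) * ?I x)" by (rule Ib)
    show "AE x in lborel. (\<lambda>n. F * (?I x * \<bar>g x - c n x\<bar>)) \<longlonglongrightarrow> 0"
      using c(3)
    proof (elim AE_mp, intro AE_I2 impI)
      fix x assume "(\<lambda>n. c n x) \<longlonglongrightarrow> g x"
      then have "(\<lambda>n. F * (?I x * \<bar>g x - c n x\<bar>)) \<longlonglongrightarrow> F * (?I x * \<bar>g x - g x\<bar>)"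
        by (intro tendsto_intros)
      then show "(\<lambda>n. F * (?I x * \<bar>g x - c n x\<bar>)) \<longlonglongrightarrow> 0" by simp
    qed
    show "AE x in lborel. norm (F * (?I x * \<bar>g x - c n x\<bar>)) \<le> F * (2 * G) * ?I x" for n
    proof (intro AE_I2)
      fix x
      have "\<bar>g x - c n x\<bar> \<le> 2 * G" using g[of x] c(2)[of n x] by linarith
      then show "norm (F * (?I x * \<bar>g x - c n x\<bar>)) \<le> F * (2 * G) * ?I x"
        using F by (auto simp: indicator_def abs_mult intro!: mult_left_mono)
    qed
  qed simp_all
  then have "\<forall>\<^sub>F n in sequentially. E n < e / 3"
    using e by (intro order_tendstoD(2)[of E 0]) auto
  then obtain n where n: "E n < e / 3" by (auto simp: eventually_sequentially)
  have le_F: "\<bar>f x\<bar> \<le> F * ?I y" if "norm (x - y) \<le> 1" for x y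
  proof (cases "norm x \<le> R")
    case True
    then have "norm y \<le> R + 1" using that norm_triangle_sub[of y x] by (simp add: norm_minus_commute)
    then show ?thesis using f(1)[of x] by simp
  qed (use F f(2) in \<open>auto simp: not_le\<close>)
  have int: "integrable lborel (\<lambda>x. f x * u x)"
    if [measurable]: "u \<in> borel_measurable borel" and "\<And>x. \<bar>u x\<bar> \<le> U" for u U
  proof (rule integrable_bounded_support[of _ "F * U" R])
    fix x show "\<bar>f x * u x\<bar> \<le> F * U"
      using that(2) f(1) F by (simp add: abs_mult mult_mono)
  qed (auto simp: f)
  have intD: "integrable lborel (\<lambda>x. F * (?I x * \<bar>g x - c n x\<bar>))"
  proof (rule Bochner_Integration.integrable_bound[OF Ib[of "F * (2 * G)"]])
    show "AE x in lborel. norm (F * (?I x * \<bar>g x - c n x\<bar>)) \<le> norm (F * (2 * G) * ?I x)"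
    proof (intro AE_I2)
      fix x
      have "\<bar>g x - c n x\<bar> \<le> 2 * G" using g[of x] c(2)[of n x] by linarith
      then show "norm (F * (?I x * \<bar>g x - c n x\<bar>)) \<le> norm (F * (2 * G) * ?I x)"
        using F G by (auto simp: indicator_def abs_mult intro!: mult_left_mono)
    qed
  qed simp
  \<comment> \<open>Translation invariance transfers the error to the unshifted difference of
    \<open>g\<close> and \<open>c n\<close>, so that one \<open>n\<close> serves all small shifts
    and, with \<open>d = 0\<close>, also the limit.\<close>
  have shift: "\<bar>(LINT x|lborel. f x * g (x - d)) - (LINT x|lborel. f x * c n (x - d))\<bar> \<le> E n"
    if d: "norm d \<le> 1" for d
  proof -
    have tr: "(LINT x|lborel. u (x - d)) = (LINT x|lborel. u x)"
      if "u \<in> borel_measurable borel" for u :: "'a \<Rightarrow> real"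
      using lborel_integral_affine[OF that, of 1 "-d"] by simp
    have "integrable lborel (\<lambda>x. f x * g (x - d))" "integrable lborel (\<lambda>x. f x * c n (x - d))"
      using g c(2) by (auto intro!: int)
    then have "(LINT x|lborel. f x * g (x - d)) - (LINT x|lborel. f x * c n (x - d))
      = (LINT x|lborel. f x * (g (x - d) - c n (x - d)))"
      by (simp add: algebra_simps)
    also have "\<bar>\<dots>\<bar> \<le> (LINT x|lborel. \<bar>f x * (g (x - d) - c n (x - d))\<bar>)"
      using integral_norm_bound[of lborel "\<lambda>x. f x * (g (x - d) - c n (x - d))"] by simp
    also have "\<dots> \<le> (LINT x|lborel. F * (?I (x - d) * \<bar>g (x - d) - c n (x - d)\<bar>))"
    proof (rule integral_mono)
      have "\<bar>g y - c n y\<bar> \<le> 2 * G" for y using g[of y] c(2)[of n y] by linarith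
      then show "integrable lborel (\<lambda>x. \<bar>f x * (g (x - d) - c n (x - d))\<bar>)"
        by (intro integrable_abs int[of _ "2 * G"]) auto
      have "distr lborel borel ((+) (- d)) = (lborel :: 'a measure)" by (rule lborel_distr_plus)
      then show "integrable lborel (\<lambda>x. F * (?I (x - d) * \<bar>g (x - d) - c n (x - d)\<bar>))"
        using intD integrable_distr[of "(+) (-d)" lborel borel "\<lambda>x. F * (?I x * \<bar>g x - c n x\<bar>)"]
        by simp
      show "\<bar>f x * (g (x - d) - c n (x - d))\<bar> \<le> F * (?I (x - d) * \<bar>g (x - d) - c n (x - d)\<bar>)" for x
        using le_F[of x "x - d"] d by (simp add: abs_mult mult_right_mono flip: mult.assoc)
    qed
    also have "\<dots> = E n" unfolding E_def by (rule tr) simp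
    finally show ?thesis .
  qed
  have "(\<lambda>k. LINT x|lborel. f x * c n (x - h k)) \<longlonglongrightarrow> (LINT x|lborel. f x * c n x)"
  proof (rule integral_dominated_convergence)
    show "integrable lborel (\<lambda>x. \<bar>f x * G\<bar>)"
      by (intro integrable_abs int[of _ G]) (use G in auto)
    show "AE x in lborel. (\<lambda>k. f x * c n (x - h k)) \<longlonglongrightarrow> f x * c n x"
    proof (intro AE_I2 tendsto_mult tendsto_const)
      fix x
      have "(\<lambda>k. x - h k) \<longlonglongrightarrow> x - 0" by (intro tendsto_intros h)
      then show "(\<lambda>k. c n (x - h k)) \<longlonglongrightarrow> c n x"
        using c(1)[of n] by (auto simp: continuous_on_eq_continuous_at intro: isCont_tendsto_compose)
    qed
    show "AE x in lborel. norm (f x * c n (x - h k)) \<le> \<bar>f x * G\<bar>" for k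
      using G c(2) by (intro AE_I2) (auto simp: abs_mult intro!: mult_left_mono)
  qed simp_all
  then have "\<forall>\<^sub>F k in sequentially. dist (LINT x|lborel. f x * c n (x - h k)) (LINT x|lborel. f x * c n x) < e / 3"
    using e by (intro tendstoD) auto
  moreover have "\<forall>\<^sub>F k in sequentially. norm (h k) \<le> 1"
    using tendstoD[OF h, of 1] by (auto elim: eventually_mono)
  ultimately have "\<forall>\<^sub>F k in sequentially.
    norm ((LINT x|lborel. f x * g (x - h k)) - (LINT x|lborel. f x * g x)) < e"
  proof eventually_elim
    case (elim k)
    have "\<bar>(LINT x|lborel. f x * g x) - (LINT x|lborel. f x * c n x)\<bar> \<le> E n"
      using shift[of 0] by simp
    then show ?case
      using elim(1) shift[OF elim(2)] n unfolding dist_real_def real_norm_def by linarith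
  qed
  then show "\<exists>no. \<forall>k\<ge>no. norm ((LINT x|lborel. f x * g (x - h k)) - (LINT x|lborel. f x * g x)) < e"
    by (simp add: eventually_sequentially)
qed

text \<open>Substituting y = x - \<epsilon> w makes this an average over \<open>w\<close>, with
  weight \<open>J\<close>, of integrals against translates of \<open>g\<close>. These converge for
  each \<open>w\<close>, and \<open>J\<close> gives the majorant. Both \<open>f\<close> and
  \<open>g\<close> may be discontinuous, as the fields of a flow are.\<close>

lemma tendsto_integral_mollified:
  fixes f g J :: "'a::euclidean_space \<Rightarrow> real"
  assumes [measurable]: "f \<in> borel_measurable borel" "g \<in> borel_measurable borel"
      "J \<in> borel_measurable borel"
    and f: "\<And>x. \<bar>f x\<bar> \<le> F" "\<And>x. R < norm x \<Longrightarrow> f x = 0" and g: "\<And>x. \<bar>g x\<bar> \<le> G"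
    and J: "\<And>x. \<bar>J x\<bar> \<le> K" "\<And>x. R' < norm x \<Longrightarrow> J x = 0" "(LINT x|lborel. J x) = 1"
    and \<epsilon>: "\<And>k. \<epsilon> k > 0" "\<epsilon> \<longlonglongrightarrow> 0"
  shows "(\<lambda>k. LINT x|lborel. LINT y|lborel. f x * g y * (J ((x - y) /\<^sub>R \<epsilon> k) / \<epsilon> k ^ DIM('a)))
    \<longlonglongrightarrow> (LINT x|lborel. f x * g x)"
proof -
  have F: "0 \<le> F" using f(1)[of 0] by linarith
  have G: "0 \<le> G" using g[of 0] by linarith
  have K: "0 \<le> K" using J(1)[of 0] by linarith
  have intJ: "integrable lborel J" using J by (intro integrable_bounded_support[of J K R']) auto
  have intf: "integrable lborel f" using f by (intro integrable_bounded_support[of f F R]) auto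
  define \<tau> where "\<tau> k w = (LINT x|lborel. f x * g (x - \<epsilon> k *\<^sub>R w))" for k w
  have int: "integrable lborel (\<lambda>(x, w). J w * (f x * g (x - \<epsilon> k *\<^sub>R w)))" for k
  proof (rule integrable_bounded_support[of _ "K * (F * G)" "R + R'"])
    show "\<bar>case p of (x, w) \<Rightarrow> J w * (f x * g (x - \<epsilon> k *\<^sub>R w))\<bar> \<le> K * (F * G)" for p
      using F G K f(1) g J(1) by (auto simp: abs_mult split: prod.split intro!: mult_mono)
    fix p :: "'a \<times> 'a" assume "R + R' < norm p"
    then have "R < norm (fst p) \<or> R' < norm (snd p)"
      using norm_Pair_le[of "fst p" "snd p"] by auto
    then show "(case p of (x, w) \<Rightarrow> J w * (f x * g (x - \<epsilon> k *\<^sub>R w))) = 0"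
      using f(2) J(2) by (auto split: prod.split)
  qed (simp add: borel_prod[symmetric])
  have "(LINT x|lborel. LINT y|lborel. f x * g y * (J ((x - y) /\<^sub>R \<epsilon> k) / \<epsilon> k ^ DIM('a)))
    = (LINT w|lborel. J w * \<tau> k w)" for k
  proof -
    have "(LINT y|lborel. f x * g y * (J ((x - y) /\<^sub>R \<epsilon> k) / \<epsilon> k ^ DIM('a)))
      = (LINT w|lborel. J w * (f x * g (x - \<epsilon> k *\<^sub>R w)))" for x
    proof -
      have e: "x - (x - \<epsilon> k *\<^sub>R w) = \<epsilon> k *\<^sub>R w" for w by simp
      have "(LINT y|lborel. f x * g y * (J ((x - y) /\<^sub>R \<epsilon> k) / \<epsilon> k ^ DIM('a)))
        = \<epsilon> k ^ DIM('a) * (LINT w|lborel. f x * g (x - \<epsilon> k *\<^sub>R w) * (J w / \<epsilon> k ^ DIM('a)))"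
        using \<epsilon>(1)[of k] by (subst lborel_integral_affine[of _ "- \<epsilon> k" x]) (simp_all add: e)
      also have "\<dots> = (LINT w|lborel. \<epsilon> k ^ DIM('a) * (f x * g (x - \<epsilon> k *\<^sub>R w) * (J w / \<epsilon> k ^ DIM('a))))"
        by (rule integral_mult_right_zero[symmetric])
      also have "\<dots> = (LINT w|lborel. J w * (f x * g (x - \<epsilon> k *\<^sub>R w)))"
        using \<epsilon>(1)[of k] by (intro Bochner_Integration.integral_cong) auto
      finally show ?thesis .
    qed
    then have "(LINT x|lborel. LINT y|lborel. f x * g y * (J ((x - y) /\<^sub>R \<epsilon> k) / \<epsilon> k ^ DIM('a)))
      = (LINT x|lborel. LINT w|lborel. J w * (f x * g (x - \<epsilon> k *\<^sub>R w)))" by simp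
    also have "\<dots> = (LINT w|lborel. LINT x|lborel. J w * (f x * g (x - \<epsilon> k *\<^sub>R w)))"
      using lborel_Fubini[OF int[of k]] by simp
    finally show ?thesis by (simp add: \<tau>_def)
  qed
  moreover have "(\<lambda>k. LINT w|lborel. J w * \<tau> k w) \<longlonglongrightarrow> (LINT w|lborel. J w * (LINT x|lborel. f x * g x))"
  proof (rule integral_dominated_convergence)
    show "integrable lborel (\<lambda>w. \<bar>J w * (LINT x|lborel. \<bar>f x * G\<bar>)\<bar>)"
      using intJ by (intro integrable_abs integrable_mult_left) auto
    show "AE w in lborel. (\<lambda>k. J w * \<tau> k w) \<longlonglongrightarrow> J w * (LINT x|lborel. f x * g x)"
    proof (intro AE_I2 tendsto_mult tendsto_const)
      fix w :: 'a
      have "(\<lambda>k. \<epsilon> k *\<^sub>R w) \<longlonglongrightarrow> 0 *\<^sub>R w" by (intro tendsto_intros \<epsilon>)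
      then show "(\<lambda>k. \<tau> k w) \<longlonglongrightarrow> (LINT x|lborel. f x * g x)"
        unfolding \<tau>_def using f g by (intro tendsto_integral_translation[of f g F R G]) auto
    qed
    show "AE w in lborel. norm (J w * \<tau> k w) \<le> \<bar>J w * (LINT x|lborel. \<bar>f x * G\<bar>)\<bar>" for k
    proof (intro AE_I2)
      fix w
      have "\<bar>\<tau> k w\<bar> \<le> (LINT x|lborel. \<bar>f x * g (x - \<epsilon> k *\<^sub>R w)\<bar>)"
        unfolding \<tau>_def using integral_norm_bound[of lborel "\<lambda>x. f x * g (x - \<epsilon> k *\<^sub>R w)"] by simp
      also have "\<dots> \<le> (LINT x|lborel. \<bar>f x * G\<bar>)"
      proof (rule integral_mono)
        show "integrable lborel (\<lambda>x. \<bar>f x * g (x - \<epsilon> k *\<^sub>R w)\<bar>)"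
        proof (intro integrable_abs integrable_bounded_support[of _ "F * G" R])
          show "\<bar>f x * g (x - \<epsilon> k *\<^sub>R w)\<bar> \<le> F * G" for x
            using f(1) g F by (simp add: abs_mult mult_mono)
        qed (auto simp: f)
        show "\<bar>f x * g (x - \<epsilon> k *\<^sub>R w)\<bar> \<le> \<bar>f x * G\<bar>" for x
          using g G by (auto simp: abs_mult intro!: mult_left_mono)
      qed (use intf in auto)
      finally show "norm (J w * \<tau> k w) \<le> \<bar>J w * (LINT x|lborel. \<bar>f x * G\<bar>)\<bar>"
        by (simp add: abs_mult mult_left_mono)
    qed
    show "(\<lambda>w. J w * \<tau> k w) \<in> borel_measurable lborel" for k
      unfolding \<tau>_def by measurable
  qed simp
  ultimately show ?thesis using J(3) by simp
qed

section \<open>Doubling of variables\<close>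

lemma deriv_eq_0_on_open:
  fixes f :: "real \<Rightarrow> real"
  assumes "open U" "x \<in> U" "\<And>y. y \<in> U \<Longrightarrow> f y = k"
  shows "deriv f x = 0"
proof -
  have "\<forall>\<^sub>F y in nhds x. f y = k"
    using assms by (intro eventually_mono[OF eventually_nhds_in_open[of U x]]) auto
  then have "deriv f x = deriv (\<lambda>_. k) x" by (intro deriv_cong_ev) auto
  then show ?thesis by simp
qed

lemma deriv_eq_0_outside:
  fixes f :: "real \<Rightarrow> real"
  assumes "\<And>x. x \<notin> {l..r} \<Longrightarrow> f x = 0" "x \<notin> {l..r}"
  shows "deriv f x = 0"
  using assms by (intro deriv_eq_0_on_open[of "- {l..r}" x f 0]) auto

lemma deriv_mult_smooth:
  assumes "smooth f" "smooth g"
  shows "deriv (\<lambda>x. f x * g x) x = deriv f x * g x + f x * deriv g x"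
  by (rule DERIV_imp_deriv) (auto intro!: derivative_eq_intros smooth_has_deriv assms)

lemma deriv_affine_smooth:
  assumes "smooth f"
  shows "deriv (\<lambda>x. f (k * x + b)) x = k * deriv f (k * x + b)"
proof (rule DERIV_imp_deriv)
  have "((\<lambda>x. f (k * x + b)) has_real_derivative deriv f (k * x + b) * k) (at x)"
    by (rule DERIV_chain2[OF smooth_has_deriv[OF assms]]) (auto intro!: derivative_eq_intros)
  then show "((\<lambda>x. f (k * x + b)) has_real_derivative k * deriv f (k * x + b)) (at x)"
    by (simp add: mult.commute)
qed

lemma deriv_shift_smooth: "smooth f \<Longrightarrow> deriv (\<lambda>x. f (x - b)) x = deriv f (x - b)"
  using deriv_affine_smooth[of f 1 "-b" x] by simp

lemma deriv_reflect_smooth: "smooth f \<Longrightarrow> deriv (\<lambda>x. f (b - x)) x = - deriv f (b - x)"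
  using deriv_affine_smooth[of f "-1" b x] by simp

lemma smooth_shift: "smooth f \<Longrightarrow> smooth (\<lambda>x::real. f (x - b))"
  using smooth_affine[of f 1 "-b"] by simp

section \<open>The mollifier and the mollified Heaviside function\<close>

definition mollifier :: "real \<Rightarrow> real \<Rightarrow> real"
  where "mollifier \<epsilon> x = bump (x / \<epsilon>) / \<epsilon>"

definition mollified_step :: "real \<Rightarrow> real \<Rightarrow> real"
  where "mollified_step \<epsilon> x = step (x / \<epsilon>)"

lemma smooth_mollifier: "smooth (mollifier \<epsilon>)"
proof -
  have "smooth (\<lambda>x. bump (inverse \<epsilon> * x + 0) * inverse \<epsilon>)"
    using smooth_mult[OF smooth_affine[OF smooth_bump] smooth_const] .
  then show ?thesis by (simp add: mollifier_def[abs_def] divide_inverse mult.commute)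
qed

lemma smooth_mollified_step: "smooth (mollified_step \<epsilon>)"
  using smooth_affine[OF smooth_step, of "inverse \<epsilon>" 0]
  by (simp add: mollified_step_def[abs_def] divide_inverse mult.commute)

lemma deriv_mollified_step: "deriv (mollified_step \<epsilon>) = mollifier \<epsilon>"
proof
  fix x
  show "deriv (mollified_step \<epsilon>) x = mollifier \<epsilon> x"
    using deriv_affine_smooth[OF smooth_step, of "inverse \<epsilon>" 0 x]
    by (simp add: mollified_step_def[abs_def] mollifier_def divide_inverse mult.commute deriv_step)
qed

lemma mollifier_nonneg: "\<epsilon> > 0 \<Longrightarrow> 0 \<le> mollifier \<epsilon> x"
  by (simp add: mollifier_def bump_nonneg)

lemma mollifier_eq_0: "\<epsilon> > 0 \<Longrightarrow> x \<notin> {0..\<epsilon>} \<Longrightarrow> mollifier \<epsilon> x = 0"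
  using bump_eq_0[of "x / \<epsilon>"] by (auto simp: mollifier_def divide_le_0_iff)

lemma nn_integral_bump: "(\<integral>\<^sup>+x. ennreal (bump x) \<partial>lborel) = 1"
  using integrable_bump integral_bump by (simp add: nn_integral_eq_integral bump_nonneg)

lemma nn_integral_bump_affine:
  assumes "k \<noteq> 0"
  shows "(\<integral>\<^sup>+x. ennreal (\<bar>k\<bar> * bump (b + k * x)) \<partial>lborel) = 1"
proof -
  have [measurable]: "bump \<in> borel_measurable borel" by (intro smooth_measurable smooth_bump)
  show ?thesis
    using nn_integral_real_affine[of "\<lambda>x. ennreal (bump x)" k b] assms nn_integral_bump
    by (simp add: ennreal_mult bump_nonneg nn_integral_cmult)
qed

lemma nn_integral_mollifier:
  assumes "\<epsilon> > 0"
  shows "(\<integral>\<^sup>+s. ennreal (mollifier \<epsilon> (t - s)) \<partial>lborel) = 1"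
  using nn_integral_bump_affine[of "- (1 / \<epsilon>)" "t / \<epsilon>"] assms
  by (simp add: mollifier_def diff_divide_distrib mult.commute)

lemma mollified_step_simps:
  assumes "\<epsilon> > 0"
  shows "x \<le> 0 \<Longrightarrow> mollified_step \<epsilon> x = 0" "\<epsilon> \<le> x \<Longrightarrow> mollified_step \<epsilon> x = 1"
    "0 \<le> mollified_step \<epsilon> x" "mollified_step \<epsilon> x \<le> 1"
  using assms by (auto simp: mollified_step_def step_nonneg step_le_1 divide_le_0_iff
    intro!: step_le_0 step_ge_1)

text \<open>The class of all factors of the doubled integrands. It is stable under sums, products
  and continuous substitutions, so the integrability of long expressions reduces to the boundedness
  of their support.\<close>

definition locally_bounded :: "('a::euclidean_space \<Rightarrow> real) \<Rightarrow> bool"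
  where "locally_bounded f \<longleftrightarrow> f \<in> borel_measurable borel \<and> (\<forall>R. \<exists>B. \<forall>x. norm x \<le> R \<longrightarrow> \<bar>f x\<bar> \<le> B)"

lemma locally_bounded_mult:
  assumes "locally_bounded f" "locally_bounded g"
  shows "locally_bounded (\<lambda>x. f x * g x)"
  unfolding locally_bounded_def
proof (intro conjI allI)
  show "(\<lambda>x. f x * g x) \<in> borel_measurable borel"
    using assms by (intro borel_measurable_times) (auto simp: locally_bounded_def)
  fix R
  obtain B1 B2 where "\<And>x. norm x \<le> R \<Longrightarrow> \<bar>f x\<bar> \<le> B1" "\<And>x. norm x \<le> R \<Longrightarrow> \<bar>g x\<bar> \<le> B2"
    using assms unfolding locally_bounded_def by metis
  then show "\<exists>B. \<forall>x. norm x \<le> R \<longrightarrow> \<bar>f x * g x\<bar> \<le> B"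
    by (intro exI[of _ "B1 * B2"] allI impI) (force simp: abs_mult intro!: mult_mono)
qed

lemma locally_bounded_add:
  assumes "locally_bounded f" "locally_bounded g"
  shows "locally_bounded (\<lambda>x. f x + g x)"
  unfolding locally_bounded_def
proof (intro conjI allI)
  show "(\<lambda>x. f x + g x) \<in> borel_measurable borel"
    using assms by (intro borel_measurable_add) (auto simp: locally_bounded_def)
  fix R
  obtain B1 B2 where "\<And>x. norm x \<le> R \<Longrightarrow> \<bar>f x\<bar> \<le> B1" "\<And>x. norm x \<le> R \<Longrightarrow> \<bar>g x\<bar> \<le> B2"
    using assms unfolding locally_bounded_def by metis
  then show "\<exists>B. \<forall>x. norm x \<le> R \<longrightarrow> \<bar>f x + g x\<bar> \<le> B"
    by (intro exI[of _ "B1 + B2"] allI impI) (smt (verit))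
qed

lemma locally_bounded_minus:
  "locally_bounded f \<Longrightarrow> locally_bounded (\<lambda>x. - f x)"
  unfolding locally_bounded_def by auto

lemma locally_bounded_diff:
  "locally_bounded f \<Longrightarrow> locally_bounded g \<Longrightarrow> locally_bounded (\<lambda>x. f x - g x)"
  using locally_bounded_add[OF _ locally_bounded_minus, of f g] by simp

lemma locally_bounded_compose:
  fixes \<phi> :: "'b::euclidean_space \<Rightarrow> 'a::euclidean_space"
  assumes "locally_bounded f" "continuous_on UNIV \<phi>"
  shows "locally_bounded (\<lambda>x. f (\<phi> x))"
  unfolding locally_bounded_def
proof (intro conjI allI)
  have [measurable]: "\<phi> \<in> borel_measurable borel"
    using assms(2) by (rule borel_measurable_continuous_onI)
  have [measurable]: "f \<in> borel_measurable borel"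
    using assms(1) by (simp add: locally_bounded_def)
  show "(\<lambda>x. f (\<phi> x)) \<in> borel_measurable borel" by measurable
  fix R
  have "bounded (\<phi> ` cball 0 R)"
    using assms(2) by (intro compact_imp_bounded compact_continuous_image)
      (auto intro: continuous_on_subset)
  then obtain R' where "\<And>x. norm x \<le> R \<Longrightarrow> norm (\<phi> x) \<le> R'"
    unfolding bounded_iff by (metis imageI mem_cball_0)
  moreover obtain B where "\<And>x. norm x \<le> R' \<Longrightarrow> \<bar>f x\<bar> \<le> B"
    using assms(1) unfolding locally_bounded_def by metis
  ultimately show "\<exists>B. \<forall>x. norm x \<le> R \<longrightarrow> \<bar>f (\<phi> x)\<bar> \<le> B" by blast
qed

lemma locally_bounded_continuous:
  fixes f :: "'a::euclidean_space \<Rightarrow> real"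
  assumes "continuous_on UNIV f"
  shows "locally_bounded f"
proof -
  have "locally_bounded (\<lambda>x::real. x)"
    unfolding locally_bounded_def by auto
  from locally_bounded_compose[OF this assms] show ?thesis by simp
qed

lemma locally_bounded_smooth: "smooth f \<Longrightarrow> locally_bounded f"
  by (intro locally_bounded_continuous smooth_continuous_on)

lemma locally_bounded_integrable:
  assumes "locally_bounded f" "\<And>x. R < norm x \<Longrightarrow> f x = 0"
  shows "integrable lborel f"
proof -
  obtain B where B: "\<And>x. norm x \<le> R \<Longrightarrow> \<bar>f x\<bar> \<le> B"
    using assms(1) unfolding locally_bounded_def by metis
  have "\<bar>f x\<bar> \<le> max B 0" for x
    using B[of x] assms(2)[of x] by (cases "norm x \<le> R") auto
  then show ?thesis
    using assms by (intro integrable_bounded_support[of f "max B 0" R]) (auto simp: locally_bounded_def)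
qed

section \<open>Integrals over two copies of space-time\<close>

type_synonym plane_pair = "(real \<times> real) \<times> (real \<times> real)"

lemma norm_quadruple_le:
  fixes w :: plane_pair
  shows "norm w \<le> \<bar>fst (fst w)\<bar> + \<bar>snd (fst w)\<bar> + \<bar>fst (snd w)\<bar> + \<bar>snd (snd w)\<bar>"
  using norm_Pair_le[of "fst w" "snd w"] norm_Pair_le[of "fst (fst w)" "snd (fst w)"]
    norm_Pair_le[of "fst (snd w)" "snd (snd w)"] by simp

lemma
  shows borel_measurable_fst [measurable]:
      "(fst :: 'a::second_countable_topology \<times> 'b::second_countable_topology \<Rightarrow> 'a) \<in> borel \<rightarrow>\<^sub>M borel"
    and borel_measurable_snd [measurable]:
      "(snd :: 'a::second_countable_topology \<times> 'b::second_countable_topology \<Rightarrow> 'b) \<in> borel \<rightarrow>\<^sub>M borel"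
  by (auto intro!: borel_measurable_continuous_onI continuous_intros)

text \<open>The mollifier couples the two times, but integrates to one in \<open>s\<close>.
  Integrating the second copy first therefore leaves the product of the two spatial bounds,
  independently of \<epsilon>.\<close>

lemma nn_integral_doubled_le:
  fixes f g :: "real \<times> real \<Rightarrow> ennreal" and k :: "real \<Rightarrow> ennreal" and F G :: ennreal
  assumes [measurable]: "f \<in> borel_measurable borel" "g \<in> borel_measurable borel"
      "k \<in> borel_measurable borel"
    and f: "AE t in lborel. (\<integral>\<^sup>+x. f (t, x) \<partial>lborel) \<le> F"
    and g: "AE t in lborel. (\<integral>\<^sup>+x. g (t, x) \<partial>lborel) \<le> G"
    and "\<epsilon> > 0"
  shows "(\<integral>\<^sup>+w. f (fst w) * g (snd w) * (k (fst (fst w)) * ennreal (mollifier \<epsilon> (fst (fst w) - fst (snd w)))) \<partial>lborel)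
    \<le> F * G * (\<integral>\<^sup>+t. k t \<partial>lborel)"
proof -
  have [measurable]: "mollifier \<epsilon> \<in> borel_measurable borel"
    by (intro smooth_measurable smooth_mollifier)
  let ?J = "\<lambda>t s. ennreal (mollifier \<epsilon> (t - s))"
  have inner: "(\<integral>\<^sup>+z'. g z' * ?J t (fst z') \<partial>lborel) \<le> G" for t
  proof -
    have "(\<integral>\<^sup>+z'. g z' * ?J t (fst z') \<partial>lborel) = (\<integral>\<^sup>+s. \<integral>\<^sup>+y. g (s, y) * ?J t s \<partial>lborel \<partial>lborel)"
      by (subst nn_integral_lborel_iterate) simp_all
    also have "\<dots> = (\<integral>\<^sup>+s. (\<integral>\<^sup>+y. g (s, y) \<partial>lborel) * ?J t s \<partial>lborel)"
      by (intro nn_integral_cong nn_integral_multc) measurable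
    also have "\<dots> \<le> (\<integral>\<^sup>+s. G * ?J t s \<partial>lborel)"
    proof (rule nn_integral_mono_AE)
      show "AE s in lborel. (\<integral>\<^sup>+y. g (s, y) \<partial>lborel) * ?J t s \<le> G * ?J t s"
        using g by eventually_elim (rule mult_right_mono, auto)
    qed
    also have "\<dots> = G"
      by (subst nn_integral_cmult) (simp_all add: nn_integral_mollifier[OF \<open>\<epsilon> > 0\<close>])
    finally show ?thesis .
  qed
  have "(\<integral>\<^sup>+w. f (fst w) * g (snd w) * (k (fst (fst w)) * ?J (fst (fst w)) (fst (snd w))) \<partial>lborel)
    = (\<integral>\<^sup>+z. \<integral>\<^sup>+z'. f z * g z' * (k (fst z) * ?J (fst z) (fst z')) \<partial>lborel \<partial>lborel)"
    by (subst nn_integral_lborel_iterate) simp_all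
  also have "\<dots> = (\<integral>\<^sup>+z. \<integral>\<^sup>+z'. (f z * k (fst z)) * (g z' * ?J (fst z) (fst z')) \<partial>lborel \<partial>lborel)"
    by (intro nn_integral_cong) (simp only: mult_ac)
  also have "\<dots> = (\<integral>\<^sup>+z. (f z * k (fst z)) * (\<integral>\<^sup>+z'. g z' * ?J (fst z) (fst z') \<partial>lborel) \<partial>lborel)"
    by (intro nn_integral_cong nn_integral_cmult) measurable
  also have "\<dots> \<le> (\<integral>\<^sup>+z. (f z * k (fst z)) * G \<partial>lborel)"
    by (intro nn_integral_mono mult_left_mono inner) simp
  also have "\<dots> = (\<integral>\<^sup>+t. \<integral>\<^sup>+x. (f (t, x) * k t) * G \<partial>lborel \<partial>lborel)"
    by (subst nn_integral_lborel_iterate) simp_all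
  also have "\<dots> = (\<integral>\<^sup>+t. \<integral>\<^sup>+x. (k t * G) * f (t, x) \<partial>lborel \<partial>lborel)"
    by (intro nn_integral_cong) (simp only: mult_ac)
  also have "\<dots> = (\<integral>\<^sup>+t. (k t * G) * (\<integral>\<^sup>+x. f (t, x) \<partial>lborel) \<partial>lborel)"
    by (intro nn_integral_cong nn_integral_cmult) measurable
  also have "\<dots> \<le> (\<integral>\<^sup>+t. (k t * G) * F \<partial>lborel)"
  proof (rule nn_integral_mono_AE)
    show "AE t in lborel. (k t * G) * (\<integral>\<^sup>+x. f (t, x) \<partial>lborel) \<le> (k t * G) * F"
      using f by eventually_elim (rule mult_left_mono, auto)
  qed
  also have "\<dots> = (\<integral>\<^sup>+t. F * G * k t \<partial>lborel)"
    by (intro nn_integral_cong) (simp only: mult_ac)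
  also have "\<dots> = F * G * (\<integral>\<^sup>+t. k t \<partial>lborel)"
    by (intro nn_integral_cmult) measurable
  finally show ?thesis .
qed

text \<open>Only \<open>- X\<close> has a majorant; \<open>X\<close> itself may have a large
  positive part. Passing through \<open>ennreal\<close> discards the negative part of
  \<open>- X\<close>, which is harmless for an upper bound.\<close>

lemma doubled_integral_ge:
  fixes f g :: "real \<times> real \<Rightarrow> real" and k :: "real \<Rightarrow> real"
  assumes [measurable]: "f \<in> borel_measurable borel" "g \<in> borel_measurable borel"
      "k \<in> borel_measurable borel"
    and nonneg: "\<And>z. 0 \<le> f z" "\<And>z. 0 \<le> g z" "\<And>t. 0 \<le> k t" "0 \<le> F" "0 \<le> G" "0 \<le> I"
    and bounds: "AE t in lborel. (\<integral>\<^sup>+x. ennreal (f (t, x)) \<partial>lborel) \<le> ennreal F"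
      "AE t in lborel. (\<integral>\<^sup>+x. ennreal (g (t, x)) \<partial>lborel) \<le> ennreal G"
      "(\<integral>\<^sup>+t. ennreal (k t) \<partial>lborel) \<le> ennreal I"
    and \<epsilon>: "0 < \<epsilon>"
    and le: "\<And>w. - X w \<le> f (fst w) * g (snd w) * (k (fst (fst w)) * mollifier \<epsilon> (fst (fst w) - fst (snd w)))"
  shows "- (LINT w|lborel. X w) \<le> F * G * I"
proof -
  have "(\<integral>\<^sup>+w. ennreal (- X w) \<partial>lborel) \<le> (\<integral>\<^sup>+w. ennreal (f (fst w)) * ennreal (g (snd w))
      * (ennreal (k (fst (fst w))) * ennreal (mollifier \<epsilon> (fst (fst w) - fst (snd w)))) \<partial>lborel)"
    using nonneg mollifier_nonneg[OF \<epsilon>] le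
    by (intro nn_integral_mono) (simp add: ennreal_leI flip: ennreal_mult)
  also have "\<dots> \<le> ennreal F * ennreal G * (\<integral>\<^sup>+t. ennreal (k t) \<partial>lborel)"
    by (rule nn_integral_doubled_le) (use bounds \<epsilon> in auto)
  also have "\<dots> \<le> ennreal F * ennreal G * ennreal I" by (intro mult_left_mono bounds) simp
  also have "\<dots> = ennreal (F * G * I)" using nonneg by (simp add: ennreal_mult)
  finally have "(LINT w|lborel. - X w) \<le> F * G * I"
    using nonneg by (intro integral_real_bounded) auto
  then show ?thesis by simp
qed

text \<open>
  The functions \<open>lcut k\<close> cut off at the left end of \<open>\<Omega>\<close>, and \<open>flux_left\<close> expresses that no mass enters
  there. In \<open>source_bound\<close>, \<open>ennreal\<close> truncates \<open>- S\<close> to the negative part of \<open>S\<close>.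
\<close>

locale weak_flow =
  fixes \<Omega> :: "real set" and m p q S :: "real \<times> real \<Rightarrow> real" and lcut :: "nat \<Rightarrow> real \<Rightarrow> real"
    and M P Q N :: real
  assumes measurable_fields [measurable]: "m \<in> borel_measurable borel" "p \<in> borel_measurable borel"
      "q \<in> borel_measurable borel" "S \<in> borel_measurable borel"
    and fields_nonneg: "0 \<le> m z" "0 \<le> q z"
    and momentum_le: "(p z)\<^sup>2 \<le> q z * m z"
    and fields_bounded: "\<exists>B. \<forall>z. \<bar>snd z\<bar> \<le> R \<longrightarrow> \<bar>m z\<bar> \<le> B \<and> \<bar>p z\<bar> \<le> B \<and> \<bar>q z\<bar> \<le> B \<and> \<bar>S z\<bar> \<le> B"
    and momentum_bounded_left: "\<exists>B. \<forall>z. snd z \<le> R \<longrightarrow> \<bar>p z\<bar> \<le> B"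
    and bounds_nonneg: "0 \<le> M" "0 \<le> P" "0 \<le> Q" "0 \<le> N"
    and mass_bound: "AE t in lborel. (\<integral>\<^sup>+x. ennreal (m (t, x)) \<partial>lborel) \<le> ennreal M"
    and momentum_bound: "AE t in lborel. (\<integral>\<^sup>+x. ennreal \<bar>p (t, x)\<bar> \<partial>lborel) \<le> ennreal P"
    and flux_bound: "AE t in lborel. (\<integral>\<^sup>+x. ennreal (q (t, x)) \<partial>lborel) \<le> ennreal Q"
    and source_bound: "AE t in lborel. (\<integral>\<^sup>+x. ennreal (- S (t, x)) \<partial>lborel) \<le> ennreal N"
    and mass_eq: "\<lbrakk>test_function {0<..} a; test_function \<Omega> b; \<And>t. 0 \<le> a t; \<And>x. 0 \<le> b x\<rbrakk> \<Longrightarrow>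
      (LINT z|lborel. m z * deriv a (fst z) * b (snd z) + p z * a (fst z) * deriv b (snd z)) = 0"
    and momentum_eq: "\<lbrakk>test_function {0<..} a; test_function \<Omega> b; \<And>t. 0 \<le> a t; \<And>x. 0 \<le> b x\<rbrakk> \<Longrightarrow>
      (LINT z|lborel. p z * deriv a (fst z) * b (snd z) + q z * a (fst z) * deriv b (snd z)
        + S z * a (fst z) * b (snd z)) = 0"
    and open_\<Omega>: "open \<Omega>"
    and lcut_smooth: "smooth (lcut k)"
    and lcut_range: "0 \<le> lcut k x" "lcut k x \<le> 1"
    and lcut_deriv_nonneg: "0 \<le> deriv (lcut k) x"
    and lcut_support: "\<exists>l. {l..} \<subseteq> \<Omega> \<and> (\<forall>x\<le>l. lcut k x = 0)"
    and lcut_variation: "(\<integral>\<^sup>+x. ennreal (deriv (lcut k) x) \<partial>lborel) \<le> 1"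
    and lcut_eventually: "l \<in> \<Omega> \<Longrightarrow> \<forall>\<^sub>F k in sequentially. \<forall>x\<ge>l. lcut k x = 1"
    and flux_left: "test_function {0<..} \<tau> \<Longrightarrow>
      (\<lambda>k. LINT z|lborel. p z * \<tau> (fst z) * deriv (lcut k) (snd z)) \<longlonglongrightarrow> 0"
begin

lemma locally_bounded_fields:
  "locally_bounded m" "locally_bounded p" "locally_bounded q" "locally_bounded S"
proof -
  have *: "\<exists>B. \<forall>z. norm z \<le> R \<longrightarrow> \<bar>m z\<bar> \<le> B \<and> \<bar>p z\<bar> \<le> B \<and> \<bar>q z\<bar> \<le> B \<and> \<bar>S z\<bar> \<le> B" for R
    using fields_bounded[of R] by (metis norm_snd_le order_trans real_norm_def prod.collapse)
  show "locally_bounded m" "locally_bounded p" "locally_bounded q" "locally_bounded S"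
    unfolding locally_bounded_def using * measurable_fields by meson+
qed

text \<open>As \<epsilon> tends to zero the kernels concentrate on the diagonal of the two
  space-time points, where the first factor becomes the determinant
  \<open>q * m - p\<^sup>2\<close>.\<close>

definition main_integrand :: "(real \<Rightarrow> real) \<Rightarrow> (real \<Rightarrow> real) \<Rightarrow> real \<Rightarrow> plane_pair \<Rightarrow> real"
  where "main_integrand a c \<epsilon> w = (q (fst w) * m (snd w) - p (fst w) * p (snd w))
    * (a (fst (fst w)) * c (snd (fst w)))
    * (mollifier \<epsilon> (fst (fst w) - fst (snd w)) * mollifier \<epsilon> (snd (fst w) - snd (snd w)))"

text \<open>The momentum in \<open>(t, x)\<close> times the mass flux in \<open>(s, y)\<close>
  across the flanks of \<open>d\<close>, restricted by \<open>mollified_step\<close> to points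
  \<open>y < x\<close>.\<close>

definition boundary_integrand ::
    "(real \<Rightarrow> real) \<Rightarrow> (real \<Rightarrow> real) \<Rightarrow> (real \<Rightarrow> real) \<Rightarrow> real \<Rightarrow> plane_pair \<Rightarrow> real"
  where "boundary_integrand a c d \<epsilon> w = p (fst w) * p (snd w) * (a (fst (fst w)) * c (snd (fst w)))
    * (mollifier \<epsilon> (fst (fst w) - fst (snd w)) * mollified_step \<epsilon> (snd (fst w) - snd (snd w)) * deriv d (snd (snd w)))"

text \<open>The sum of the two tested equations is the main term plus four others. Those with
  \<open>deriv a\<close>, \<open>deriv c\<close> and \<open>S\<close> are bounded by dropping
  factors between zero and one and using the bounds per time of the two copies; the fourth is kept.
  For \<open>c\<close> and \<open>S\<close> the signs decide: a rising \<open>c\<close> and a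
  positive \<open>S\<close> contribute with the favourable sign, so a lower bound on the slope and
  the negative part of the source suffice.\<close>

lemma doubled_integrals:
  fixes a c d :: "real \<Rightarrow> real"
  assumes a: "smooth a" "\<And>t. 0 \<le> a t" "\<And>t. t \<notin> {\<delta>..T} \<Longrightarrow> a t = 0"
    and c: "smooth c" "\<And>x. 0 \<le> c x" "\<And>x. c x \<le> 1" "\<And>x. x \<notin> {l..r} \<Longrightarrow> c x = 0" "{l..} \<subseteq> \<Omega>"
    and d: "smooth d" "\<And>x. 0 \<le> d x" "\<And>x. d x \<le> 1" "\<And>x. x \<notin> {l'..r'} \<Longrightarrow> d x = 0" "{l'..} \<subseteq> \<Omega>"
    and \<epsilon>: "0 < \<epsilon>" "\<epsilon> < \<delta>"
    and d_1: "\<And>x. x \<in> {l - \<epsilon>..r} \<Longrightarrow> d x = 1"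
    and slope: "0 \<le> \<kappa>" "\<And>x. - \<kappa> \<le> deriv c x"
    and Va: "0 \<le> Va" "(\<integral>\<^sup>+t. ennreal \<bar>deriv a t\<bar> \<partial>lborel) \<le> ennreal Va"
    and Ia: "0 \<le> Ia" "(\<integral>\<^sup>+t. ennreal (a t) \<partial>lborel) \<le> ennreal Ia"
  shows "integrable lborel (boundary_integrand a c d \<epsilon>)" "integrable lborel (main_integrand a c \<epsilon>)"
    "(LINT w|lborel. main_integrand a c \<epsilon> w)
      \<le> M * (P * Va + (Q * \<kappa> + N) * Ia) - (LINT w|lborel. boundary_integrand a c d \<epsilon> w)"
proof -
  let ?J = "mollifier \<epsilon>" and ?H = "mollified_step \<epsilon>"
  have da: "deriv a t = 0" if "t \<notin> {\<delta>..T}" for t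
    using deriv_eq_0_outside[of \<delta> T a] a(3) that by blast
  have dc: "deriv c x = 0" if "x \<notin> {l..r}" for x
    using deriv_eq_0_outside[of l r c] c(4) that by blast
  have dd: "deriv d x = 0" if "x \<notin> {l'..r'}" for x
    using deriv_eq_0_outside[of l' r' d] d(4) that by blast
  have J0: "?J x = 0" "deriv ?J x = 0" if "x \<notin> {0..\<epsilon>}" for x
    using that deriv_eq_0_outside[of 0 \<epsilon> ?J] mollifier_eq_0[OF \<epsilon>(1)] by blast+
  note lb = locally_bounded_mult locally_bounded_add locally_bounded_diff locally_bounded_minus
  note sm = a(1) c(1) d(1) smooth_deriv[OF a(1)] smooth_deriv[OF c(1)] smooth_deriv[OF d(1)]
    smooth_mollifier[of \<epsilon>] smooth_deriv[OF smooth_mollifier[of \<epsilon>]] smooth_mollified_step[of \<epsilon>]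
  note lbs = sm[THEN locally_bounded_smooth]
  note comp = locally_bounded_compose
  let ?t = "\<lambda>w :: plane_pair. fst (fst w)" and ?x = "\<lambda>w :: plane_pair. snd (fst w)"
  let ?s = "\<lambda>w :: plane_pair. fst (snd w)" and ?y = "\<lambda>w :: plane_pair. snd (snd w)"
  have cont: "continuous_on UNIV ?t" "continuous_on UNIV ?x" "continuous_on UNIV ?s" "continuous_on UNIV ?y"
    "continuous_on UNIV (\<lambda>w. ?t w - ?s w)" "continuous_on UNIV (\<lambda>w. ?x w - ?y w)"
    "continuous_on UNIV (\<lambda>w :: plane_pair. fst w)" "continuous_on UNIV (\<lambda>w :: plane_pair. snd w)"
    by (intro continuous_intros)+
  note lba = lbs(1)[THEN comp, OF cont(1)] lbs(2)[THEN comp, OF cont(2)] lbs(3)[THEN comp, OF cont(4)]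
    lbs(4)[THEN comp, OF cont(1)] lbs(5)[THEN comp, OF cont(2)] lbs(6)[THEN comp, OF cont(4)]
    lbs(7)[THEN comp, OF cont(5)] lbs(7)[THEN comp, OF cont(6)] lbs(8)[THEN comp, OF cont(5)] lbs(9)[THEN comp, OF cont(6)]
    locally_bounded_fields[THEN comp, OF cont(7)] locally_bounded_fields[THEN comp, OF cont(8)]
  \<comment> \<open>A crude radius for the support in four variables. Since \<open>s\<close> is
    confined only through \<open>t - s\<close>, the bounds for \<open>t\<close> enter twice and
    \<epsilon> once.\<close>
  define R where "R = 2 * \<bar>\<delta>\<bar> + 2 * \<bar>T\<bar> + \<bar>\<epsilon>\<bar> + \<bar>l\<bar> + \<bar>r\<bar> + \<bar>l'\<bar> + \<bar>r'\<bar>"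
  have box: "?t w \<notin> {\<delta>..T} \<or> ?x w \<notin> {l..r} \<or> ?t w - ?s w \<notin> {0..\<epsilon>} \<or> ?y w \<notin> {l'..r'}"
    if "R < norm w" for w
  proof (rule ccontr)
    assume "\<not> ?thesis"
    then have "\<bar>?t w\<bar> \<le> \<bar>\<delta>\<bar> + \<bar>T\<bar>" "\<bar>?x w\<bar> \<le> \<bar>l\<bar> + \<bar>r\<bar>"
      "\<bar>?s w\<bar> \<le> \<bar>?t w\<bar> + \<bar>\<epsilon>\<bar>" "\<bar>?y w\<bar> \<le> \<bar>l'\<bar> + \<bar>r'\<bar>"
      by auto
    then show False using that norm_quadruple_le[of w] unfolding R_def by linarith
  qed
  define main where "main w = (q (fst w) * m (snd w) - p (fst w) * p (snd w)) * (a (?t w) * c (?x w) * d (?y w))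
    * (?J (?t w - ?s w) * ?J (?x w - ?y w))" for w
  define It where "It w = m (snd w) * d (?y w) * p (fst w) * c (?x w) * ?H (?x w - ?y w) * deriv a (?t w) * ?J (?t w - ?s w)" for w
  define Ic where "Ic w = m (snd w) * d (?y w) * q (fst w) * deriv c (?x w) * ?H (?x w - ?y w) * a (?t w) * ?J (?t w - ?s w)" for w
  define Is where "Is w = m (snd w) * d (?y w) * S (fst w) * c (?x w) * ?H (?x w - ?y w) * a (?t w) * ?J (?t w - ?s w)" for w
  \<comment> \<open>\<open>A1\<close> is the momentum equation for fixed \<open>(s, y)\<close>, \<open>A2\<close> the mass equation for fixed
    \<open>(t, x)\<close>; the derivatives of \<open>J\<close> cancel in the sum.\<close>
  define A1 where "A1 w = m (snd w) * d (?y w) *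
    (p (fst w) * (deriv a (?t w) * ?J (?t w - ?s w) + a (?t w) * deriv ?J (?t w - ?s w)) * (c (?x w) * ?H (?x w - ?y w))
    + q (fst w) * (a (?t w) * ?J (?t w - ?s w)) * (deriv c (?x w) * ?H (?x w - ?y w) + c (?x w) * ?J (?x w - ?y w))
    + S (fst w) * (a (?t w) * ?J (?t w - ?s w)) * (c (?x w) * ?H (?x w - ?y w)))" for w
  define A2 where "A2 w = p (fst w) * a (?t w) * c (?x w) *
    (m (snd w) * (- deriv ?J (?t w - ?s w)) * (?H (?x w - ?y w) * d (?y w))
    + p (snd w) * ?J (?t w - ?s w) * (- ?J (?x w - ?y w) * d (?y w) + ?H (?x w - ?y w) * deriv d (?y w)))" for w
  note defs = main_def[abs_def] It_def[abs_def] Ic_def[abs_def] Is_def[abs_def] A1_def[abs_def] A2_def[abs_def] boundary_integrand_def[abs_def]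
  have lbd: "locally_bounded main" "locally_bounded It" "locally_bounded Ic" "locally_bounded Is"
    "locally_bounded A1" "locally_bounded A2" "locally_bounded (boundary_integrand a c d \<epsilon>)"
    unfolding defs by (intro lb lba)+
  have zero: "main w = 0" "It w = 0" "Ic w = 0" "Is w = 0" "A1 w = 0" "A2 w = 0"
    "boundary_integrand a c d \<epsilon> w = 0" if "R < norm w" for w
    using box[OF that] a(3) c(4) d(4) da dc dd J0 by (auto simp: defs)
  have int: "integrable lborel main" "integrable lborel It" "integrable lborel Ic" "integrable lborel Is"
    "integrable lborel A1" "integrable lborel A2" "integrable lborel (boundary_integrand a c d \<epsilon>)"
    using lbd zero by (auto intro!: locally_bounded_integrable[of _ R])
  show "integrable lborel (boundary_integrand a c d \<epsilon>)" by fact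
  \<comment> \<open>\<open>d\<close> may be inserted: on the support, \<open>x\<close> is in
    \<open>{l..r}\<close> and \<open>x - y\<close> in \<open>{0..\<epsilon>}\<close>, so
    \<open>y\<close> is in the interval on which \<open>d\<close> is one.\<close>
  have main_eq: "main_integrand a c \<epsilon> = main"
  proof
    fix w
    show "main_integrand a c \<epsilon> w = main w"
    proof (cases "?x w \<in> {l..r} \<and> ?x w - ?y w \<in> {0..\<epsilon>}")
      case True
      then have "d (?y w) = 1" by (intro d_1) auto
      then show ?thesis by (simp add: main_integrand_def main_def)
    next
      case False
      then show ?thesis using c(4) J0(1) by (auto simp: main_integrand_def main_def)
    qed
  qed
  show "integrable lborel (main_integrand a c \<epsilon>)" unfolding main_eq by fact
  have A1_0: "(LINT w|lborel. A1 w) = 0"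
  proof -
    have "(LINT z|lborel. A1 (z, z')) = 0" for z'
    proof -
      have t1: "test_function {0<..} (\<lambda>t. a t * ?J (t - fst z'))"
      proof (rule test_functionI)
        show "smooth (\<lambda>t. a t * ?J (t - fst z'))"
          by (rule smooth_mult[OF a(1) smooth_shift[OF smooth_mollifier]])
        show "{\<delta>..T} \<subseteq> {0<..}" using \<epsilon> by auto
      qed (use a(3) in auto)
      have t2: "test_function \<Omega> (\<lambda>x. c x * ?H (x - snd z'))"
      proof (rule test_functionI)
        show "smooth (\<lambda>x. c x * ?H (x - snd z'))"
          by (rule smooth_mult[OF c(1) smooth_shift[OF smooth_mollified_step]])
        show "{l..r} \<subseteq> \<Omega>" using c(5) by auto
      qed (use c(4) in auto)
      have da: "deriv (\<lambda>t. a t * ?J (t - fst z')) t = deriv a t * ?J (t - fst z') + a t * deriv ?J (t - fst z')" for t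
        by (simp add: deriv_mult_smooth[OF a(1) smooth_shift[OF smooth_mollifier]] deriv_shift_smooth[OF smooth_mollifier])
      have dc: "deriv (\<lambda>x. c x * ?H (x - snd z')) x = deriv c x * ?H (x - snd z') + c x * ?J (x - snd z')" for x
        by (simp add: deriv_mult_smooth[OF c(1) smooth_shift[OF smooth_mollified_step]]
            deriv_shift_smooth[OF smooth_mollified_step] deriv_mollified_step)
      have "(LINT z|lborel. A1 (z, z')) = m z' * d (snd z') * (LINT z|lborel.
          p z * deriv (\<lambda>t. a t * ?J (t - fst z')) (fst z) * (c (snd z) * ?H (snd z - snd z'))
          + q z * (a (fst z) * ?J (fst z - fst z')) * deriv (\<lambda>x. c x * ?H (x - snd z')) (snd z)
          + S z * (a (fst z) * ?J (fst z - fst z')) * (c (snd z) * ?H (snd z - snd z')))"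
        unfolding A1_def da dc by simp
      also have "\<dots> = 0"
        by (subst momentum_eq[OF t1 t2])
          (auto intro!: mult_nonneg_nonneg a c mollifier_nonneg mollified_step_simps \<epsilon>)
      finally show ?thesis .
    qed
    then show ?thesis using lborel_Fubini(2)[OF int(5)] by simp
  qed
  have A2_0: "(LINT w|lborel. A2 w) = 0"
  proof -
    have "(LINT z'|lborel. A2 (z, z')) = 0" for z
    \<comment> \<open>For \<open>t\<close> in \<open>{\<delta>..T}\<close> the support
      \<open>{t - \<epsilon>..t}\<close> of \<open>J(t - s)\<close> consists of positive times
      because \<epsilon> < \<delta>; for other \<open>t\<close> the prefactor \<open>a t\<close> is
      zero.\<close>
    proof (cases "fst z \<in> {\<delta>..T}")
      case True
      have t1: "test_function {0<..} (\<lambda>s. ?J (fst z - s))"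
      proof (rule test_functionI)
        show "smooth (\<lambda>s. ?J (fst z - s))" by (rule smooth_reflect[OF smooth_mollifier])
        show "{fst z - \<epsilon>..fst z} \<subseteq> {0<..}" using \<epsilon> True by auto
      qed (use J0 in auto)
      have t2: "test_function \<Omega> (\<lambda>y. ?H (snd z - y) * d y)"
      proof (rule test_functionI)
        show "smooth (\<lambda>y. ?H (snd z - y) * d y)"
          by (rule smooth_mult[OF smooth_reflect[OF smooth_mollified_step] d(1)])
        show "{l'..r'} \<subseteq> \<Omega>" using d(5) by auto
      qed (use d(4) in auto)
      have da: "deriv (\<lambda>s. ?J (fst z - s)) s = - deriv ?J (fst z - s)" for s
        by (rule deriv_reflect_smooth[OF smooth_mollifier])
      have dc: "deriv (\<lambda>y. ?H (snd z - y) * d y) y = - ?J (snd z - y) * d y + ?H (snd z - y) * deriv d y" for y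
        by (simp add: deriv_mult_smooth[OF smooth_reflect[OF smooth_mollified_step] d(1)]
            deriv_reflect_smooth[OF smooth_mollified_step] deriv_mollified_step)
      have "(LINT z'|lborel. A2 (z, z')) = p z * a (fst z) * c (snd z) * (LINT z'|lborel.
          m z' * deriv (\<lambda>s. ?J (fst z - s)) (fst z') * (?H (snd z - snd z') * d (snd z'))
          + p z' * ?J (fst z - fst z') * deriv (\<lambda>y. ?H (snd z - y) * d y) (snd z'))"
        unfolding A2_def da dc by simp
      also have "\<dots> = 0"
        by (subst mass_eq[OF t1 t2])
          (auto intro!: mult_nonneg_nonneg d mollifier_nonneg mollified_step_simps \<epsilon>)
      finally show ?thesis .
    qed (simp add: A2_def a(3))
    then show ?thesis using lborel_Fubini(1)[OF int(6)] by simp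
  qed
  \<comment> \<open>The mollifiers in space remain: \<open>H\<close> is differentiated in both
    equations, with opposite signs, and yields the two halves of the main term.\<close>
  have eq: "A1 w + A2 w = main w + It w + Ic w + Is w + boundary_integrand a c d \<epsilon> w" for w
    by (simp add: A1_def A2_def main_def It_def Ic_def Is_def boundary_integrand_def algebra_simps)
  have "(LINT w|lborel. A1 w + A2 w) = 0" using int A1_0 A2_0 by simp
  then have "(LINT w|lborel. main w) = - (LINT w|lborel. It w) - (LINT w|lborel. Ic w) - (LINT w|lborel. Is w)
      - (LINT w|lborel. boundary_integrand a c d \<epsilon> w)"
    unfolding eq using int by simp
  moreover
  have [measurable]: "a \<in> borel_measurable borel" "deriv a \<in> borel_measurable borel"
    using a(1) by (auto intro: smooth_measurable smooth_deriv)
  have le1: "0 \<le> d y * c x * ?H h \<and> d y * c x * ?H h \<le> 1" for x y h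
    using d(2,3)[of y] c(2,3)[of x] mollified_step_simps(3,4)[OF \<epsilon>(1), of h]
    by (auto intro!: mult_le_one mult_nonneg_nonneg)
  have le1': "0 \<le> d y * ?H h \<and> d y * ?H h \<le> 1" for y h
    using d(2,3)[of y] mollified_step_simps(3,4)[OF \<epsilon>(1), of h]
    by (auto intro!: mult_le_one mult_nonneg_nonneg)
  have Jn: "0 \<le> ?J h" for h by (rule mollifier_nonneg[OF \<epsilon>(1)])
  have "- (LINT w|lborel. It w) \<le> P * M * Va"
  proof (rule doubled_integral_ge[where f = "\<lambda>z. \<bar>p z\<bar>" and k = "\<lambda>t. \<bar>deriv a t\<bar>"])
    fix w
    define u where "u = \<bar>p (fst w)\<bar> * m (snd w) * (\<bar>deriv a (?t w)\<bar> * ?J (?t w - ?s w))"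
    define h where "h = d (?y w) * c (?x w) * ?H (?x w - ?y w)"
    have "- It w \<le> \<bar>It w\<bar>" by simp
    also have "\<bar>It w\<bar> = h * u"
      using Jn[of "?t w - ?s w"] fields_nonneg(1)[of "snd w"]
      unfolding It_def u_def h_def by (simp add: abs_mult c d mollified_step_simps \<epsilon>)
    also have "\<dots> \<le> u"
      unfolding h_def using le1 Jn fields_nonneg(1)
      by (intro mult_left_le_one_le) (auto simp: u_def)
    finally show "- It w \<le> \<bar>p (fst w)\<bar> * m (snd w) * (\<bar>deriv a (?t w)\<bar> * ?J (?t w - ?s w))"
      by (simp only: u_def)
  qed (use momentum_bound mass_bound bounds_nonneg fields_nonneg Va \<epsilon> in auto)
  moreover have "- (LINT w|lborel. Ic w) \<le> Q * M * (\<kappa> * Ia)"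
  proof (rule doubled_integral_ge[where k = "\<lambda>t. \<kappa> * a t"])
    fix w
    define u where "u = q (fst w) * m (snd w) * (a (?t w) * ?J (?t w - ?s w))"
    define h where "h = d (?y w) * ?H (?x w - ?y w)"
    have u: "0 \<le> u" using Jn fields_nonneg a(2) by (simp add: u_def)
    have h: "0 \<le> h" "h \<le> 1" using le1' by (auto simp: h_def)
    have "- Ic w = (h * (- deriv c (?x w))) * u" by (simp add: Ic_def u_def h_def)
    also have "h * (- deriv c (?x w)) \<le> h * \<kappa>"
      using slope(2)[of "?x w"] h by (intro mult_left_mono) auto
    also have "h * \<kappa> \<le> \<kappa>" using h slope(1) by (intro mult_left_le_one_le) auto
    finally have "- Ic w \<le> \<kappa> * u" using u by (simp add: mult_right_mono)
    then show "- Ic w \<le> q (fst w) * m (snd w) * (\<kappa> * a (?t w) * ?J (?t w - ?s w))"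
      by (simp add: u_def mult_ac)
  next
    show "(\<integral>\<^sup>+t. ennreal (\<kappa> * a t) \<partial>lborel) \<le> ennreal (\<kappa> * Ia)"
      using slope(1) a(2) Ia by (simp add: ennreal_mult nn_integral_cmult mult_left_mono)
  qed (use flux_bound mass_bound bounds_nonneg fields_nonneg slope(1) a(2) Ia \<epsilon> in auto)
  moreover have "- (LINT w|lborel. Is w) \<le> N * M * Ia"
  proof (rule doubled_integral_ge[where f = "\<lambda>z. max (- S z) 0"])
    fix w
    define u where "u = max (- S (fst w)) 0 * m (snd w) * (a (?t w) * ?J (?t w - ?s w))"
    define h where "h = d (?y w) * c (?x w) * ?H (?x w - ?y w)"
    have h: "0 \<le> h" "h \<le> 1" using le1 by (auto simp: h_def)
    have "- Is w = h * (- S (fst w) * (m (snd w) * (a (?t w) * ?J (?t w - ?s w))))"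
      by (simp add: Is_def h_def)
    also have "\<dots> \<le> h * (max (- S (fst w)) 0 * (m (snd w) * (a (?t w) * ?J (?t w - ?s w))))"
      using Jn fields_nonneg a(2) h by (intro mult_left_mono mult_right_mono) auto
    also have "\<dots> = h * u" by (simp add: u_def)
    also have "\<dots> \<le> u" using h Jn fields_nonneg a(2) by (intro mult_left_le_one_le) (auto simp: u_def)
    finally show "- Is w \<le> max (- S (fst w)) 0 * m (snd w) * (a (?t w) * ?J (?t w - ?s w))"
      by (simp only: u_def)
  next
    have "ennreal (max y 0) = ennreal y" for y
      by (cases "0 \<le> y") (simp_all add: ennreal_neg max_def)
    then show "AE t in lborel. (\<integral>\<^sup>+x. ennreal (max (- S (t, x)) 0) \<partial>lborel) \<le> ennreal N"
      using source_bound by simp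
  qed (use mass_bound bounds_nonneg fields_nonneg a(2) Ia \<epsilon> in auto)
  ultimately show "(LINT w|lborel. main_integrand a c \<epsilon> w)
      \<le> M * (P * Va + (Q * \<kappa> + N) * Ia) - (LINT w|lborel. boundary_integrand a c d \<epsilon> w)"
    unfolding main_eq by (simp add: algebra_simps)
qed

end

section \<open>Removal of the left cutoff and passage to the diagonal\<close>

lemma locally_bounded_support_bounded:
  assumes "locally_bounded f" "\<And>x. R < norm x \<Longrightarrow> f x = 0"
  obtains B where "\<And>x. \<bar>f x\<bar> \<le> B"
proof -
  obtain B where B: "\<And>x. norm x \<le> R \<Longrightarrow> \<bar>f x\<bar> \<le> B"
    using assms(1) unfolding locally_bounded_def by metis
  have "\<bar>f x\<bar> \<le> max B 0" for x
    using B[of x] assms(2)[of x] by (cases "norm x \<le> R") auto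
  then show ?thesis using that by blast
qed

lemma locally_bounded_indicator: "B \<in> sets borel \<Longrightarrow> locally_bounded (indicat_real B)"
  unfolding locally_bounded_def by (auto intro!: exI[of _ 1] simp: indicator_def)

text \<open>Puts the product kernel into the form of \<open>tendsto_integral_mollified\<close> in
  dimension two.\<close>

lemma mollifier_product:
  "mollifier \<epsilon> (fst z - fst z') * mollifier \<epsilon> (snd z - snd z')
    = bump (fst ((z - z') /\<^sub>R \<epsilon>)) * bump (snd ((z - z') /\<^sub>R \<epsilon>)) / \<epsilon> ^ DIM(real \<times> real)"
  by (simp add: mollifier_def divide_inverse power2_eq_square mult_ac)

lemma integral_bump_product: "(LINT z|lborel. bump (fst z) * bump (snd z)) = 1"
proof -
  have [measurable]: "bump \<in> borel_measurable borel" by (intro smooth_measurable smooth_bump)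
  have n: "0 \<le> bump (fst z) * bump (snd z)" for z by (simp add: bump_nonneg)
  have "(\<integral>\<^sup>+z. ennreal (bump (fst z) * bump (snd z)) \<partial>lborel)
    = (\<integral>\<^sup>+x. \<integral>\<^sup>+y. ennreal (bump x) * ennreal (bump y) \<partial>lborel \<partial>lborel)"
    by (subst nn_integral_lborel_iterate) (simp_all add: ennreal_mult bump_nonneg)
  also have "\<dots> = 1"
    by (simp add: nn_integral_cmult nn_integral_bump)
  finally show ?thesis
    using n by (subst integral_eq_nn_integral) auto
qed

context weak_flow
begin

text \<open>The left side does not depend on \<open>d\<close>, so \<open>d\<close> may follow the
  left cutoffs and the boundary term be replaced by its limit. For fixed \<open>(t, x)\<close> this
  term is a multiple of the flux through the left end tested with \<open>J(t - s)\<close> as a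
  function of \<open>s\<close>, which tends to zero by \<open>flux_left\<close>; dominated
  convergence does the rest.\<close>

lemma integral_main_integrand_le:
  fixes a c :: "real \<Rightarrow> real"
  assumes a: "smooth a" "\<And>t. 0 \<le> a t" "\<And>t. t \<notin> {\<delta>..T} \<Longrightarrow> a t = 0"
    and c: "smooth c" "\<And>x. 0 \<le> c x" "\<And>x. c x \<le> 1" "\<And>x. x \<notin> {l..r} \<Longrightarrow> c x = 0" "{l..} \<subseteq> \<Omega>"
    and \<epsilon>: "0 < \<epsilon>" "\<epsilon> < \<delta>" "l - \<epsilon> \<in> \<Omega>"
    and slope: "0 \<le> \<kappa>" "\<And>x. - \<kappa> \<le> deriv c x"
    and Va: "0 \<le> Va" "(\<integral>\<^sup>+t. ennreal \<bar>deriv a t\<bar> \<partial>lborel) \<le> ennreal Va"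
    and Ia: "0 \<le> Ia" "(\<integral>\<^sup>+t. ennreal (a t) \<partial>lborel) \<le> ennreal Ia"
  shows "(LINT w|lborel. main_integrand a c \<epsilon> w) \<le> M * (P * Va + (Q * \<kappa> + N) * Ia)"
proof -
  let ?J = "mollifier \<epsilon>" and ?H = "mollified_step \<epsilon>"
  let ?C = "M * (P * Va + (Q * \<kappa> + N) * Ia)"
  \<comment> \<open>The index is shifted by \<open>K\<close> so that every \<open>L k\<close> is one
    to the right of \<open>l - \<epsilon>\<close>, as \<open>doubled_integrals\<close> demands of
    \<open>d\<close>; in particular the slope of \<open>L k\<close> vanishes there.\<close>
  obtain K where K: "\<And>k x. K \<le> k \<Longrightarrow> l - \<epsilon> \<le> x \<Longrightarrow> lcut k x = 1"
    using lcut_eventually[OF \<epsilon>(3)] unfolding eventually_sequentially by metis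
  define L where "L k = lcut (k + K)" for k
  have L: "smooth (L k)" "0 \<le> L k x" "L k x \<le> 1" "0 \<le> deriv (L k) x" "l - \<epsilon> \<le> x \<Longrightarrow> L k x = 1" for k x
    by (auto simp: L_def lcut_smooth lcut_range lcut_deriv_nonneg K)
  have dL0: "deriv (L k) x = 0" if "l - \<epsilon> < x" for k x
    by (rule deriv_eq_0_on_open[of "{l - \<epsilon><..}" x "L k" 1]) (use that L(5) in auto)
  \<comment> \<open>The second factor only makes the support compact. It is one up to
    \<open>r + 1\<close> and falls to the right of every \<open>x\<close> in the support of
    \<open>c\<close>, where \<open>mollified_step\<close> vanishes.\<close>
  define d where "d k y = L k y * step (r + 2 - y)" for k y
  have d_smooth: "smooth (d k)" for k
    unfolding d_def[abs_def] by (rule smooth_mult[OF L(1) smooth_reflect[OF smooth_step]])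
  have d_1: "d k x = L k x" if "x \<le> r + 1" for k x
    using that by (simp add: d_def step_ge_1)
  have d_deriv: "deriv (d k) x = deriv (L k) x" if "x < r + 1" for k x
  proof -
    have "\<forall>\<^sub>F y in nhds x. d k y = L k y"
      using that by (intro eventually_mono[OF eventually_nhds_in_open[of "{..<r + 1}" x]]) (auto simp: d_1)
    then show ?thesis by (intro deriv_cong_ev) auto
  qed
  define B where "B k = (LINT w|lborel. boundary_integrand a c (d k) \<epsilon> w)" for k
  have main: "integrable lborel (boundary_integrand a c (d k) \<epsilon>)"
    "(LINT w|lborel. main_integrand a c \<epsilon> w) \<le> ?C - B k" for k
  proof -
    obtain l' where l': "{l'..} \<subseteq> \<Omega>" "\<And>x. x \<le> l' \<Longrightarrow> L k x = 0"
      using lcut_support[of "k + K"] unfolding L_def by auto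
    have supp: "d k x = 0" if "x \<notin> {l'..r + 2}" for x
    proof (cases "x \<le> l'")
      case False
      then have "step (r + 2 - x) = 0" using that by (intro step_le_0) auto
      then show ?thesis by (simp add: d_def)
    qed (simp add: d_def l')
    have range: "0 \<le> d k x" "d k x \<le> 1" for x
      using L(2,3) step_nonneg step_le_1 by (auto simp: d_def intro!: mult_le_one)
    have one: "d k x = 1" if "x \<in> {l - \<epsilon>..r}" for x
      using that by (subst d_1) (auto intro!: L)
    note * = doubled_integrals[OF a c d_smooth[of k] range supp l'(1) \<epsilon>(1,2) one slope Va Ia]
    show "integrable lborel (boundary_integrand a c (d k) \<epsilon>)" by (rule *(1))
    show "(LINT w|lborel. main_integrand a c \<epsilon> w) \<le> ?C - B k" unfolding B_def by (rule *(3))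
  qed
  define \<Phi> where "\<Phi> k t = (LINT z|lborel. p z * ?J (t - fst z) * deriv (L k) (snd z))" for k t
  have B_eq: "B k = (LINT z|lborel. p z * (a (fst z) * c (snd z)) * \<Phi> k (fst z))" for k
  proof -
    have "(LINT z'|lborel. boundary_integrand a c (d k) \<epsilon> (z, z'))
      = p z * (a (fst z) * c (snd z)) * \<Phi> k (fst z)" for z
    proof (cases "snd z \<in> {l..r}")
      case True
      \<comment> \<open>On the flank of \<open>L k\<close> one has
        \<open>y \<le> x - \<epsilon>\<close>, where \<open>mollified_step\<close> is one. For
        larger \<open>y\<close> the slope of \<open>L k\<close> is zero, and so is the slope of
        \<open>d k\<close> or, from \<open>y = x\<close> on, \<open>mollified_step\<close>.\<close>
      have *: "?H (snd z - y) * deriv (d k) y = deriv (L k) y" for y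
      proof -
        consider "y \<le> snd z - \<epsilon>" | "snd z - \<epsilon> < y" "y < snd z" | "snd z \<le> y" by linarith
        then show ?thesis
        proof cases
          case 1
          then show ?thesis using True \<epsilon>(1) d_deriv[of y k] by (simp add: mollified_step_simps)
        next
          case 2
          then show ?thesis using True dL0[of y k] d_deriv[of y k] by simp
        next
          case 3
          then show ?thesis using True \<epsilon>(1) dL0[of y k] by (simp add: mollified_step_simps)
        qed
      qed
      have "boundary_integrand a c (d k) \<epsilon> (z, z')
        = p z * (a (fst z) * c (snd z)) * (p z' * ?J (fst z - fst z') * deriv (L k) (snd z'))" for z'
        unfolding boundary_integrand_def *[symmetric] by (simp add: mult_ac)
      then show ?thesis by (simp add: \<Phi>_def)
    qed (simp add: boundary_integrand_def c(4))
    then show ?thesis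
      unfolding B_def lborel_Fubini(1)[OF main(1), symmetric] by simp
  qed
  obtain Bp where "\<And>z. snd z \<le> l \<Longrightarrow> \<bar>p z\<bar> \<le> Bp"
    using momentum_bounded_left by metis
  then have Bp: "\<And>z. snd z \<le> l \<Longrightarrow> \<bar>p z\<bar> \<le> Bp" "0 \<le> Bp"
    by (simp, smt (verit) snd_conv)
  have [measurable]: "?J \<in> borel_measurable borel" "deriv (L k) \<in> borel_measurable borel"
    "a \<in> borel_measurable borel" "c \<in> borel_measurable borel" for k
    using a(1) c(1) L(1) by (auto intro!: smooth_measurable smooth_mollifier smooth_deriv)
  \<comment> \<open>The bound has to be uniform in \<open>k\<close>, although
    \<open>deriv (L k)\<close> may become large: only its integral, at most one, enters, and it
    lives to the left of \<open>l\<close>, where \<open>p\<close> is bounded.\<close>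
  have \<Phi>_le: "\<bar>\<Phi> k t\<bar> \<le> Bp" for k t
  proof -
    have "(\<integral>\<^sup>+z. ennreal \<bar>p z * ?J (t - fst z) * deriv (L k) (snd z)\<bar> \<partial>lborel)
      \<le> (\<integral>\<^sup>+z. ennreal Bp * (ennreal (?J (t - fst z)) * ennreal (deriv (L k) (snd z))) \<partial>lborel)"
    proof (intro nn_integral_mono)
      fix z
      have "\<bar>p z * ?J (t - fst z) * deriv (L k) (snd z)\<bar> \<le> Bp * (?J (t - fst z) * deriv (L k) (snd z))"
      proof (cases "snd z \<le> l")
        case True
        then show ?thesis
          using Bp(1)[OF True] mollifier_nonneg[OF \<epsilon>(1)] L(4)
          by (auto simp: abs_mult mult.assoc intro!: mult_right_mono)
      next
        case False
        then show ?thesis using \<epsilon>(1) by (simp add: dL0)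
      qed
      then show "ennreal \<bar>p z * ?J (t - fst z) * deriv (L k) (snd z)\<bar>
        \<le> ennreal Bp * (ennreal (?J (t - fst z)) * ennreal (deriv (L k) (snd z)))"
        using Bp mollifier_nonneg[OF \<epsilon>(1)] L(4) by (simp add: ennreal_leI flip: ennreal_mult)
    qed
    also have "\<dots> = ennreal Bp * (\<integral>\<^sup>+z. ennreal (?J (t - fst z)) * ennreal (deriv (L k) (snd z)) \<partial>lborel)"
      by (intro nn_integral_cmult) simp
    also have "(\<integral>\<^sup>+z. ennreal (?J (t - fst z)) * ennreal (deriv (L k) (snd z)) \<partial>lborel)
      = (\<integral>\<^sup>+s. \<integral>\<^sup>+y. ennreal (?J (t - s)) * ennreal (deriv (L k) y) \<partial>lborel \<partial>lborel)"
      by (subst nn_integral_lborel_iterate) simp_all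
    also have "\<dots> = (\<integral>\<^sup>+s. ennreal (?J (t - s)) * (\<integral>\<^sup>+y. ennreal (deriv (L k) y) \<partial>lborel) \<partial>lborel)"
      by (intro nn_integral_cong nn_integral_cmult) simp
    also have "\<dots> \<le> (\<integral>\<^sup>+s. ennreal (?J (t - s)) * 1 \<partial>lborel)"
      unfolding L_def by (intro nn_integral_mono mult_left_mono lcut_variation) simp
    also have "\<dots> = 1" using nn_integral_mollifier[OF \<epsilon>(1)] by simp
    finally have "(\<integral>\<^sup>+z. ennreal \<bar>p z * ?J (t - fst z) * deriv (L k) (snd z)\<bar> \<partial>lborel) \<le> ennreal Bp"
      by (simp add: mult_left_mono)
    then have "(LINT z|lborel. \<bar>p z * ?J (t - fst z) * deriv (L k) (snd z)\<bar>) \<le> Bp"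
      using Bp by (intro integral_real_bounded) auto
    moreover have "\<bar>\<Phi> k t\<bar> \<le> (LINT z|lborel. \<bar>p z * ?J (t - fst z) * deriv (L k) (snd z)\<bar>)"
      unfolding \<Phi>_def by (rule integral_abs_bound)
    ultimately show ?thesis by linarith
  qed
  have "B \<longlonglongrightarrow> (LINT z::real\<times>real|lborel. 0)"
    unfolding B_eq
  proof (rule integral_dominated_convergence)
    have zero: "p z * (a (fst z) * c (snd z)) * Bp = 0" if "\<bar>\<delta>\<bar> + \<bar>T\<bar> + \<bar>l\<bar> + \<bar>r\<bar> < norm z" for z
    proof -
      have "fst z \<notin> {\<delta>..T} \<or> snd z \<notin> {l..r}"
        using that norm_Pair_le[of "fst z" "snd z"] by auto
      then show ?thesis using a(3) c(4) by auto
    qed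
    have "locally_bounded (\<lambda>z. p z * (a (fst z) * c (snd z)) * Bp)"
      by (intro locally_bounded_mult locally_bounded_fields locally_bounded_smooth[of "\<lambda>_. Bp"]
          locally_bounded_compose[OF locally_bounded_smooth] a c continuous_intros smooth_const)
    then show "integrable lborel (\<lambda>z. \<bar>p z * (a (fst z) * c (snd z)) * Bp\<bar>)"
      using zero by (intro integrable_abs) (rule locally_bounded_integrable)
    show "AE z in lborel. (\<lambda>k. p z * (a (fst z) * c (snd z)) * \<Phi> k (fst z)) \<longlonglongrightarrow> 0"
    proof (intro AE_I2)
      fix z
      show "(\<lambda>k. p z * (a (fst z) * c (snd z)) * \<Phi> k (fst z)) \<longlonglongrightarrow> 0"
      proof (cases "fst z \<in> {\<delta>..T}")
        case True
        have "test_function {0<..} (\<lambda>s. ?J (fst z - s))"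
        proof (rule test_functionI)
          show "smooth (\<lambda>s. ?J (fst z - s))" by (rule smooth_reflect[OF smooth_mollifier])
          show "{fst z - \<epsilon>..fst z} \<subseteq> {0<..}" using \<epsilon> True by auto
        qed (use mollifier_eq_0[OF \<epsilon>(1)] in auto)
        from LIMSEQ_ignore_initial_segment[OF flux_left[OF this], of K]
        have "(\<lambda>k. \<Phi> k (fst z)) \<longlonglongrightarrow> 0" by (simp add: \<Phi>_def L_def)
        then show ?thesis by (rule tendsto_mult_right_zero)
      qed (simp add: a(3))
    qed
    show "AE z in lborel. norm (p z * (a (fst z) * c (snd z)) * \<Phi> k (fst z)) \<le> \<bar>p z * (a (fst z) * c (snd z)) * Bp\<bar>" for k
      using \<Phi>_le Bp(2) by (intro AE_I2) (auto simp: abs_mult intro!: mult_left_mono)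
    have [measurable]: "\<Phi> k \<in> borel_measurable borel" for k
      unfolding \<Phi>_def[abs_def] by measurable
    show "(\<lambda>z. p z * (a (fst z) * c (snd z)) * \<Phi> k (fst z)) \<in> borel_measurable lborel" for k
      by simp
  qed simp
  then have "(\<lambda>k. ?C - B k) \<longlonglongrightarrow> ?C - 0" by (intro tendsto_intros) simp
  then have "(LINT w|lborel. main_integrand a c \<epsilon> w) \<le> ?C - 0"
    by (rule tendsto_lowerbound) (use main(2) in auto)
  then show ?thesis by simp
qed

text \<open>Here \<epsilon> tends to zero. \<open>main_integrand\<close> is split into its two
  products, each a mollified product of two functions of one space-time point as in
  \<open>tendsto_integral_mollified\<close>. Both functions have to be bounded there, while the
  fields are bounded locally; hence the indicator \<open>I\<close> on the second copy.\<close>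

lemma integral_diagonal_le:
  fixes a c :: "real \<Rightarrow> real"
  assumes a: "smooth a" "\<And>t. 0 \<le> a t" "\<And>t. t \<notin> {\<delta>..T} \<Longrightarrow> a t = 0" and \<delta>: "0 < \<delta>"
    and c: "smooth c" "\<And>x. 0 \<le> c x" "\<And>x. c x \<le> 1" "\<And>x. x \<notin> {l..r} \<Longrightarrow> c x = 0" "{l..} \<subseteq> \<Omega>"
    and slope: "0 \<le> \<kappa>" "\<And>x. - \<kappa> \<le> deriv c x"
    and Va: "0 \<le> Va" "(\<integral>\<^sup>+t. ennreal \<bar>deriv a t\<bar> \<partial>lborel) \<le> ennreal Va"
    and Ia: "0 \<le> Ia" "(\<integral>\<^sup>+t. ennreal (a t) \<partial>lborel) \<le> ennreal Ia"
  shows "(\<integral>\<^sup>+z. ennreal ((q z * m z - (p z)\<^sup>2) * (a (fst z) * c (snd z))) \<partial>lborel)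
    \<le> ennreal (M * (P * Va + (Q * \<kappa> + N) * Ia))"
proof -
  have "l \<in> \<Omega>" using c(5) by auto
  then obtain e where e: "e > 0" "ball l e \<subseteq> \<Omega>" using open_\<Omega> open_contains_ball by blast
  \<comment> \<open>Three requirements on the scale: the box in \<open>I\<close> has a margin of
    one, times stay positive (scale below \<delta>), and \<open>l - \<epsilon>\<close> belongs to
    the open set \<open>\<Omega>\<close>.\<close>
  define e0 where "e0 = min 1 (min (\<delta> / 2) (e / 2))"
  have e0: "0 < e0" "e0 \<le> 1" "e0 < \<delta>" "e0 < e" using e \<delta> by (auto simp: e0_def)
  define \<epsilon> where "\<epsilon> k = e0 * inverse (real (Suc k))" for k
  have \<epsilon>: "0 < \<epsilon> k" "\<epsilon> k \<le> e0" for k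
    using e0 by (auto simp: \<epsilon>_def field_simps)
  have \<epsilon>_lim: "\<epsilon> \<longlonglongrightarrow> 0"
    unfolding \<epsilon>_def[abs_def] by (intro tendsto_mult_right_zero LIMSEQ_inverse_real_of_nat)
  \<comment> \<open>The box contains every \<open>(s, y)\<close> with \<open>t - s\<close> and
    \<open>x - y\<close> in \<open>{0..\<epsilon> k}\<close> and \<open>(t, x)\<close> in the
    support of \<open>u\<close>, so that \<open>I\<close> is one wherever the kernels and
    \<open>u\<close> are nonzero.\<close>
  define I where "I = indicat_real ({0..T} \<times> {l - 1..r})"
  define u where "u z = a (fst z) * c (snd z)" for z
  let ?J2 = "\<lambda>z. bump (fst z) * bump (snd z)"
  define R where "R = \<bar>\<delta>\<bar> + \<bar>T\<bar> + \<bar>l\<bar> + \<bar>r\<bar> + 1"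
  have u0: "u z = 0" if "R < norm z" for z
  proof -
    have "fst z \<notin> {\<delta>..T} \<or> snd z \<notin> {l..r}"
      using that norm_Pair_le[of "fst z" "snd z"] by (auto simp: R_def)
    then show ?thesis using a(3) c(4) by (auto simp: u_def)
  qed
  have I0: "I z = 0" if "R < norm z" for z
    using that norm_Pair_le[of "fst z" "snd z"] \<delta> by (auto simp: R_def I_def indicator_def)
  have J0: "?J2 z = 0" if "2 < norm z" for z
    using that norm_Pair_le[of "fst z" "snd z"] bump_eq_0[of "fst z"] bump_eq_0[of "snd z"] by fastforce
  have lbu: "locally_bounded u" unfolding u_def[abs_def]
    by (intro locally_bounded_mult locally_bounded_compose[OF locally_bounded_smooth] a c continuous_intros)
  have lbI: "locally_bounded I"
    unfolding I_def by (intro locally_bounded_indicator) (auto intro!: borel_closed closed_Times)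
  have lbJ: "locally_bounded ?J2"
    by (intro locally_bounded_mult locally_bounded_compose[OF locally_bounded_smooth] smooth_bump continuous_intros)
  obtain BJ where BJ: "\<And>z. \<bar>?J2 z\<bar> \<le> BJ"
    using locally_bounded_support_bounded[OF lbJ J0] by blast
  have lim: "integrable lborel (\<lambda>w. f (fst w) * u (fst w) * (g (snd w) * I (snd w))
      * (mollifier (\<epsilon> k) (fst (fst w) - fst (snd w)) * mollifier (\<epsilon> k) (snd (fst w) - snd (snd w))))"
    (is "integrable lborel (?F k)")
    "(\<lambda>k. LINT w|lborel. f (fst w) * u (fst w) * (g (snd w) * I (snd w))
      * (mollifier (\<epsilon> k) (fst (fst w) - fst (snd w)) * mollifier (\<epsilon> k) (snd (fst w) - snd (snd w))))
      \<longlonglongrightarrow> (LINT z|lborel. f z * u z * g z)"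
    if fg: "locally_bounded f" "locally_bounded g" for f g k
  proof -
    have lbF: "locally_bounded (\<lambda>z. f z * u z)" and lbG: "locally_bounded (\<lambda>z. g z * I z)"
      by (intro locally_bounded_mult fg lbu lbI)+
    have z: "f z * u z = 0" "g z * I z = 0" if "R < norm z" for z using u0 I0 that by auto
    obtain BF where BF: "\<And>z. \<bar>f z * u z\<bar> \<le> BF"
      using locally_bounded_support_bounded[OF lbF z(1)] by blast
    obtain BG where BG: "\<And>z. \<bar>g z * I z\<bar> \<le> BG"
      using locally_bounded_support_bounded[OF lbG z(2)] by blast
    show int: "integrable lborel (?F k)" for k
    proof (rule locally_bounded_integrable[of _ "2 * R"])
      show "locally_bounded (?F k)"
        by (intro locally_bounded_mult locally_bounded_compose[OF lbu] locally_bounded_compose[OF lbI]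
            locally_bounded_compose[OF fg(1)] locally_bounded_compose[OF fg(2)]
            locally_bounded_compose[OF locally_bounded_smooth[OF smooth_mollifier]] continuous_intros)
      fix w :: "plane_pair"
      assume "2 * R < norm w"
      then have "R < norm (fst w) \<or> R < norm (snd w)" using norm_Pair_le[of "fst w" "snd w"] by auto
      then show "?F k w = 0" using u0[of "fst w"] I0[of "snd w"] by auto
    qed
    have "(\<lambda>k. LINT z|lborel. LINT z'|lborel. f z * u z * (g z' * I z') * (?J2 ((z - z') /\<^sub>R \<epsilon> k) / \<epsilon> k ^ DIM(real \<times> real)))
      \<longlonglongrightarrow> (LINT z|lborel. f z * u z * (g z * I z))"
      by (rule tendsto_integral_mollified[where J = ?J2 and F = BF and G = BG and R = R and R' = 2 and K = BJ])
        (use lbF lbG lbJ BF z BG BJ J0 integral_bump_product \<epsilon>(1) \<epsilon>_lim in \<open>auto simp: locally_bounded_def\<close>)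
    moreover have "(LINT z|lborel. LINT z'|lborel. f z * u z * (g z' * I z') * (?J2 ((z - z') /\<^sub>R \<epsilon> k) / \<epsilon> k ^ DIM(real \<times> real)))
      = (LINT w|lborel. ?F k w)" for k
      using lborel_Fubini(1)[OF int[of k]] by (simp only: mollifier_product[symmetric] fst_conv snd_conv)
    moreover have "f z * u z * (g z * I z) = f z * u z * g z" for z
    proof (cases "u z = 0")
      case False
      then have "fst z \<in> {\<delta>..T}" "snd z \<in> {l..r}" using a(3) c(4) by (auto simp: u_def)
      then have "I z = 1" using \<delta> by (auto simp: I_def indicator_def mem_Times_iff)
      then show ?thesis by simp
    qed simp
    ultimately show "(\<lambda>k. LINT w|lborel. ?F k w) \<longlonglongrightarrow> (LINT z|lborel. f z * u z * g z)" by simp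
  qed
  note lqm = lim[OF locally_bounded_fields(3,1)] and lpp = lim[OF locally_bounded_fields(2,2)]
  define F where "F f g k w = f (fst w) * u (fst w) * (g (snd w) * I (snd w))
      * (mollifier (\<epsilon> k) (fst (fst w) - fst (snd w)) * mollifier (\<epsilon> k) (snd (fst w) - snd (snd w)))" for f g k w
  have main: "main_integrand a c (\<epsilon> k) w = F q m k w - F p p k w" for k w
  proof (cases "u (fst w) = 0 \<or> fst (fst w) - fst (snd w) \<notin> {0..\<epsilon> k} \<or> snd (fst w) - snd (snd w) \<notin> {0..\<epsilon> k}")
    case True
    then show ?thesis
      using mollifier_eq_0[OF \<epsilon>(1)[of k]] by (auto simp: main_integrand_def F_def u_def)
  next
    case False
    then have "fst (fst w) \<in> {\<delta>..T}" "snd (fst w) \<in> {l..r}" using a(3) c(4) by (auto simp: u_def)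
    then have "snd w \<in> {0..T} \<times> {l - 1..r}"
      using False \<epsilon>(2)[of k] e0 by (auto simp: mem_Times_iff)
    then have "I (snd w) = 1" by (simp add: I_def)
    then show ?thesis by (simp add: main_integrand_def F_def u_def algebra_simps)
  qed
  have "(\<lambda>k. (LINT w|lborel. F q m k w) - (LINT w|lborel. F p p k w))
    \<longlonglongrightarrow> (LINT z|lborel. q z * u z * m z) - (LINT z|lborel. p z * u z * p z)"
    unfolding F_def by (intro tendsto_diff lqm(2) lpp(2))
  moreover have "(LINT w|lborel. F q m k w) - (LINT w|lborel. F p p k w)
    \<le> M * (P * Va + (Q * \<kappa> + N) * Ia)" for k
  proof -
    have "l - \<epsilon> k \<in> \<Omega>" using e \<epsilon>[of k] e0 by (intro subsetD[OF e(2)]) (auto simp: dist_real_def)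
    then have "(LINT w|lborel. main_integrand a c (\<epsilon> k) w) \<le> M * (P * Va + (Q * \<kappa> + N) * Ia)"
      using \<epsilon>[of k] e0 by (intro integral_main_integrand_le[OF a c _ _ _ slope Va Ia]) auto
    then show ?thesis unfolding main using lqm(1)[of k] lpp(1)[of k] by (simp add: F_def)
  qed
  ultimately have *: "(LINT z|lborel. q z * u z * m z) - (LINT z|lborel. p z * u z * p z)
      \<le> M * (P * Va + (Q * \<kappa> + N) * Ia)"
    by (intro tendsto_upperbound[of _ _ sequentially]) auto
  have int: "integrable lborel (\<lambda>z. q z * u z * m z)" "integrable lborel (\<lambda>z. p z * u z * p z)"
    by (rule locally_bounded_integrable[of _ R]; (intro locally_bounded_mult locally_bounded_fields lbu | simp add: u0))+
  have eq: "(q z * m z - (p z)\<^sup>2) * (a (fst z) * c (snd z)) = q z * u z * m z - p z * u z * p z" for z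
    by (simp add: u_def algebra_simps power2_eq_square)
  have nn: "0 \<le> q z * u z * m z - p z * u z * p z" for z
    unfolding eq[symmetric] using momentum_le[of z] a(2) c(2) by (intro mult_nonneg_nonneg) auto
  have "(\<integral>\<^sup>+z. ennreal (q z * u z * m z - p z * u z * p z) \<partial>lborel)
    = ennreal (LINT z|lborel. q z * u z * m z - p z * u z * p z)"
    using int nn by (intro nn_integral_eq_integral) auto
  also have "\<dots> \<le> ennreal (M * (P * Va + (Q * \<kappa> + N) * Ia))"
    using * int by (intro ennreal_leI) simp
  finally show ?thesis unfolding eq .
qed

text \<open>Exhaustion by cutoffs and Fatou's lemma. In time, \<open>a i\<close> rises once and
  falls once, so its variation is at most 2, and its support is in \<open>{0..T + 2}\<close>. In
  space, the downward slope of \<open>c i\<close> is that of \<open>bump\<close> stretched by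
  \<open>n i \<ge> 1\<close>, hence at most \<open>K\<close>; the rising slope of
  \<open>lcut i\<close> may be arbitrarily large but has the good sign.\<close>

theorem spacetime_bound:
  assumes "0 < T" and K: "0 \<le> K" "\<And>x. bump x \<le> K"
  shows "(\<integral>\<^sup>+z\<in>{0<..T} \<times> \<Omega>. ennreal (q z * m z - (p z)\<^sup>2) \<partial>lborel)
    \<le> ennreal (M * (P * 2 + (Q * K + N) * (T + 2)))"
proof -
  define n where "n i = real (Suc i)" for i
  have n: "1 \<le> n i" "0 < n i" for i by (auto simp: n_def)
  \<comment> \<open>With n = \<open>n i\<close>, the factors rise on \<open>[1/n, 2/n]\<close> and
    fall on \<open>[T + 1, T + 2]\<close>; in the next definition the right cutoff falls on
    \<open>[n, 2n]\<close>.\<close>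
  define a where "a i t = step (n i * t + (-1)) * step (T + 2 - t)" for i t
  define c where "c i x = lcut i x * step (- (1 / n i) * x + 2)" for i x
  have bound: "(\<integral>\<^sup>+z. ennreal ((q z * m z - (p z)\<^sup>2) * (a i (fst z) * c i (snd z))) \<partial>lborel)
    \<le> ennreal (M * (P * 2 + (Q * K + N) * (T + 2)))" for i
  proof -
    obtain l where l: "{l..} \<subseteq> \<Omega>" "\<And>x. x \<le> l \<Longrightarrow> lcut i x = 0" using lcut_support[of i] by auto
    have sm: "smooth (\<lambda>t. step (n i * t + (-1)))" "smooth (\<lambda>t. step (T + 2 - t))"
        "smooth (\<lambda>x. step (- (1 / n i) * x + 2))"
      by (rule smooth_affine[OF smooth_step] smooth_reflect[OF smooth_step])+
    have a1: "smooth (a i)" unfolding a_def[abs_def] by (rule smooth_mult[OF sm(1,2)])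
    have c1: "smooth (c i)" unfolding c_def[abs_def] by (rule smooth_mult[OF lcut_smooth sm(3)])
    have a01: "0 \<le> a i t" "a i t \<le> 1" for t
      by (auto simp: a_def step_nonneg step_le_1 intro!: mult_le_one)
    have a0: "a i t = 0" if "t \<notin> {1 / n i..T + 2}" for t
    proof (cases "t < 1 / n i")
      case True
      then have "step (n i * t + (-1)) = 0" using n[of i] by (intro step_le_0) (auto simp: field_simps)
      then show ?thesis by (simp add: a_def)
    next
      case False
      then have "step (T + 2 - t) = 0" using that by (intro step_le_0) auto
      then show ?thesis by (simp add: a_def)
    qed
    have c01: "0 \<le> c i x" "c i x \<le> 1" for x
      using lcut_range by (auto simp: c_def step_nonneg step_le_1 intro!: mult_le_one)
    have c0: "c i x = 0" if "x \<notin> {l..2 * n i}" for x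
    proof (cases "x < l")
      case False
      then have "step (- (1 / n i) * x + 2) = 0"
        using n[of i] that by (intro step_le_0) (auto simp: field_simps)
      then show ?thesis by (simp add: c_def)
    qed (simp add: c_def l)
    have da: "deriv (a i) t = n i * bump (n i * t + (-1)) * step (T + 2 - t) - step (n i * t + (-1)) * bump (T + 2 - t)" for t
      unfolding a_def[abs_def] deriv_mult_smooth[OF sm(1,2)] deriv_affine_smooth[OF smooth_step]
        deriv_reflect_smooth[OF smooth_step] deriv_step by simp
    have [measurable]: "bump \<in> borel_measurable borel" by (intro smooth_measurable smooth_bump)
    have "(\<integral>\<^sup>+t. ennreal \<bar>deriv (a i) t\<bar> \<partial>lborel)
      \<le> (\<integral>\<^sup>+t. ennreal (\<bar>n i\<bar> * bump (-1 + n i * t)) + ennreal (\<bar>-1\<bar> * bump (T + 2 + (-1) * t)) \<partial>lborel)"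
    proof (intro nn_integral_mono)
      fix t
      have "\<bar>deriv (a i) t\<bar> \<le> \<bar>n i * bump (n i * t + (-1)) * step (T + 2 - t)\<bar> + \<bar>step (n i * t + (-1)) * bump (T + 2 - t)\<bar>"
        unfolding da by linarith
      also have "\<dots> \<le> n i * bump (n i * t + (-1)) + bump (T + 2 - t)"
        using n[of i] by (auto simp: abs_mult bump_nonneg step_nonneg step_le_1
          intro!: add_mono mult_left_le mult_left_le_one_le mult_nonneg_nonneg)
      finally show "ennreal \<bar>deriv (a i) t\<bar> \<le> ennreal (\<bar>n i\<bar> * bump (-1 + n i * t)) + ennreal (\<bar>-1\<bar> * bump (T + 2 + (-1) * t))"
        using n[of i] by (simp add: bump_nonneg add.commute ennreal_leI flip: ennreal_plus)
    qed
    also have "\<dots> = 1 + 1"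
      using n[of i] nn_integral_bump_affine[of "n i" "-1"] nn_integral_bump_affine[of "-1" "T + 2"]
      by (subst nn_integral_add) simp_all
    finally have Va: "(\<integral>\<^sup>+t. ennreal \<bar>deriv (a i) t\<bar> \<partial>lborel) \<le> ennreal 2" by simp
    have "(\<integral>\<^sup>+t. ennreal (a i t) \<partial>lborel) \<le> (\<integral>\<^sup>+t. indicator {0..T + 2} t \<partial>lborel)"
    proof (intro nn_integral_mono)
      fix t
      have "a i t = 0" if "t \<notin> {0..T + 2}"
      proof (rule a0)
        have "0 < 1 / n i" using n by simp
        then show "t \<notin> {1 / n i..T + 2}" using that by (metis atLeastAtMost_iff less_imp_le order_trans)
      qed
      then show "ennreal (a i t) \<le> indicator {0..T + 2} t"
        using a01[of t] by (auto simp: indicator_def)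
    qed
    also have "\<dots> = ennreal (T + 2)" using \<open>0 < T\<close> by simp
    finally have Ia: "(\<integral>\<^sup>+t. ennreal (a i t) \<partial>lborel) \<le> ennreal (T + 2)" .
    have slope: "- K \<le> deriv (c i) x" for x
    proof -
      let ?y = "- (1 / n i) * x + 2"
      have "deriv (c i) x = deriv (lcut i) x * step ?y - lcut i x * ((1 / n i) * bump ?y)"
        unfolding c_def[abs_def] deriv_mult_smooth[OF lcut_smooth sm(3)] deriv_affine_smooth[OF smooth_step]
          deriv_step by simp
      moreover have "0 \<le> deriv (lcut i) x * step ?y" by (simp add: lcut_deriv_nonneg step_nonneg)
      moreover have "lcut i x * ((1 / n i) * bump ?y) \<le> (1 / n i) * bump ?y"
        using n[of i] by (intro mult_left_le_one_le lcut_range) (auto simp: bump_nonneg)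
      moreover have "(1 / n i) * bump ?y \<le> bump ?y"
        using n[of i] by (intro mult_left_le_one_le) (auto simp: bump_nonneg)
      ultimately show ?thesis using K(2)[of ?y] by linarith
    qed
    show ?thesis
      by (rule integral_diagonal_le[where \<delta> = "1 / n i" and T = "T + 2" and l = l and r = "2 * n i"])
        (use n[of i] \<open>0 < T\<close> a1 a01 a0 c1 c01 c0 l(1) K(1) slope Va Ia in auto)
  qed
  \<comment> \<open>Every point with positive time up to \<open>T\<close> and \<open>x\<close> in
    \<open>\<Omega>\<close> eventually lies where both cutoffs are one.\<close>
  have "(\<integral>\<^sup>+z\<in>{0<..T} \<times> \<Omega>. ennreal (q z * m z - (p z)\<^sup>2) \<partial>lborel)
    \<le> (\<integral>\<^sup>+z. liminf (\<lambda>i. ennreal ((q z * m z - (p z)\<^sup>2) * (a i (fst z) * c i (snd z)))) \<partial>lborel)"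
  proof (intro nn_integral_mono)
    fix z
    show "ennreal (q z * m z - (p z)\<^sup>2) * indicator ({0<..T} \<times> \<Omega>) z
      \<le> liminf (\<lambda>i. ennreal ((q z * m z - (p z)\<^sup>2) * (a i (fst z) * c i (snd z))))"
    proof (cases "z \<in> {0<..T} \<times> \<Omega>")
      case True
      then have z: "0 < fst z" "fst z \<le> T" "snd z \<in> \<Omega>" by (auto simp: mem_Times_iff)
      have "\<forall>\<^sub>F i in sequentially. max (2 / fst z) (snd z) \<le> real i"
        using eventually_ge_at_top filterlim_real_sequentially unfolding filterlim_at_top by blast
      moreover note lcut_eventually[OF z(3)]
      ultimately have "\<forall>\<^sub>F i in sequentially.
        ennreal (q z * m z - (p z)\<^sup>2) \<le> ennreal ((q z * m z - (p z)\<^sup>2) * (a i (fst z) * c i (snd z)))"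
      proof eventually_elim
        case (elim i)
        have 1: "2 / fst z \<le> n i" "snd z \<le> n i" using elim by (auto simp: n_def)
        have "2 \<le> n i * fst z" using 1(1) z(1) by (simp add: field_simps)
        then have "a i (fst z) = 1" using z by (simp add: a_def step_ge_1)
        moreover have "c i (snd z) = 1"
          using elim 1(2) n[of i] by (simp add: c_def step_ge_1 field_simps)
        ultimately show ?case by simp
      qed
      then show ?thesis using True by (simp add: Liminf_bounded)
    qed simp
  qed
  also have "\<dots> \<le> liminf (\<lambda>i. \<integral>\<^sup>+z. ennreal ((q z * m z - (p z)\<^sup>2) * (a i (fst z) * c i (snd z))) \<partial>lborel)"
  proof (rule nn_integral_liminf)
    have [measurable]: "step \<in> borel_measurable borel" "lcut i \<in> borel_measurable borel" for i
      by (auto intro!: smooth_measurable smooth_step lcut_smooth)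
    show "(\<lambda>z. ennreal ((q z * m z - (p z)\<^sup>2) * (a i (fst z) * c i (snd z)))) \<in> borel_measurable lborel" for i
      unfolding a_def c_def by simp
  qed
  also have "\<dots> \<le> liminf (\<lambda>i. ennreal (M * (P * 2 + (Q * K + N) * (T + 2))))"
    by (intro Liminf_mono always_eventually allI bound)
  also have "\<dots> = ennreal (M * (P * 2 + (Q * K + N) * (T + 2)))" by (simp add: Liminf_const)
  finally show ?thesis .
qed

end

section \<open>Finite energy solutions\<close>

lemma measurable_lebesgue_cong_AE:
  fixes f g :: "'a::euclidean_space \<Rightarrow> real"
  assumes "AE z in lborel. f z = g z" "g \<in> borel_measurable borel"
  shows "f \<in> borel_measurable lebesgue"
proof -
  have "AE z in lebesgue. f z = g z" using assms(1) by (simp add: AE_completion_iff)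
  then obtain N where N: "N \<in> null_sets lebesgue" "\<And>z. z \<in> space lebesgue - N \<Longrightarrow> f z = g z"
    by (auto elim: AE_E3)
  have "g measurable_on UNIV"
    using assms(2) by (intro lebesgue_measurable_imp_measurable_on_real) (auto intro: measurable_completion)
  then have "f measurable_on UNIV"
    by (rule measurable_on_spike[of _ _ N]) (use N in \<open>auto simp: negligible_iff_null_sets\<close>)
  then show ?thesis by (simp add: measurable_on_imp_borel_measurable_lebesgue_UNIV)
qed

lemma integral_lebesgue_eq_lborel:
  fixes f g :: "'a::euclidean_space \<Rightarrow> real"
  assumes "AE z in lborel. f z = g z" "g \<in> borel_measurable borel"
  shows "(LINT z|lebesgue. f z) = (LINT z|lborel. g z)"
proof -
  have "(LINT z|lebesgue. f z) = (LINT z|lebesgue. g z)"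
    using assms measurable_lebesgue_cong_AE[OF assms]
    by (intro integral_cong_AE) (auto intro: measurable_completion simp: AE_completion_iff)
  also have "\<dots> = (LINT z|lborel. g z)"
    using assms(2) by (intro integral_completion) simp
  finally show ?thesis .
qed

lemma nn_integral_lebesgue_eq_lborel:
  fixes f g :: "'a::euclidean_space \<Rightarrow> ennreal"
  assumes "AE z in lborel. f z = g z"
  shows "(\<integral>\<^sup>+z. f z \<partial>lebesgue) = (\<integral>\<^sup>+z. g z \<partial>lborel)"
  using assms by (simp add: nn_integral_completion cong: nn_integral_cong_AE)

lemma AE_lborel_pair:
  assumes "AE z in (lborel :: ('a::euclidean_space \<times> 'b::euclidean_space) measure). R z"
  shows "AE x in lborel. AE y in lborel. R (x, y)"
proof -
  have "AE z in lborel \<Otimes>\<^sub>M lborel. R z" using assms by (subst lborel_prod)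
  then show ?thesis by (rule lborel_pair.AE_pair)
qed

text \<open>Solutions are Lebesgue measurable and bounded almost everywhere. A Borel representative
  with pointwise bounds, zero off \<open>S\<close>, frees the later estimates from exceptional sets.
  The bounds are enforced by clamping; the value zero off \<open>S\<close> is the reason for
  \<open>b \<le> 0\<close> and \<open>0 \<le> c\<close>.\<close>

lemma borel_representative:
  fixes f :: "'a::euclidean_space \<Rightarrow> real"
  assumes "f \<in> borel_measurable (lebesgue_on S)" "S \<in> sets borel"
    and "AE z\<in>S in lebesgue. b \<le> f z \<and> f z \<le> c" "b \<le> 0" "0 \<le> c"
  obtains g where "g \<in> borel_measurable borel" "\<And>z. b \<le> g z" "\<And>z. g z \<le> c"
    "\<And>z. z \<notin> S \<Longrightarrow> g z = 0" "AE z in lborel. z \<in> S \<longrightarrow> f z = g z"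
proof -
  have "(\<lambda>z. if z \<in> S then f z else 0) \<in> borel_measurable lebesgue"
    using assms(1,2) by (subst borel_measurable_if) (auto intro: sets_completionI_sets)
  from completion_ex_borel_measurable_real[OF this]
  obtain h where h: "h \<in> borel_measurable lborel" "AE z in lborel. (if z \<in> S then f z else 0) = h z"
    by auto
  define g where "g z = indicat_real S z * max b (min c (h z))" for z
  have "g \<in> borel_measurable borel" unfolding g_def[abs_def] using h(1) assms(2) by simp
  moreover have "AE z in lborel. z \<in> S \<longrightarrow> f z = g z"
    using h(2) assms(3)[unfolded AE_completion_iff]
    by eventually_elim (auto simp: g_def)
  ultimately show ?thesis
    using that[of g] assms(4,5) by (auto simp: g_def indicator_def)
qed

text \<open>The coefficient of the pressure as the kinetic formula delivers it. Evaluating the Beta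
  integrals gives \<open>(theta \<gamma>)\<^sup>2 / \<gamma>\<close>, that is
  \<open>kappa \<gamma>\<close>; the proof works with the ratio and its sign.\<close>

definition pressure_coeff :: "real \<Rightarrow> real"
  where "pressure_coeff \<gamma> = theta \<gamma> * moment 2 \<gamma> / moment 0 \<gamma>"

lemma pressure_coeff_pos: "\<gamma> > 1 \<Longrightarrow> 0 < pressure_coeff \<gamma>"
  using moment_even_pos[of \<gamma> 0] moment_even_pos[of \<gamma> 2] by (simp add: pressure_coeff_def theta_def)

lemma test_function_tensor:
  fixes a b :: "real \<Rightarrow> real"
  assumes "test_function U a" "test_function V b"
  shows "test_function (UNIV \<times> V) (\<lambda>z. a (fst z) * b (snd z))"
proof (rule test_functionI)
  show "smooth (\<lambda>z. a (fst z) * b (snd z))"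
    using assms by (intro smooth_tensor test_function_smooth)
  let ?K = "closure {x. a x \<noteq> 0} \<times> closure {x. b x \<noteq> 0}"
  show "compact ?K" "?K \<subseteq> UNIV \<times> V"
    using assms by (auto simp: test_function_def intro!: compact_Times)
  show "a (fst z) * b (snd z) = 0" if "z \<notin> ?K" for z
    using that closure_subset[of "{x. a x \<noteq> 0}"] closure_subset[of "{x. b x \<noteq> 0}"]
    by (auto simp: mem_Times_iff)
qed

lemma deriv_mult_const_smooth:
  fixes a :: "real \<Rightarrow> real"
  assumes "smooth a"
  shows "deriv (\<lambda>t. a t * k) t = deriv a t * k" "deriv (\<lambda>t. k * a t) t = k * deriv a t"
  using deriv_mult_smooth[OF assms smooth_const[of k]] deriv_mult_smooth[OF smooth_const[of k] assms]
  by simp_all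

text \<open>The integrand is \<open>k * c * F\<close> with \<open>k\<close> of either sign, so the
  inequality forces the integral of \<open>F\<close> to be zero. The initial datum disappears
  because \<open>a\<close> has its support in positive times.\<close>

lemma entropy_solution_weak:
  assumes sol: "entropy_solution \<gamma> \<Omega> A r0 v0 \<rho> u"
    and \<psi>: "\<And>k. entropy_generator (\<psi> k)"
    and a: "test_function {0<..} a" "\<And>t. 0 \<le> a t"
    and b: "test_function \<Omega> b" "\<And>x. 0 \<le> b x"
    and meas: "F \<in> borel_measurable borel" and c: "c > 0"
    and eq: "\<And>k. AE z in lborel. indicat_real ({0..} \<times> \<Omega>) z * (
        eta \<gamma> (\<psi> k) (\<rho> z) (u z) * A (snd z) * (deriv a (fst z) * b (snd z))
      + entropy_flux \<gamma> (\<psi> k) (\<rho> z) (u z) * A (snd z) * (a (fst z) * deriv b (snd z))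
      - geometric_source \<gamma> (\<psi> k) (\<rho> z) (u z) * deriv A (snd z) * (a (fst z) * b (snd z))) = k * c * F z"
  shows "(LINT z|lborel. F z) = 0"
proof -
  have a0: "a 0 = 0"
    using a(1) closure_subset[of "{x. a x \<noteq> 0}"] by (force simp: test_function_def)
  have "0 \<le> k * c * (LINT z|lborel. F z)" for k
  proof -
    have "0 \<le> (LINT z:{0..} \<times> \<Omega>|lebesgue.
        eta \<gamma> (\<psi> k) (\<rho> z) (u z) * A (snd z) * (deriv a (fst z) * b (snd z))
      + entropy_flux \<gamma> (\<psi> k) (\<rho> z) (u z) * A (snd z) * (a (fst z) * deriv b (snd z))
      - geometric_source \<gamma> (\<psi> k) (\<rho> z) (u z) * deriv A (snd z) * (a (fst z) * b (snd z)))"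
      using sol[unfolded entropy_solution_def, THEN conjunct2, THEN conjunct2, THEN conjunct2,
          rule_format, OF \<psi>[of k] test_function_tensor[OF a(1) b(1)]] a(2) b(2)
        deriv_mult_const_smooth(1)[OF test_function_smooth[OF a(1)]]
        deriv_mult_const_smooth(2)[OF test_function_smooth[OF b(1)]]
      by (simp add: a0)
    also have "\<dots> = (LINT z|lborel. k * c * F z)"
      unfolding set_lebesgue_integral_def using eq[of k] meas
      by (intro integral_lebesgue_eq_lborel) auto
    finally show ?thesis by simp
  qed
  from this[of 1] this[of "-1"] c show ?thesis
    by (simp add: zero_le_mult_iff mult_le_0_iff)
qed

text \<open>One member of the sequence, represented by Borel functions with pointwise bounds.
  \<open>B\<close> may depend on \<open>n\<close> and gives only qualitative information; the
  estimates are expressed by \<open>M\<close>, \<open>E\<close> and \<open>K\<close>, which are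
  chosen before \<open>n\<close> when the locale is interpreted.\<close>

locale finite_energy_flow =
  fixes \<gamma> :: real and \<Omega> :: "real set" and A :: "real \<Rightarrow> real" and r v :: "real \<times> real \<Rightarrow> real"
    and B M E K :: real
  assumes gamma: "\<gamma> > 1"
    and open_domain: "open \<Omega>"
    and continuous_weight: "continuous_on \<Omega> A" "continuous_on \<Omega> (deriv A)"
    and weight_nonneg: "x \<in> \<Omega> \<Longrightarrow> 0 \<le> A x"
    and weight_bounded: "\<exists>C. \<forall>x\<in>\<Omega>. x \<le> R \<longrightarrow> A x \<le> C"
    and weight_deriv_bounded: "\<exists>C. \<forall>x\<in>\<Omega>. \<bar>x\<bar> \<le> R \<longrightarrow> \<bar>deriv A x\<bar> \<le> C"
    and weight_deriv_ge: "AE x in lborel. x \<in> \<Omega> \<longrightarrow> - deriv A x \<le> K * A x"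
    and constants_nonneg: "0 \<le> M" "0 \<le> E" "0 \<le> K"
    and borel_r [measurable]: "r \<in> borel_measurable borel"
    and borel_v [measurable]: "v \<in> borel_measurable borel"
    and r_range: "0 \<le> r z" "r z \<le> B"
    and v_range: "\<bar>v z\<bar> \<le> B"
    and r_support: "z \<notin> {0..} \<times> \<Omega> \<Longrightarrow> r z = 0"
    and mass_le: "AE t in lborel. (\<integral>\<^sup>+x. ennreal (r (t, x) * (indicat_real \<Omega> x * A x)) \<partial>lborel) \<le> ennreal M"
    and energy_le: "AE t in lborel. (\<integral>\<^sup>+x. ennreal ((1 / 2 * r (t, x) * (v (t, x))\<^sup>2
      + internal_energy \<gamma> (r (t, x))) * (indicat_real \<Omega> x * A x)) \<partial>lborel) \<le> ennreal E"
begin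

definition W :: "real \<Rightarrow> real" where "W x = indicat_real \<Omega> x * A x"
definition dW :: "real \<Rightarrow> real" where "dW x = indicat_real \<Omega> x * deriv A x"

definition m :: "real \<times> real \<Rightarrow> real" where "m z = r z * W (snd z)"
definition p :: "real \<times> real \<Rightarrow> real" where "p z = r z * v z * W (snd z)"
definition q :: "real \<times> real \<Rightarrow> real"
  where "q z = (r z * (v z)\<^sup>2 + pressure_coeff \<gamma> * r z powr \<gamma>) * W (snd z)"
definition S :: "real \<times> real \<Rightarrow> real" where "S z = pressure_coeff \<gamma> * r z powr \<gamma> * dW (snd z)"
definition e :: "real \<times> real \<Rightarrow> real"
  where "e z = (1 / 2 * r z * (v z)\<^sup>2 + internal_energy \<gamma> (r z)) * W (snd z)"

text \<open>The 2 accounts for the kinetic part of \<open>q\<close>, which is twice the kinetic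
  energy density; the second summand is the ratio of the pressure term to the internal energy. Their
  sum dominates both factors.\<close>

definition flux_const :: real
  where "flux_const = 2 + pressure_coeff \<gamma> * (\<gamma> - 1) / kappa \<gamma>"

lemma W_measurable [measurable]: "W \<in> borel_measurable borel" "dW \<in> borel_measurable borel"
proof -
  have "\<Omega> \<in> sets borel" using open_domain by simp
  then show "W \<in> borel_measurable borel" "dW \<in> borel_measurable borel"
    using borel_measurable_continuous_on_indicator[OF _ continuous_weight(1)]
      borel_measurable_continuous_on_indicator[OF _ continuous_weight(2)]
    by (simp_all add: W_def[abs_def] dW_def[abs_def])
qed

lemma fields_measurable [measurable]: "m \<in> borel_measurable borel" "p \<in> borel_measurable borel"
    "q \<in> borel_measurable borel" "S \<in> borel_measurable borel" "e \<in> borel_measurable borel"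
  unfolding m_def[abs_def] p_def[abs_def] q_def[abs_def] S_def[abs_def] e_def[abs_def] internal_energy_def
  by measurable

lemma W_nonneg: "0 \<le> W x"
  using weight_nonneg by (simp add: W_def indicator_def)

lemma coeff_pos: "0 < pressure_coeff \<gamma>" using gamma by (rule pressure_coeff_pos)

lemma kappa_pos: "0 < kappa \<gamma>" using gamma by (simp add: kappa_def theta_def)

lemma flux_const_nonneg: "0 \<le> flux_const"
  using coeff_pos kappa_pos gamma by (simp add: flux_const_def)

lemma fields_nonneg: "0 \<le> m z" "0 \<le> q z" "0 \<le> e z"
  using W_nonneg r_range(1) coeff_pos kappa_pos gamma
  by (simp_all add: m_def q_def e_def internal_energy_def)

text \<open>The kinetic part of \<open>q * m\<close> is exactly the square of \<open>p\<close>; the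
  pressure alone survives and is multiplied by one more power of the density.\<close>

lemma determinant: "q z * m z - (p z)\<^sup>2 = pressure_coeff \<gamma> * (r z powr (\<gamma> + 1) * (W (snd z))\<^sup>2)"
proof -
  have "r z powr \<gamma> * r z = r z powr (\<gamma> + 1)"
    using r_range(1)[of z] by (cases "r z = 0") (auto simp: powr_add)
  then show ?thesis by (simp add: q_def m_def p_def algebra_simps power2_eq_square)
qed

lemma q_le: "q z \<le> flux_const * e z"
proof -
  define k where "k = pressure_coeff \<gamma> * (\<gamma> - 1) / kappa \<gamma>"
  have "pressure_coeff \<gamma> * r z powr \<gamma> = k * internal_energy \<gamma> (r z)"
    using kappa_pos gamma by (simp add: k_def internal_energy_def)
  moreover have "0 \<le> internal_energy \<gamma> (r z)" "0 \<le> r z * (v z)\<^sup>2" "0 \<le> k"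
    using kappa_pos gamma r_range(1) coeff_pos by (simp_all add: internal_energy_def k_def)
  moreover from this have "0 \<le> k * (r z * (v z)\<^sup>2)" by simp
  moreover have "(2 + k) * (1 / 2 * r z * (v z)\<^sup>2 + internal_energy \<gamma> (r z)) = r z * (v z)\<^sup>2
      + 2 * internal_energy \<gamma> (r z) + k * (r z * (v z)\<^sup>2) / 2 + k * internal_energy \<gamma> (r z)"
    by (simp add: algebra_simps)
  ultimately have "r z * (v z)\<^sup>2 + pressure_coeff \<gamma> * r z powr \<gamma>
    \<le> (2 + k) * (1 / 2 * r z * (v z)\<^sup>2 + internal_energy \<gamma> (r z))" by linarith
  then have "r z * (v z)\<^sup>2 + pressure_coeff \<gamma> * r z powr \<gamma>
    \<le> flux_const * (1 / 2 * r z * (v z)\<^sup>2 + internal_energy \<gamma> (r z))"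
    by (simp add: flux_const_def k_def)
  then show ?thesis unfolding q_def e_def using W_nonneg by (simp add: mult_right_mono flip: mult.assoc)
qed

text \<open>Young's inequality for the velocity; the constant \<open>M + E\<close> in the momentum
  bound has its origin here.\<close>

lemma p_le: "\<bar>p z\<bar> \<le> m z + e z"
proof -
  have "0 \<le> (\<bar>v z\<bar> - 1)\<^sup>2" by simp
  then have "\<bar>v z\<bar> \<le> 1 + 1 / 2 * (v z)\<^sup>2" by (simp add: power2_eq_square algebra_simps)
  then have "r z * \<bar>v z\<bar> \<le> r z * (1 + 1 / 2 * (v z)\<^sup>2)" by (intro mult_left_mono r_range)
  also have "\<dots> \<le> r z + (1 / 2 * r z * (v z)\<^sup>2 + internal_energy \<gamma> (r z))"
    using kappa_pos gamma by (simp add: internal_energy_def algebra_simps)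
  finally have "r z * \<bar>v z\<bar> * W (snd z) \<le> (r z + (1 / 2 * r z * (v z)\<^sup>2 + internal_energy \<gamma> (r z))) * W (snd z)"
    by (intro mult_right_mono W_nonneg)
  then show ?thesis
    using r_range(1)[of z] W_nonneg by (simp add: p_def m_def e_def abs_mult ring_distribs)
qed

lemma mass_bound: "AE t in lborel. (\<integral>\<^sup>+x. ennreal (m (t, x)) \<partial>lborel) \<le> ennreal M"
  using mass_le by (simp add: m_def W_def)

lemma energy_bound: "AE t in lborel. (\<integral>\<^sup>+x. ennreal (e (t, x)) \<partial>lborel) \<le> ennreal E"
  using energy_le by (simp add: e_def W_def)

lemma momentum_bound: "AE t in lborel. (\<integral>\<^sup>+x. ennreal \<bar>p (t, x)\<bar> \<partial>lborel) \<le> ennreal (M + E)"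
  using mass_bound energy_bound
proof eventually_elim
  case (elim t)
  have "(\<integral>\<^sup>+x. ennreal \<bar>p (t, x)\<bar> \<partial>lborel) \<le> (\<integral>\<^sup>+x. ennreal (m (t, x)) + ennreal (e (t, x)) \<partial>lborel)"
    using p_le fields_nonneg by (intro nn_integral_mono) (simp add: ennreal_leI flip: ennreal_plus)
  also have "\<dots> = (\<integral>\<^sup>+x. ennreal (m (t, x)) \<partial>lborel) + (\<integral>\<^sup>+x. ennreal (e (t, x)) \<partial>lborel)"
    by (intro nn_integral_add) simp_all
  also have "\<dots> \<le> ennreal M + ennreal E" using elim by (intro add_mono)
  finally show ?case using constants_nonneg by (simp flip: ennreal_plus)
qed

lemma flux_bound: "AE t in lborel. (\<integral>\<^sup>+x. ennreal (q (t, x)) \<partial>lborel) \<le> ennreal (flux_const * E)"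
  using energy_bound
proof eventually_elim
  case (elim t)
  have "(\<integral>\<^sup>+x. ennreal (q (t, x)) \<partial>lborel) \<le> (\<integral>\<^sup>+x. ennreal flux_const * ennreal (e (t, x)) \<partial>lborel)"
    using q_le fields_nonneg flux_const_nonneg
    by (intro nn_integral_mono) (simp add: ennreal_leI flip: ennreal_mult)
  also have "\<dots> = ennreal flux_const * (\<integral>\<^sup>+x. ennreal (e (t, x)) \<partial>lborel)"
    by (intro nn_integral_cmult) simp
  also have "\<dots> \<le> ennreal flux_const * ennreal E" using elim by (intro mult_left_mono) auto
  finally show ?case using constants_nonneg flux_const_nonneg by (simp add: ennreal_mult)
qed

text \<open>\<open>- S\<close> is the pressure term times \<open>- A'\<close>, and
  \<open>- A' \<le> K * A\<close> makes it at most \<open>K\<close> times the pressure part of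
  \<open>q\<close>.\<close>

lemma source_bound: "AE t in lborel. (\<integral>\<^sup>+x. ennreal (- S (t, x)) \<partial>lborel) \<le> ennreal (K * (flux_const * E))"
  using flux_bound
proof eventually_elim
  case (elim t)
  have "AE x in lborel. ennreal (- S (t, x)) \<le> ennreal K * ennreal (q (t, x))"
    using weight_deriv_ge
  proof eventually_elim
    case (elim x)
    have "- dW x \<le> K * W x" using elim by (simp add: dW_def W_def indicator_def)
    then have "pressure_coeff \<gamma> * r (t, x) powr \<gamma> * (- dW x) \<le> pressure_coeff \<gamma> * r (t, x) powr \<gamma> * (K * W x)"
      using coeff_pos by (intro mult_left_mono) auto
    also have "\<dots> = K * (pressure_coeff \<gamma> * r (t, x) powr \<gamma> * W x)" by simp
    also have "\<dots> \<le> K * q (t, x)"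
      using constants_nonneg r_range(1) W_nonneg by (intro mult_left_mono) (auto simp: q_def ring_distribs)
    finally have "- S (t, x) \<le> K * q (t, x)" by (simp add: S_def)
    then show ?case using constants_nonneg fields_nonneg by (simp add: ennreal_leI flip: ennreal_mult)
  qed
  then have "(\<integral>\<^sup>+x. ennreal (- S (t, x)) \<partial>lborel) \<le> (\<integral>\<^sup>+x. ennreal K * ennreal (q (t, x)) \<partial>lborel)"
    by (rule nn_integral_mono_AE)
  also have "\<dots> = ennreal K * (\<integral>\<^sup>+x. ennreal (q (t, x)) \<partial>lborel)"
    by (intro nn_integral_cmult) simp
  also have "\<dots> \<le> ennreal K * ennreal (flux_const * E)" using elim by (intro mult_left_mono) auto
  finally show ?case using constants_nonneg flux_const_nonneg by (simp add: ennreal_mult)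
qed

lemma B_nonneg: "0 \<le> B"
  using r_range[of undefined] by linarith

lemma W_bounded: obtains C where "0 \<le> C" "\<And>x. x \<le> R \<Longrightarrow> W x \<le> C"
proof -
  obtain C where "\<forall>x\<in>\<Omega>. x \<le> R \<longrightarrow> A x \<le> C" using weight_bounded by blast
  then have "W x \<le> max 0 C" if "x \<le> R" for x
    using that by (auto simp: W_def indicator_def le_max_iff_disj)
  then show ?thesis using that[of "max 0 C"] by auto
qed

text \<open>The half plane extends to minus infinity since this is where the left cutoffs of a
  nozzle go.\<close>

lemma p_bounded_left: "\<exists>C. \<forall>z. snd z \<le> R \<longrightarrow> \<bar>p z\<bar> \<le> C"
proof -
  obtain C where C: "0 \<le> C" "\<And>x. x \<le> R \<Longrightarrow> W x \<le> C" using W_bounded by blast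
  have "\<bar>p z\<bar> \<le> B * B * C" if "snd z \<le> R" for z
    using C(2)[OF that] C(1) r_range[of z] v_range[of z] W_nonneg[of "snd z"] B_nonneg
    unfolding p_def abs_mult by (intro mult_mono) auto
  then show ?thesis by blast
qed

text \<open>Here the strip is bounded on both sides, as the derivative of the weight is controlled
  on bounded sets only.\<close>

lemma fields_bounded:
  "\<exists>C. \<forall>z. \<bar>snd z\<bar> \<le> R \<longrightarrow> \<bar>m z\<bar> \<le> C \<and> \<bar>p z\<bar> \<le> C \<and> \<bar>q z\<bar> \<le> C \<and> \<bar>S z\<bar> \<le> C"
proof -
  obtain C where C: "0 \<le> C" "\<And>x. x \<le> R \<Longrightarrow> W x \<le> C" using W_bounded by blast
  obtain D where "\<forall>x\<in>\<Omega>. \<bar>x\<bar> \<le> R \<longrightarrow> \<bar>deriv A x\<bar> \<le> D" using weight_deriv_bounded by blast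
  then have D: "\<bar>dW x\<bar> \<le> max 0 D" if "\<bar>x\<bar> \<le> R" for x
    using that by (auto simp: dW_def indicator_def le_max_iff_disj)
  obtain Cp where Cp: "\<And>z. snd z \<le> R \<Longrightarrow> \<bar>p z\<bar> \<le> Cp" using p_bounded_left by blast
  have rg: "0 \<le> r z powr \<gamma>" "r z powr \<gamma> \<le> B powr \<gamma>" for z
    using r_range[of z] gamma by (auto intro: powr_mono2)
  have v2: "(v z)\<^sup>2 \<le> B\<^sup>2" for z using v_range[of z] by (simp add: abs_le_square_iff[symmetric] B_nonneg)
  define X where "X = B * C + \<bar>Cp\<bar> + (B * B\<^sup>2 + pressure_coeff \<gamma> * B powr \<gamma>) * C
    + pressure_coeff \<gamma> * B powr \<gamma> * max 0 D"
  have "\<bar>m z\<bar> \<le> X \<and> \<bar>p z\<bar> \<le> X \<and> \<bar>q z\<bar> \<le> X \<and> \<bar>S z\<bar> \<le> X" if "\<bar>snd z\<bar> \<le> R" for z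
  proof -
    have z: "snd z \<le> R" using that by simp
    have 1: "\<bar>m z\<bar> \<le> B * C" unfolding m_def abs_mult
      using C(2)[OF z] C(1) r_range[of z] W_nonneg[of "snd z"] B_nonneg by (intro mult_mono) auto
    have 2: "\<bar>p z\<bar> \<le> \<bar>Cp\<bar>" using Cp[OF z] by linarith
    have 3: "\<bar>q z\<bar> \<le> (B * B\<^sup>2 + pressure_coeff \<gamma> * B powr \<gamma>) * C"
      unfolding abs_of_nonneg[OF fields_nonneg(2)] unfolding q_def
      using C(2)[OF z] C(1) r_range[of z] W_nonneg[of "snd z"] B_nonneg v2[of z] rg[of z] coeff_pos
      by (intro mult_mono add_mono add_nonneg_nonneg) auto
    have 4: "\<bar>S z\<bar> \<le> pressure_coeff \<gamma> * B powr \<gamma> * max 0 D"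
      unfolding S_def abs_mult using rg[of z] coeff_pos D[OF that] B_nonneg by (intro mult_mono) auto
    have "0 \<le> B * C" "0 \<le> \<bar>Cp\<bar>" "0 \<le> (B * B\<^sup>2 + pressure_coeff \<gamma> * B powr \<gamma>) * C"
      "0 \<le> pressure_coeff \<gamma> * B powr \<gamma> * max 0 D"
      using C(1) B_nonneg coeff_pos by auto
    then show ?thesis using 1 2 3 4 unfolding X_def by linarith
  qed
  then show ?thesis by blast
qed

lemma weak_flowI:
  assumes mass_eq: "\<And>a b. \<lbrakk>test_function {0<..} a; test_function \<Omega> b; \<And>t. 0 \<le> a t; \<And>x. 0 \<le> b x\<rbrakk> \<Longrightarrow>
      (LINT z|lborel. m z * deriv a (fst z) * b (snd z) + p z * a (fst z) * deriv b (snd z)) = 0"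
    and momentum_eq: "\<And>a b. \<lbrakk>test_function {0<..} a; test_function \<Omega> b; \<And>t. 0 \<le> a t; \<And>x. 0 \<le> b x\<rbrakk> \<Longrightarrow>
      (LINT z|lborel. p z * deriv a (fst z) * b (snd z) + q z * a (fst z) * deriv b (snd z)
        + S z * a (fst z) * b (snd z)) = 0"
    and lcut: "\<And>k. smooth (lcut k)" "\<And>k x. 0 \<le> lcut k x" "\<And>k x. lcut k x \<le> 1"
      "\<And>k x. 0 \<le> deriv (lcut k) x" "\<And>k. \<exists>l. {l..} \<subseteq> \<Omega> \<and> (\<forall>x\<le>l. lcut k x = 0)"
      "\<And>k. (\<integral>\<^sup>+x. ennreal (deriv (lcut k) x) \<partial>lborel) \<le> 1"
      "\<And>l. l \<in> \<Omega> \<Longrightarrow> \<forall>\<^sub>F k in sequentially. \<forall>x\<ge>l. lcut k x = 1"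
    and flux_left: "\<And>\<tau>. test_function {0<..} \<tau> \<Longrightarrow>
      (\<lambda>k. LINT z|lborel. p z * \<tau> (fst z) * deriv (lcut k) (snd z)) \<longlonglongrightarrow> 0"
  shows "weak_flow \<Omega> m p q S lcut M (M + E) (flux_const * E) (K * (flux_const * E))"
proof
  show "(p z)\<^sup>2 \<le> q z * m z" for z
    using determinant[of z] coeff_pos by (smt (verit) mult_nonneg_nonneg powr_ge_zero zero_le_power2)
qed (use assms constants_nonneg flux_const_nonneg fields_nonneg mass_bound momentum_bound flux_bound
    source_bound fields_bounded p_bounded_left open_domain in auto)

end

section \<open>Cutoffs at the left end of the domain\<close>

lemma smooth_eq_integral_deriv:
  fixes w :: "real \<Rightarrow> real"
  assumes w: "smooth w" "\<And>x. b \<le> x \<Longrightarrow> w x = 0"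
  shows "w x = - (LINT s|lborel. deriv w s * indicat_real {x<..} s)"
proof -
  \<comment> \<open>Beyond \<open>c\<close> the function \<open>w\<close> is zero and its derivative
    too, so the integral over \<open>{x..c}\<close> is already the one over all
    \<open>s > x\<close>. The indicator form prepares for Fubini in the variables \<open>x\<close>
    and \<open>s\<close>.\<close>
  define c where "c = max x b"
  have [measurable]: "deriv w \<in> borel_measurable borel"
    using w(1) by (intro smooth_measurable smooth_deriv)
  have "(LINT s|lborel. indicator {x..c} s *\<^sub>R deriv w s) = w c - w x"
  proof (rule integral_FTC_Icc)
    show "(w has_vector_derivative deriv w s) (at s within {x..c})" for s
      using smooth_has_deriv[OF w(1), of s]
      by (simp add: has_real_derivative_iff_has_vector_derivative has_vector_derivative_at_within)
  qed (auto simp: c_def intro!: smooth_continuous_on smooth_deriv w)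
  moreover have "w c = 0" using w(2) by (simp add: c_def)
  moreover have "(LINT s|lborel. indicator {x..c} s *\<^sub>R deriv w s) = (LINT s|lborel. deriv w s * indicat_real {x<..} s)"
  proof (rule integral_cong_AE)
    have "deriv w s = 0" if "c < s" for s
      by (rule deriv_eq_0_on_open[of "{c<..}" s w 0]) (use that w(2) in \<open>auto simp: c_def\<close>)
    then show "AE s in lborel. indicator {x..c} s *\<^sub>R deriv w s = deriv w s * indicat_real {x<..} s"
      using AE_lborel_singleton[of x]
      by (auto simp: indicator_def elim!: eventually_mono)
  qed simp_all
  ultimately show ?thesis by simp
qed

lemma test_function_support_bounded:
  assumes "test_function S \<tau>"
  obtains R where "\<And>x. R < norm x \<Longrightarrow> \<tau> x = 0"
proof -
  have "bounded (closure {z. \<tau> z \<noteq> 0})" using assms by (auto simp: test_function_def compact_imp_bounded)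
  then obtain R where "\<forall>z\<in>closure {z. \<tau> z \<noteq> 0}. norm z \<le> R" by (auto simp: bounded_iff)
  then show ?thesis using that[of R] closure_subset[of "{z. \<tau> z \<noteq> 0}"] by force
qed

text \<open>With n = \<open>Suc k\<close>, the cutoff of a nozzle rises on \<open>[-2n, -n]\<close>
  with slope of order 1/n. In spherical symmetry it rises on \<open>[1/n, 2/n]\<close>, inside the
  open half line but approaching the origin, with slope of order n.\<close>

primrec left_cutoff :: "geometry \<Rightarrow> nat \<Rightarrow> real \<Rightarrow> real" where
  "left_cutoff (Nozzle A) k = (\<lambda>x. step (1 / real (Suc k) * x + 2))"
| "left_cutoff (Spherical \<alpha>) k = (\<lambda>x. step (real (Suc k) * x + (-1)))"

lemma
  fixes s b :: real
  assumes "0 < s"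
  shows smooth_step_affine: "smooth (\<lambda>x. step (s * x + b))"
    and deriv_step_affine: "deriv (\<lambda>x. step (s * x + b)) x = s * bump (s * x + b)"
    and variation_step_affine: "(\<integral>\<^sup>+x. ennreal (deriv (\<lambda>x. step (s * x + b)) x) \<partial>lborel) = 1"
proof -
  show 1: "deriv (\<lambda>x. step (s * x + b)) x = s * bump (s * x + b)" for x
    by (simp add: deriv_affine_smooth[OF smooth_step] deriv_step)
  show "smooth (\<lambda>x. step (s * x + b))" by (rule smooth_affine[OF smooth_step])
  show "(\<integral>\<^sup>+x. ennreal (deriv (\<lambda>x. step (s * x + b)) x) \<partial>lborel) = 1"
    unfolding 1 using nn_integral_bump_affine[of s b] assms by (simp add: add.commute)
qed

lemma left_cutoff_step: "\<exists>s b. 0 < s \<and> left_cutoff G k = (\<lambda>x. step (s * x + b))"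
proof (cases G)
  case (Nozzle A)
  then show ?thesis by (intro exI[of _ "1 / real (Suc k)"] exI[of _ 2]) simp
next
  case (Spherical \<alpha>)
  then show ?thesis by (intro exI[of _ "real (Suc k)"] exI[of _ "-1"]) simp
qed

lemma
  shows smooth_left_cutoff: "smooth (left_cutoff G k)"
    and left_cutoff_range: "0 \<le> left_cutoff G k x" "left_cutoff G k x \<le> 1"
    and left_cutoff_deriv_nonneg: "0 \<le> deriv (left_cutoff G k) x"
    and left_cutoff_variation: "(\<integral>\<^sup>+x. ennreal (deriv (left_cutoff G k) x) \<partial>lborel) \<le> 1"
proof -
  obtain s b where *: "0 < s" "left_cutoff G k = (\<lambda>x. step (s * x + b))"
    using left_cutoff_step by blast
  show "smooth (left_cutoff G k)" "0 \<le> left_cutoff G k x" "left_cutoff G k x \<le> 1"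
    "0 \<le> deriv (left_cutoff G k) x"
    unfolding *(2) using *(1)
    by (simp_all add: smooth_step_affine step_nonneg step_le_1 deriv_step_affine bump_nonneg)
  show "(\<integral>\<^sup>+x. ennreal (deriv (left_cutoff G k) x) \<partial>lborel) \<le> 1"
    unfolding *(2) by (simp only: variation_step_affine[OF *(1)] order_refl)
qed

lemma left_cutoff_support: "\<exists>l. {l..} \<subseteq> domain G \<and> (\<forall>x\<le>l. left_cutoff G k x = 0)"
proof (cases G)
  case (Nozzle A)
  have "1 / real (Suc k) * x + 2 \<le> 0" if "x \<le> - 2 * real (Suc k)" for x
    using that by (simp add: field_simps)
  then show ?thesis
    using Nozzle by (intro exI[of _ "- 2 * real (Suc k)"]) (auto intro!: step_le_0)
next
  case (Spherical \<alpha>)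
  have "real (Suc k) * x + (-1) \<le> 0" if "x \<le> 1 / real (Suc k)" for x
    using that by (simp add: field_simps)
  then show ?thesis
    using Spherical by (intro exI[of _ "1 / real (Suc k)"])
      (auto intro!: step_le_0 simp: less_le_trans[of 0 "1 / real (Suc k)"])
qed

lemma left_cutoff_eventually:
  assumes "l \<in> domain G"
  shows "\<forall>\<^sub>F k in sequentially. \<forall>x\<ge>l. left_cutoff G k x = 1"
proof -
  have ev: "\<forall>\<^sub>F k in sequentially. c \<le> real (Suc k)" for c
  proof -
    have "\<forall>\<^sub>F k in sequentially. c \<le> real k"
      using filterlim_real_sequentially unfolding filterlim_at_top by blast
    then show ?thesis by eventually_elim simp
  qed
  show ?thesis
  proof (cases G)
    case (Nozzle A)
    show ?thesis
      using ev[of "- l"]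
    proof eventually_elim
      case (elim k)
      have "1 \<le> 1 / real (Suc k) * x + 2" if "l \<le> x" for x
        using elim that by (simp add: field_simps)
      then show ?case using Nozzle by (auto intro!: step_ge_1)
    qed
  next
    case (Spherical \<alpha>)
    then have l: "0 < l" using assms by simp
    show ?thesis
      using ev[of "2 / l"]
    proof eventually_elim
      case (elim k)
      have "1 \<le> real (Suc k) * x + (-1)" if "l \<le> x" for x
      proof -
        have "2 \<le> real (Suc k) * l" using elim l by (simp add: field_simps)
        also have "\<dots> \<le> real (Suc k) * x" using that by (intro mult_left_mono) auto
        finally show ?thesis by simp
      qed
      then show ?case using Spherical by (auto intro!: step_ge_1)
    qed
  qed
qed

section \<open>Weak equations, the bound for one approximate solution, and the flux at the left
  end\<close>

context finite_energy_flow
begin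

lemma fields_eq_0: "z \<notin> {0..} \<times> \<Omega> \<Longrightarrow> m z = 0" "z \<notin> {0..} \<times> \<Omega> \<Longrightarrow> p z = 0"
    "z \<notin> {0..} \<times> \<Omega> \<Longrightarrow> q z = 0" "z \<notin> {0..} \<times> \<Omega> \<Longrightarrow> S z = 0"
  using gamma by (simp_all add: m_def p_def q_def S_def r_support)

context
  fixes r0 v0 \<rho> u
  assumes sol: "entropy_solution \<gamma> \<Omega> A r0 v0 \<rho> u"
    and rep: "AE z in lborel. z \<in> {0..} \<times> \<Omega> \<longrightarrow> \<rho> z = r z \<and> u z = v z"
begin

lemma mass_equation:
  assumes a: "test_function {0<..} a" "\<And>t. 0 \<le> a t" and b: "test_function \<Omega> b" "\<And>x. 0 \<le> b x"
  shows "(LINT z|lborel. m z * deriv a (fst z) * b (snd z) + p z * a (fst z) * deriv b (snd z)) = 0"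
proof (rule entropy_solution_weak[OF sol entropy_generator_const a b])
  have [measurable]: "a \<in> borel_measurable borel" "deriv a \<in> borel_measurable borel"
      "b \<in> borel_measurable borel" "deriv b \<in> borel_measurable borel"
    using a b by (auto intro: smooth_measurable smooth_deriv test_function_smooth)
  show "(\<lambda>z. m z * deriv a (fst z) * b (snd z) + p z * a (fst z) * deriv b (snd z)) \<in> borel_measurable borel"
    by measurable
  show "0 < moment 0 \<gamma>" using moment_even_pos[OF gamma, of 0] by simp
  fix k
  show "AE z in lborel. indicat_real ({0..} \<times> \<Omega>) z * (
        eta \<gamma> (\<lambda>_. k) (\<rho> z) (u z) * A (snd z) * (deriv a (fst z) * b (snd z))
      + entropy_flux \<gamma> (\<lambda>_. k) (\<rho> z) (u z) * A (snd z) * (a (fst z) * deriv b (snd z))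
      - geometric_source \<gamma> (\<lambda>_. k) (\<rho> z) (u z) * deriv A (snd z) * (a (fst z) * b (snd z)))
      = k * moment 0 \<gamma> * (m z * deriv a (fst z) * b (snd z) + p z * a (fst z) * deriv b (snd z))"
    using rep
  proof eventually_elim
    case (elim z)
    show ?case
    proof (cases "z \<in> {0..} \<times> \<Omega>")
      case True
      then have "W (snd z) = A (snd z)" by (auto simp: W_def)
      then show ?thesis using elim True gamma r_range(1)[of z]
        by (simp add: eta_const entropy_flux_const geometric_source_const m_def p_def algebra_simps)
    qed (simp add: fields_eq_0)
  qed
qed

lemma momentum_equation:
  assumes a: "test_function {0<..} a" "\<And>t. 0 \<le> a t" and b: "test_function \<Omega> b" "\<And>x. 0 \<le> b x"
  shows "(LINT z|lborel. p z * deriv a (fst z) * b (snd z) + q z * a (fst z) * deriv b (snd z)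
    + S z * a (fst z) * b (snd z)) = 0"
proof (rule entropy_solution_weak[OF sol entropy_generator_linear a b])
  have [measurable]: "a \<in> borel_measurable borel" "deriv a \<in> borel_measurable borel"
      "b \<in> borel_measurable borel" "deriv b \<in> borel_measurable borel"
    using a b by (auto intro: smooth_measurable smooth_deriv test_function_smooth)
  show "(\<lambda>z. p z * deriv a (fst z) * b (snd z) + q z * a (fst z) * deriv b (snd z)
    + S z * a (fst z) * b (snd z)) \<in> borel_measurable borel"
    by measurable
  show I0: "0 < moment 0 \<gamma>" using moment_even_pos[OF gamma, of 0] by simp
  \<comment> \<open>Makes \<open>moment 0 \<gamma>\<close> a common factor of flux and source as
    well, in the role of \<open>c\<close> in \<open>entropy_solution_weak\<close>.\<close>
  have flux_coeff: "theta \<gamma> * moment 2 \<gamma> = pressure_coeff \<gamma> * moment 0 \<gamma>"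
    using I0 by (simp add: pressure_coeff_def)
  fix k
  show "AE z in lborel. indicat_real ({0..} \<times> \<Omega>) z * (
        eta \<gamma> (\<lambda>s. k * s) (\<rho> z) (u z) * A (snd z) * (deriv a (fst z) * b (snd z))
      + entropy_flux \<gamma> (\<lambda>s. k * s) (\<rho> z) (u z) * A (snd z) * (a (fst z) * deriv b (snd z))
      - geometric_source \<gamma> (\<lambda>s. k * s) (\<rho> z) (u z) * deriv A (snd z) * (a (fst z) * b (snd z)))
      = k * moment 0 \<gamma> * (p z * deriv a (fst z) * b (snd z) + q z * a (fst z) * deriv b (snd z)
        + S z * a (fst z) * b (snd z))"
    using rep
  proof eventually_elim
    case (elim z)
    show ?case
    proof (cases "z \<in> {0..} \<times> \<Omega>")
      case True
      then have W: "W (snd z) = A (snd z)" "dW (snd z) = deriv A (snd z)" by (auto simp: W_def dW_def)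
      have eq: "\<rho> z = r z" "u z = v z" using elim True by auto
      show ?thesis
        unfolding eq eta_linear[OF gamma r_range(1)] entropy_flux_linear[OF gamma r_range(1)]
          geometric_source_linear[OF gamma r_range(1)] flux_coeff p_def q_def S_def W
        using True by (simp add: algebra_simps)
    qed (simp add: fields_eq_0)
  qed
qed

text \<open>The diagonal estimate controls the density with the weight \<open>A\<close> of the
  approximation; \<open>w\<close>, later the limit weight, lies below it.\<close>

lemma higher_integrability:
  assumes K': "0 \<le> K'" "\<And>x. bump x \<le> K'" and "0 < T" and G: "\<Omega> = domain G"
    and w: "\<And>x. x \<in> \<Omega> \<Longrightarrow> 0 \<le> w x \<and> w x \<le> A x"
    and flux_left: "\<And>\<tau>. test_function {0<..} \<tau> \<Longrightarrow>
      (\<lambda>k. LINT z|lborel. p z * \<tau> (fst z) * deriv (left_cutoff G k) (snd z)) \<longlonglongrightarrow> 0"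
  shows "(\<integral>\<^sup>+z\<in>{0..T} \<times> \<Omega>. ennreal (\<rho> z powr (\<gamma> + 1) * (w (snd z))\<^sup>2) \<partial>lebesgue)
    \<le> ennreal (1 / pressure_coeff \<gamma>)
      * ennreal (M * ((M + E) * 2 + (flux_const * E * K' + K * (flux_const * E)) * (T + 2)))"
proof -
  interpret weak_flow \<Omega> m p q S "left_cutoff G" M "M + E" "flux_const * E" "K * (flux_const * E)"
    by (rule weak_flowI) (use mass_equation momentum_equation flux_left smooth_left_cutoff left_cutoff_range
      left_cutoff_deriv_nonneg left_cutoff_support[of G] left_cutoff_variation left_cutoff_eventually[of _ G] in \<open>auto simp: G\<close>)
  \<comment> \<open>\<open>spacetime_bound\<close> covers positive times; the slice at time zero is
    a null set.\<close>
  have "AE z in (lborel :: (real \<times> real) measure). fst z \<noteq> 0"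
  proof -
    have "AE z in lborel \<Otimes>\<^sub>M (lborel :: real measure). fst z \<noteq> (0::real)"
    proof (rule lborel_pair.AE_pair_measure)
      show "AE x in lborel. AE y in (lborel :: real measure). fst (x, y) \<noteq> (0::real)"
        using AE_lborel_singleton[of "0::real"] by eventually_elim simp
      show "{z \<in> space (lborel \<Otimes>\<^sub>M (lborel :: real measure)). fst z \<noteq> (0::real)} \<in> sets (lborel \<Otimes>\<^sub>M lborel)"
        by measurable
    qed
    then show ?thesis unfolding lborel_prod .
  qed
  then have "AE z in lborel. ennreal (\<rho> z powr (\<gamma> + 1) * (w (snd z))\<^sup>2) * indicator ({0..T} \<times> \<Omega>) z
    \<le> ennreal (1 / pressure_coeff \<gamma>) * (ennreal (q z * m z - (p z)\<^sup>2) * indicator ({0<..T} \<times> \<Omega>) z)"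
    using rep
  proof eventually_elim
    case (elim z)
    show ?case
    proof (cases "z \<in> {0..T} \<times> \<Omega>")
      case True
      then have z: "z \<in> {0<..T} \<times> \<Omega>" "z \<in> {0..} \<times> \<Omega>" "snd z \<in> \<Omega>" using elim by (auto simp: mem_Times_iff)
      have W: "W (snd z) = A (snd z)" using z(3) by (simp add: W_def)
      have "\<rho> z powr (\<gamma> + 1) * (w (snd z))\<^sup>2 \<le> r z powr (\<gamma> + 1) * (W (snd z))\<^sup>2"
        using elim z w[OF z(3)] unfolding W by (auto intro!: mult_left_mono power_mono)
      also have "\<dots> = 1 / pressure_coeff \<gamma> * (q z * m z - (p z)\<^sup>2)"
        unfolding determinant using coeff_pos by simp
      finally have "ennreal (\<rho> z powr (\<gamma> + 1) * (w (snd z))\<^sup>2) \<le> ennreal (1 / pressure_coeff \<gamma> * (q z * m z - (p z)\<^sup>2))"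
        by (rule ennreal_leI)
      also have "\<dots> = ennreal (1 / pressure_coeff \<gamma>) * ennreal (q z * m z - (p z)\<^sup>2)"
        using coeff_pos momentum_le[of z] by (intro ennreal_mult) auto
      finally show ?thesis using True z(1) by simp
    qed simp
  qed
  then have "(\<integral>\<^sup>+z\<in>{0..T} \<times> \<Omega>. ennreal (\<rho> z powr (\<gamma> + 1) * (w (snd z))\<^sup>2) \<partial>lebesgue)
    \<le> (\<integral>\<^sup>+z. ennreal (1 / pressure_coeff \<gamma>) * (ennreal (q z * m z - (p z)\<^sup>2) * indicator ({0<..T} \<times> \<Omega>) z) \<partial>lborel)"
    unfolding nn_integral_completion by (rule nn_integral_mono_AE)
  also have "\<dots> = ennreal (1 / pressure_coeff \<gamma>) * (\<integral>\<^sup>+z\<in>{0<..T} \<times> \<Omega>. ennreal (q z * m z - (p z)\<^sup>2) \<partial>lborel)"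
  proof (rule nn_integral_cmult)
    have "\<Omega> \<in> sets borel" using open_domain by simp
    then have [measurable]: "{0<..T} \<times> \<Omega> \<in> sets borel" by (simp add: borel_prod[symmetric])
    show "(\<lambda>z. ennreal (q z * m z - (p z)\<^sup>2) * indicator ({0<..T} \<times> \<Omega>) z) \<in> borel_measurable lborel"
      by simp
  qed
  also have "\<dots> \<le> ennreal (1 / pressure_coeff \<gamma>)
      * ennreal (M * ((M + E) * 2 + (flux_const * E * K' + K * (flux_const * E)) * (T + 2)))"
    by (intro mult_left_mono spacetime_bound \<open>0 < T\<close> K') simp
  finally show ?thesis .
qed

end

text \<open>The slope of the cutoff is of order 1/(k + 1), while \<open>p\<close> times
  \<open>\<tau>\<close> is integrable over space-time by the momentum bound.\<close>

lemma flux_left_nozzle: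
  assumes "test_function {0<..} \<tau>"
  shows "(\<lambda>k. LINT z|lborel. p z * \<tau> (fst z) * deriv (left_cutoff (Nozzle A') k) (snd z)) \<longlonglongrightarrow> 0"
proof -
  obtain K' where K': "0 < K'" "\<And>x. bump x \<le> K'" using bump_bounded by blast
  have \<tau>: "smooth \<tau>" using assms by (rule test_function_smooth)
  have [measurable]: "\<tau> \<in> borel_measurable borel" using \<tau> by (rule smooth_measurable)
  obtain R where R: "\<And>x. R < norm x \<Longrightarrow> \<tau> x = 0" using test_function_support_bounded[OF assms] by blast
  have int: "integrable lborel \<tau>" by (rule locally_bounded_integrable[OF locally_bounded_smooth[OF \<tau>] R])
  define I where "I = (LINT t|lborel. \<bar>\<tau> t\<bar>)"
  have I: "(\<integral>\<^sup>+t. ennreal \<bar>\<tau> t\<bar> \<partial>lborel) = ennreal I" "0 \<le> I"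
    unfolding I_def using int by (auto intro!: nn_integral_eq_integral)
  have bound: "(\<integral>\<^sup>+z. ennreal (\<bar>\<tau> (fst z)\<bar>) * ennreal \<bar>p z\<bar> \<partial>lborel) \<le> ennreal (M + E) * ennreal I"
  proof -
    have "(\<integral>\<^sup>+z. ennreal (\<bar>\<tau> (fst z)\<bar>) * ennreal \<bar>p z\<bar> \<partial>lborel)
      = (\<integral>\<^sup>+t. \<integral>\<^sup>+x. ennreal \<bar>\<tau> t\<bar> * ennreal \<bar>p (t, x)\<bar> \<partial>lborel \<partial>lborel)"
      by (subst nn_integral_lborel_iterate) simp_all
    also have "\<dots> = (\<integral>\<^sup>+t. ennreal \<bar>\<tau> t\<bar> * (\<integral>\<^sup>+x. ennreal \<bar>p (t, x)\<bar> \<partial>lborel) \<partial>lborel)"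
      by (intro nn_integral_cong nn_integral_cmult) simp
    also have "\<dots> \<le> (\<integral>\<^sup>+t. ennreal \<bar>\<tau> t\<bar> * ennreal (M + E) \<partial>lborel)"
    proof (rule nn_integral_mono_AE)
      show "AE t in lborel. ennreal \<bar>\<tau> t\<bar> * (\<integral>\<^sup>+x. ennreal \<bar>p (t, x)\<bar> \<partial>lborel) \<le> ennreal \<bar>\<tau> t\<bar> * ennreal (M + E)"
        using momentum_bound by eventually_elim (rule mult_left_mono, auto)
    qed
    also have "\<dots> = ennreal (M + E) * ennreal I"
      by (simp add: nn_integral_multc I mult.commute)
    finally show ?thesis .
  qed
  have le: "norm (LINT z|lborel. p z * \<tau> (fst z) * deriv (left_cutoff (Nozzle A') k) (snd z))
    \<le> K' * inverse (real (Suc k)) * ((M + E) * I)" for k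
  proof -
    let ?f = "\<lambda>z. p z * \<tau> (fst z) * deriv (left_cutoff (Nozzle A') k) (snd z)"
    have "(\<integral>\<^sup>+z. ennreal \<bar>?f z\<bar> \<partial>lborel)
      \<le> (\<integral>\<^sup>+z. ennreal (K' * inverse (real (Suc k))) * (ennreal \<bar>\<tau> (fst z)\<bar> * ennreal \<bar>p z\<bar>) \<partial>lborel)"
    proof (intro nn_integral_mono)
      fix z :: "real \<times> real"
      define y where "y = 1 / real (Suc k) * snd z + 2"
      let ?b = "1 / real (Suc k) * bump y"
      have d: "deriv (left_cutoff (Nozzle A') k) (snd z) = ?b"
        by (simp only: left_cutoff.simps y_def) (rule deriv_step_affine, simp)
      have "0 \<le> ?b" "?b \<le> K' * inverse (real (Suc k))"
        using mult_right_mono[OF K'(2)[of y], of "inverse (real (Suc k))"] bump_nonneg[of y]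
        by (simp_all add: divide_inverse mult.commute)
      define c where "c = ?b"
      have c: "0 \<le> c" "c \<le> K' * inverse (real (Suc k))"
        unfolding c_def by fact+
      have "\<bar>?f z\<bar> = c * (\<bar>\<tau> (fst z)\<bar> * \<bar>p z\<bar>)"
        unfolding d c_def[symmetric] using c(1) by (simp add: abs_mult)
      also have "\<dots> \<le> K' * inverse (real (Suc k)) * (\<bar>\<tau> (fst z)\<bar> * \<bar>p z\<bar>)"
        by (intro mult_right_mono c) simp
      finally have "\<bar>?f z\<bar> \<le> K' * inverse (real (Suc k)) * (\<bar>\<tau> (fst z)\<bar> * \<bar>p z\<bar>)" .
      then show "ennreal \<bar>?f z\<bar> \<le> ennreal (K' * inverse (real (Suc k))) * (ennreal \<bar>\<tau> (fst z)\<bar> * ennreal \<bar>p z\<bar>)"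
        using K'(1) by (simp add: ennreal_leI flip: ennreal_mult)
    qed
    also have "\<dots> = ennreal (K' * inverse (real (Suc k))) * (\<integral>\<^sup>+z. ennreal \<bar>\<tau> (fst z)\<bar> * ennreal \<bar>p z\<bar> \<partial>lborel)"
      by (intro nn_integral_cmult) simp
    also have "\<dots> \<le> ennreal (K' * inverse (real (Suc k))) * (ennreal (M + E) * ennreal I)"
      by (intro mult_left_mono bound) simp
    also have "\<dots> = ennreal (K' * inverse (real (Suc k)) * ((M + E) * I))"
    proof -
      have nn: "0 \<le> K' * inverse (real (Suc k))" "0 \<le> M + E" "0 \<le> (M + E) * I"
        using constants_nonneg K'(1) I(2) by auto
      show ?thesis unfolding ennreal_mult[OF nn(1,3)] ennreal_mult[OF nn(2) I(2)] ..
    qed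
    finally have "(LINT z|lborel. \<bar>?f z\<bar>) \<le> K' * inverse (real (Suc k)) * ((M + E) * I)"
      using constants_nonneg K'(1) I(2) by (intro integral_real_bounded) auto
    with integral_abs_bound[of lborel ?f] show ?thesis unfolding real_norm_def by (rule order_trans)
  qed
  have "(\<lambda>k. K' * inverse (real (Suc k)) * ((M + E) * I)) \<longlonglongrightarrow> 0"
    by (intro tendsto_mult_left_zero tendsto_mult_right_zero LIMSEQ_inverse_real_of_nat)
  then show ?thesis by (rule Lim_null_comparison[OF always_eventually[OF allI[OF le]]])
qed

text \<open>
  The derivative \<open>w\<close> of the cutoff is a superposition of indicators of layers \<open>{..<s}\<close> with weight
  \<open>- w' s\<close>, which reduces the claim to the averages in the boundary condition.
\<close>

lemma flux_left_spherical:
  assumes \<Omega>: "\<Omega> = {0<..}" and "test_function {0<..} \<tau>"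
    and vanish: "((\<lambda>\<epsilon>. 1 / \<epsilon> * (LINT z|lborel. indicat_real {..<\<epsilon>} (snd z) * (p z * \<tau> (fst z)))) \<longlongrightarrow> 0) (at_right 0)"
  shows "(\<lambda>k. LINT z|lborel. p z * \<tau> (fst z) * deriv (left_cutoff (Spherical \<alpha>) k) (snd z)) \<longlonglongrightarrow> 0"
proof (rule LIMSEQ_I)
  fix e :: real assume e: "0 < e"
  define G where "G s = (LINT z|lborel. indicat_real {..<s} (snd z) * (p z * \<tau> (fst z)))" for s
  obtain D where D: "0 < D" "\<And>x. \<bar>deriv bump x\<bar> \<le> D" using bump_deriv_bounded by blast
  \<comment> \<open>Chosen so that the final bound \<open>2 * D * e'\<close> is half of
    \<open>e\<close>.\<close>
  define e' where "e' = e / (4 * D)"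
  have e': "0 < e'" "2 * D * e' < e" using e D by (auto simp: e'_def field_simps)
  have "\<forall>\<^sub>F s in at_right 0. \<bar>1 / s * G s\<bar> < e'"
    using tendstoD[OF vanish e'(1)] by (simp add: G_def)
  then obtain d where d: "0 < d" "\<And>s. 0 < s \<Longrightarrow> s < d \<Longrightarrow> \<bar>1 / s * G s\<bar> < e'"
    unfolding eventually_at_right_field by blast
  \<comment> \<open>For \<open>k \<ge> k0\<close> the cutoff rises within \<open>(0, d)\<close>,
    where the layer averages are already small.\<close>
  obtain k0 where k0: "2 / d < real k0" using reals_Archimedean2 by blast
  obtain R where R: "\<And>x. R < norm x \<Longrightarrow> \<tau> x = 0" using test_function_support_bounded[OF assms(2)] by blast
  have \<tau>: "smooth \<tau>" using assms(2) by (rule test_function_smooth)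
  have "norm ((LINT z|lborel. p z * \<tau> (fst z) * deriv (left_cutoff (Spherical \<alpha>) k) (snd z)) - 0) < e" if "k0 \<le> k" for k
  proof -
    define n where "n = real (Suc k)"
    have "2 / d < n" using k0 that by (simp add: n_def)
    then have n: "0 < n" "2 / n < d" using d(1) by (auto simp: n_def field_simps)
    define w where "w = deriv (left_cutoff (Spherical \<alpha>) k)"
    have w_eq: "w = (\<lambda>x. n * bump (n * x + (-1)))"
      unfolding w_def left_cutoff.simps n_def[symmetric] using deriv_step_affine[OF n(1)] by (intro ext)
    have w_smooth: "smooth w" unfolding w_def by (intro smooth_deriv smooth_left_cutoff)
    have w0: "w x = 0" if "x \<notin> {1 / n..2 / n}" for x
    proof -
      have "n * x + (-1) \<le> 0 \<or> 1 \<le> n * x + (-1)"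
        using that n(1) by (auto simp: field_simps)
      then show ?thesis unfolding w_eq using bump_eq_0 by simp
    qed
    have dw0: "deriv w x = 0" if "x \<notin> {1 / n..2 / n}" for x
      using deriv_eq_0_outside[of "1 / n" "2 / n" w] w0 that by blast
    have dw: "deriv w x = n * (n * deriv bump (n * x + (-1)))" for x
    proof -
      have "smooth (\<lambda>x. bump (n * x + (-1)))" by (rule smooth_affine[OF smooth_bump])
      from deriv_mult_const_smooth(2)[OF this] show ?thesis
        unfolding w_eq deriv_affine_smooth[OF smooth_bump] .
    qed
    define f where "f zs = p (fst zs) * \<tau> (fst (fst zs)) * (deriv w (snd zs) * indicat_real {zs. snd (fst zs) < snd zs} zs)"
      for zs :: "(real \<times> real) \<times> real"
    have int: "integrable lborel f"
    \<comment> \<open>Time contributes \<open>R\<close>. On the support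
      \<open>0 < x < s \<le> 2 / n\<close>, since \<open>p\<close> vanishes for
      \<open>x \<le> 0\<close>, and \<open>x\<close> and \<open>s\<close> contribute
      \<open>2 / n\<close> each.\<close>
    proof (rule locally_bounded_integrable[of _ "\<bar>R\<bar> + 4 / n"])
      have "open {zs :: (real \<times> real) \<times> real. snd (fst zs) < snd zs}"
        by (intro open_Collect_less continuous_intros)
      moreover have "locally_bounded p"
      proof -
        have "\<exists>C. \<forall>z. norm z \<le> R \<longrightarrow> \<bar>p z\<bar> \<le> C" for R
          using fields_bounded[of R] by (metis norm_snd_le order_trans real_norm_def prod.collapse)
        then show ?thesis by (simp add: locally_bounded_def)
      qed
      ultimately have lb: "locally_bounded (indicat_real {zs :: (real \<times> real) \<times> real. snd (fst zs) < snd zs})"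
        "locally_bounded p" by (auto intro: locally_bounded_indicator)
      have "locally_bounded (\<lambda>zs :: (real \<times> real) \<times> real. p (fst zs))"
        by (rule locally_bounded_compose[OF lb(2)]) (intro continuous_intros)
      moreover have "locally_bounded (\<lambda>zs :: (real \<times> real) \<times> real. \<tau> (fst (fst zs)))"
        by (rule locally_bounded_compose[OF locally_bounded_smooth[OF \<tau>]]) (intro continuous_intros)
      moreover have "locally_bounded (\<lambda>zs :: (real \<times> real) \<times> real. deriv w (snd zs))"
        by (rule locally_bounded_compose[OF locally_bounded_smooth[OF smooth_deriv[OF w_smooth]]])
          (intro continuous_intros)
      ultimately show "locally_bounded f"
        unfolding f_def[abs_def] by (intro locally_bounded_mult lb(1))
      fix zs :: "(real \<times> real) \<times> real" assume big: "\<bar>R\<bar> + 4 / n < norm zs"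
      have "norm zs \<le> \<bar>fst (fst zs)\<bar> + \<bar>snd (fst zs)\<bar> + \<bar>snd zs\<bar>"
        using norm_Pair_le[of "fst zs" "snd zs"] norm_Pair_le[of "fst (fst zs)" "snd (fst zs)"] by simp
      moreover have False if "\<bar>fst (fst zs)\<bar> \<le> R" "0 < snd (fst zs)" "snd (fst zs) < snd zs" "snd zs \<le> 2 / n"
        using that big calculation by (simp add: field_simps)
      ultimately have "R < norm (fst (fst zs)) \<or> fst zs \<notin> {0..} \<times> \<Omega> \<or> \<not> snd (fst zs) < snd zs \<or> snd zs \<notin> {1 / n..2 / n}"
        by (auto simp: \<Omega> mem_Times_iff not_less)
      then show "f zs = 0" using R[of "fst (fst zs)"] fields_eq_0(2)[of "fst zs"] dw0[of "snd zs"] by (auto simp: f_def)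
    qed
    have "p z * \<tau> (fst z) * w (snd z) = - (LINT s|lborel. f (z, s))" for z
    proof -
      have "w (snd z) = - (LINT s|lborel. deriv w s * indicat_real {snd z<..} s)"
        by (rule smooth_eq_integral_deriv[OF w_smooth, of "2 / n + 1"]) (use w0 in auto)
      moreover have "indicat_real {zs. snd (fst zs) < snd zs} (z, s) = indicat_real {snd z<..} s" for s
        by (simp add: indicator_def)
      ultimately show ?thesis by (simp add: f_def)
    qed
    then have "(LINT z|lborel. p z * \<tau> (fst z) * w (snd z)) = - (LINT z|lborel. LINT s|lborel. f (z, s))"
      by simp
    also have "\<dots> = - (LINT s|lborel. LINT z|lborel. f (z, s))"
      using lborel_Fubini[OF int] by simp
    also have "(LINT s|lborel. LINT z|lborel. f (z, s)) = (LINT s|lborel. deriv w s * G s)"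
    proof -
      have "f (z, s) = deriv w s * (indicat_real {..<s} (snd z) * (p z * \<tau> (fst z)))" for z s
        by (simp add: f_def indicator_def)
      then show ?thesis by (simp add: G_def)
    qed
    finally have "\<bar>LINT z|lborel. p z * \<tau> (fst z) * w (snd z)\<bar> = \<bar>LINT s|lborel. deriv w s * G s\<bar>"
      by (simp only: abs_minus_cancel)
    also have "\<dots> \<le> (LINT s|lborel. \<bar>deriv w s * G s\<bar>)" by (rule integral_abs_bound)
    \<comment> \<open>The powers of n balance: the second derivative of the cutoff is of order n^2,
      \<open>G s\<close> is at most \<open>2 * e' / n\<close>, and \<open>s\<close> runs through an
      interval of length 1/n.\<close>
    also have "\<dots> \<le> 2 * D * e'"
    proof (rule integral_real_bounded)
      have "(\<integral>\<^sup>+s. ennreal \<bar>deriv w s * G s\<bar> \<partial>lborel) \<le> (\<integral>\<^sup>+s. ennreal (2 * n * D * e') * indicator {1 / n..2 / n} s \<partial>lborel)"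
      proof (intro nn_integral_mono)
        fix s
        show "ennreal \<bar>deriv w s * G s\<bar> \<le> ennreal (2 * n * D * e') * indicator {1 / n..2 / n} s"
        proof (cases "s \<in> {1 / n..2 / n}")
          case True
          have "0 < 1 / n" "1 / n \<le> s" "s \<le> 2 / n" using True n by auto
          then have s: "0 < s" "s \<le> 2 / n" "s < d" using n by linarith+
          have "\<bar>G s\<bar> \<le> e' * s" using d(2)[OF s(1,3)] s(1) by (simp add: abs_mult field_simps)
          also have "\<dots> \<le> e' * (2 / n)" using s e' by (intro mult_left_mono) auto
          finally have G: "\<bar>G s\<bar> \<le> e' * (2 / n)" .
          have "\<bar>deriv w s\<bar> \<le> n * (n * D)"
            unfolding dw abs_mult using D n(1) by (intro mult_mono) auto
          then have "\<bar>deriv w s * G s\<bar> \<le> n * (n * D) * (e' * (2 / n))"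
            unfolding abs_mult using G n(1) D(1) by (intro mult_mono) auto
          also have "\<dots> = 2 * n * D * e'" using n(1) by simp
          finally show ?thesis using True by (simp add: ennreal_leI)
        qed (simp add: dw0)
      qed
      also have "\<dots> = ennreal (2 * n * D * e') * emeasure lborel {1 / n..2 / n}"
        by (intro nn_integral_cmult_indicator) simp
      also have "emeasure lborel {1 / n..2 / n} = ennreal (1 / n)"
        using n(1) by (simp add: divide_right_mono diff_divide_distrib[symmetric])
      also have "ennreal (2 * n * D * e') * ennreal (1 / n) = ennreal (2 * D * e')"
        using n(1) D(1) e' by (simp flip: ennreal_mult)
      finally show "(\<integral>\<^sup>+s. ennreal \<bar>deriv w s * G s\<bar> \<partial>lborel) \<le> ennreal (2 * D * e')" .
    qed (use D e' in auto)
    also have "\<dots> < e" by (rule e')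
    finally show ?thesis by (simp add: w_def)
  qed
  then show "\<exists>no. \<forall>k\<ge>no. norm ((LINT z|lborel. p z * \<tau> (fst z) * deriv (left_cutoff (Spherical \<alpha>) k) (snd z)) - 0) < e"
    by blast
qed

end

section \<open>Properties of the approximate weights, uniform in \<open>n\<close> where
  necessary\<close>

lemma deriv_shifted_powr:
  fixes x c \<alpha> :: real
  assumes "0 < x" "0 \<le> c"
  shows "deriv (\<lambda>x. (x + c) powr \<alpha>) x = \<alpha> * (x + c) powr (\<alpha> - 1)"
  by (rule DERIV_imp_deriv) (use assms in \<open>auto intro!: derivative_eq_intros\<close>)

lemma C1_deriv:
  fixes A :: "real \<Rightarrow> real"
  assumes "A C1_differentiable_on UNIV"
  shows "continuous_on UNIV A" "continuous_on UNIV (deriv A)"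
proof -
  obtain D where D: "\<And>x. (A has_vector_derivative D x) (at x)" "continuous_on UNIV D"
    using assms by (auto simp: C1_differentiable_on_def)
  then have R: "(A has_real_derivative D x) (at x)" for x
    by (simp add: has_real_derivative_iff_has_vector_derivative)
  then have "deriv A = D" by (auto intro: DERIV_imp_deriv)
  then show "continuous_on UNIV (deriv A)" using D(2) by simp
  show "continuous_on UNIV A"
    using R by (intro DERIV_continuous_on) (auto intro: has_field_derivative_at_within)
qed

lemma continuous_bounded_on_compact:
  fixes f :: "real \<Rightarrow> real"
  assumes "continuous_on {a..b} f"
  shows "\<exists>C. \<forall>x\<in>{a..b}. \<bar>f x\<bar> \<le> C"
  using compact_imp_bounded[OF compact_continuous_image[OF assms compact_Icc]]
  by (auto simp: bounded_iff)

text \<open>The shift by \<open>1 / n\<close> keeps the derivative bounded up to the origin, also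
  for \<alpha> < 1, and makes the approximate weight larger than the limit weight. For a nozzle,
  continuity bounds the derivative on compact intervals.\<close>

lemma approx_weight_regularity:
  assumes G: "admissible_geometry G" and n: "1 \<le> n"
  shows "continuous_on (domain G) (approx_weight G n) \<and>
      continuous_on (domain G) (deriv (approx_weight G n)) \<and>
      (\<forall>x\<in>domain G. 0 \<le> weight G x \<and> weight G x \<le> approx_weight G n x) \<and>
      (\<exists>C. \<forall>x\<in>domain G. x \<le> R \<longrightarrow> approx_weight G n x \<le> C) \<and>
      (\<exists>C. \<forall>x\<in>domain G. \<bar>x\<bar> \<le> R \<longrightarrow> \<bar>deriv (approx_weight G n) x\<bar> \<le> C)"
proof (cases G)
  case (Nozzle A)
  obtain a b where ab: "0 < a" "\<And>x. A x \<in> {a..b}"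
    using G Nozzle by (auto simp: admissible_geometry_def)
  have "A C1_differentiable_on UNIV" using G Nozzle by (simp add: admissible_geometry_def)
  note C = C1_deriv[OF this]
  obtain C where "\<forall>x\<in>{- R..R}. \<bar>deriv A x\<bar> \<le> C"
    using continuous_bounded_on_compact[OF continuous_on_subset[OF C(2)], of "- R" R] by blast
  then have "\<forall>x. \<bar>x\<bar> \<le> R \<longrightarrow> \<bar>deriv A x\<bar> \<le> C" by (auto simp: abs_le_iff)
  moreover have "0 \<le> A x" for x using ab(1) ab(2)[of x] by auto
  ultimately show ?thesis
    using Nozzle C ab(2) by auto
next
  case (Spherical \<alpha>)
  have \<alpha>: "0 < \<alpha>" using G Spherical by (simp add: admissible_geometry_def)
  define c where "c = 1 / real n"
  have c: "0 < c" using n by (simp add: c_def)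
  have A: "approx_weight G n = (\<lambda>x. (x + c) powr \<alpha>)" using Spherical by (simp add: c_def)
  have dA: "deriv (approx_weight G n) x = \<alpha> * (x + c) powr (\<alpha> - 1)" if "0 < x" for x
    unfolding A using deriv_shifted_powr[OF that, of c] c by simp
  have cont: "continuous_on {0..} (\<lambda>x. \<alpha> * (x + c) powr (\<alpha> - 1))" "continuous_on {0..} (\<lambda>x. (x + c) powr \<alpha>)"
    using c by (auto intro!: continuous_intros)
  have "continuous_on (domain G) (approx_weight G n)"
    unfolding A by (rule continuous_on_subset[OF cont(2)]) (auto simp: Spherical)
  moreover have "continuous_on (domain G) (deriv (approx_weight G n))"
    by (subst continuous_on_cong[OF refl dA]; (rule continuous_on_subset[OF cont(1)])?)
      (auto simp: Spherical)
  moreover have "0 \<le> weight G x \<and> weight G x \<le> approx_weight G n x" if "x \<in> domain G" for x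
    using that \<alpha> c unfolding A by (auto simp: Spherical intro!: powr_mono2)
  moreover have "\<exists>C. \<forall>x\<in>domain G. x \<le> R \<longrightarrow> approx_weight G n x \<le> C"
    using \<alpha> c unfolding A by (intro exI[of _ "(R + c) powr \<alpha>"]) (auto simp: Spherical intro!: powr_mono2)
  moreover have "\<exists>C. \<forall>x\<in>domain G. \<bar>x\<bar> \<le> R \<longrightarrow> \<bar>deriv (approx_weight G n) x\<bar> \<le> C"
  proof -
    obtain C where "\<forall>x\<in>{0..R}. \<bar>\<alpha> * (x + c) powr (\<alpha> - 1)\<bar> \<le> C"
      using continuous_bounded_on_compact[OF continuous_on_subset[OF cont(1)], of 0 R] by auto
    moreover have "0 < x \<and> x \<in> {0..R}" if "x \<in> domain G" "\<bar>x\<bar> \<le> R" for x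
      using that by (auto simp: Spherical)
    ultimately show ?thesis using dA by metis
  qed
  ultimately show ?thesis
    by blast
qed

text \<open>\<open>K\<close> has to be the same for all \<open>n\<close>. A nozzle has one weight,
  and the bound of the negative part divided by the lower bound \<open>a\<close> of the weight
  serves; spherical weights increase, so zero does.\<close>

lemma approx_weight_deriv_ge:
  assumes G: "admissible_geometry G"
  obtains K where "0 \<le> K" "\<And>n. 1 \<le> n \<Longrightarrow>
    AE x in lborel. x \<in> domain G \<longrightarrow> - deriv (approx_weight G n) x \<le> K * approx_weight G n x"
proof (cases G)
  case (Nozzle A)
  obtain a b where ab: "0 < a" "\<And>x. A x \<in> {a..b}"
    using G Nozzle by (auto simp: admissible_geometry_def)
  obtain B where "AE x\<in>domain G in lebesgue. neg_part (deriv (weight G) x) \<le> B"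
    using G by (auto simp: admissible_geometry_def)
  then have B: "AE x in lborel. neg_part (deriv A x) \<le> B"
    using Nozzle by (simp add: AE_completion_iff)
  show ?thesis
  proof (rule that[of "\<bar>B\<bar> / a"])
    show "AE x in lborel. x \<in> domain G \<longrightarrow> - deriv (approx_weight G n) x \<le> \<bar>B\<bar> / a * approx_weight G n x" for n
      using B
    proof eventually_elim
      case (elim x)
      have "- deriv A x \<le> \<bar>B\<bar>" using elim by (simp add: neg_part_def min_def split: if_splits)
      also have "\<bar>B\<bar> = \<bar>B\<bar> / a * a" using ab(1) by simp
      also have "\<dots> \<le> \<bar>B\<bar> / a * A x" using ab(1) ab(2)[of x] by (intro mult_left_mono) auto
      finally show ?case using Nozzle by simp
    qed
  qed (use ab in simp)
next
  case (Spherical \<alpha>)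
  have \<alpha>: "0 < \<alpha>" using G Spherical by (simp add: admissible_geometry_def)
  show ?thesis
  proof (rule that[of 0])
    show "AE x in lborel. x \<in> domain G \<longrightarrow> - deriv (approx_weight G n) x \<le> 0 * approx_weight G n x" for n
      using \<alpha> Spherical by (intro AE_I2) (auto simp: deriv_shifted_powr)
  qed simp
qed

theorem proposition2p1:
  fixes \<gamma> T :: real and G :: geometry
    and r0 v0 :: "real \<Rightarrow> real"
    and r0n v0n :: "nat \<Rightarrow> real \<Rightarrow> real"
    and \<rho> u :: "nat \<Rightarrow> real \<times> real \<Rightarrow> real"
  assumes "\<gamma> > 1"
    and "admissible_geometry G"
    and "finite_energy_approximate_solutions \<gamma> G r0 v0 r0n v0n \<rho> u"
    and "T > 0"
  shows "\<exists>C>0. (SUP n\<in>{1..}. \<integral>\<^sup>+z\<in>{0..T} \<times> domain G.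
           ennreal (\<rho> n z powr (\<gamma> + 1) * (weight G (snd z))\<^sup>2) \<partial>lebesgue) \<le> ennreal C"
proof -
  have data: "finite_energy_data \<gamma> G r0 v0" "approximate_data \<gamma> G r0 v0 r0n v0n"
    using assms(3) by (simp_all add: finite_energy_approximate_solutions_def)
  obtain M where M: "0 \<le> M" "total_mass (domain G) (weight G) r0 = ennreal M"
    using data(1) by (auto simp: finite_energy_data_def less_top_ennreal)
  \<comment> \<open>The factor two is the one in the uniform energy bound on the approximate
    data.\<close>
  obtain E where E: "0 \<le> E" "2 * total_energy \<gamma> (domain G) (weight G) r0 v0 = ennreal E"
  proof -
    obtain e where "0 \<le> e" "total_energy \<gamma> (domain G) (weight G) r0 v0 = ennreal e"
      using data(1) by (auto simp: finite_energy_data_def less_top_ennreal)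
    then show ?thesis using that[of "2 * e"] by (simp add: ennreal_mult)
  qed
  obtain K where K: "0 \<le> K" "\<And>n. 1 \<le> n \<Longrightarrow>
    AE x in lborel. x \<in> domain G \<longrightarrow> - deriv (approx_weight G n) x \<le> K * approx_weight G n x"
    using approx_weight_deriv_ge[OF assms(2)] by blast
  obtain K' where K': "0 < K'" "\<And>x. bump x \<le> K'" using bump_bounded by blast
  \<comment> \<open>The constant must be fixed before \<open>n\<close>, so
    \<open>flux_const\<close>, which belongs to the locale interpreted for each \<open>n\<close>, is
    written out.\<close>
  define F where "F = 2 + pressure_coeff \<gamma> * (\<gamma> - 1) / kappa \<gamma>"
  define C where "C = 1 / pressure_coeff \<gamma> * (M * ((M + E) * 2 + (F * E * K' + K * (F * E)) * (T + 2)))"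
  have S_borel: "{0::real..} \<times> domain G \<in> sets borel"
  proof -
    have "domain G \<in> sets borel" by (cases G) auto
    then show ?thesis by (intro borel_Times) auto
  qed
  have F: "0 \<le> F"
    using assms(1) pressure_coeff_pos[OF assms(1)] by (auto simp: F_def kappa_def)
  have bound: "(\<integral>\<^sup>+z\<in>{0..T} \<times> domain G. ennreal (\<rho> n z powr (\<gamma> + 1) * (weight G (snd z))\<^sup>2) \<partial>lebesgue) \<le> ennreal C"
    if n: "n \<in> {1..}" for n
  proof -
    define A where "A = approx_weight G n"
    have n1: "1 \<le> n" using n by simp
    note sol_n = assms(3)[unfolded finite_energy_approximate_solutions_def, THEN conjunct2, THEN conjunct2, rule_format, OF n1, folded A_def]
    have sol: "entropy_solution \<gamma> (domain G) A (r0n n) (v0n n) (\<rho> n) (u n)" using sol_n by blast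
    obtain B0 where B0: "AE z\<in>{0..} \<times> domain G in lebesgue. \<bar>\<rho> n z\<bar> \<le> B0 \<and> \<bar>u n z\<bar> \<le> B0"
      using sol_n by blast
    \<comment> \<open>This bound depends on \<open>n\<close>; it provides the pointwise bounds of
      the locale, while \<open>C\<close> is built from \<open>M\<close>, \<open>E\<close>,
      \<open>K\<close>, \<open>K'\<close>, \<open>T\<close> and constants of \<gamma>.\<close>
    define B where "B = \<bar>B0\<bar>"
    have \<rho>_range: "AE z\<in>{0..} \<times> domain G in lebesgue. 0 \<le> \<rho> n z \<and> \<rho> n z \<le> B"
    proof -
      have "AE z\<in>{0..} \<times> domain G in lebesgue. 0 \<le> \<rho> n z" using sol by (simp add: entropy_solution_def)
      with B0 show ?thesis by eventually_elim (auto simp: B_def)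
    qed
    obtain r where r: "r \<in> borel_measurable borel" "\<And>z. 0 \<le> r z" "\<And>z. r z \<le> B"
      "\<And>z. z \<notin> {0..} \<times> domain G \<Longrightarrow> r z = 0" "AE z in lborel. z \<in> {0..} \<times> domain G \<longrightarrow> \<rho> n z = r z"
      by (rule borel_representative[OF _ S_borel \<rho>_range])
        (use sol in \<open>auto simp: entropy_solution_def B_def\<close>)
    have u_range: "AE z\<in>{0..} \<times> domain G in lebesgue. - B \<le> u n z \<and> u n z \<le> B"
      using B0 by eventually_elim (auto simp: B_def)
    obtain v where v: "v \<in> borel_measurable borel" "\<And>z. - B \<le> v z" "\<And>z. v z \<le> B"
      "AE z in lborel. z \<in> {0..} \<times> domain G \<longrightarrow> u n z = v z"
      by (rule borel_representative[OF _ S_borel u_range])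
        (use sol in \<open>auto simp: entropy_solution_def B_def\<close>)
    have rep: "AE z in lborel. z \<in> {0..} \<times> domain G \<longrightarrow> \<rho> n z = r z \<and> u n z = v z"
      using r(5) v(4) by eventually_elim auto
    \<comment> \<open>Mass and energy are given at almost every fixed time, so the identification
      with \<open>r\<close> and \<open>v\<close> is needed on almost every time slice.\<close>
    note rep_t = AE_lborel_pair[OF rep]
    have mass: "AE t in lborel. (\<integral>\<^sup>+x. ennreal (r (t, x) * (indicat_real (domain G) x * A x)) \<partial>lborel) \<le> ennreal M"
    proof -
      have "AE t\<in>{0..} in lebesgue. total_mass (domain G) A (\<lambda>x. \<rho> n (t, x)) = ennreal M"
      proof -
        have "total_mass (domain G) A (r0n n) = ennreal M"
          using data(2) n1 M(2) by (simp add: approximate_data_def A_def)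
        then show ?thesis using sol_n by simp
      qed
      then have "AE t in lborel. t \<in> {0..} \<longrightarrow> total_mass (domain G) A (\<lambda>x. \<rho> n (t, x)) = ennreal M"
        by (simp add: AE_completion_iff)
      then show ?thesis
        using rep_t
      proof eventually_elim
        case (elim t)
        show ?case
        proof (cases "0 \<le> t")
          case True
          have "AE x in lborel. ennreal (\<rho> n (t, x) * A x) * indicator (domain G) x
            = ennreal (r (t, x) * (indicat_real (domain G) x * A x))"
            using elim(2) by eventually_elim (use True in \<open>auto simp: indicator_def\<close>)
          then have "total_mass (domain G) A (\<lambda>x. \<rho> n (t, x))
            = (\<integral>\<^sup>+x. ennreal (r (t, x) * (indicat_real (domain G) x * A x)) \<partial>lborel)"
            unfolding total_mass_def by (rule nn_integral_lebesgue_eq_lborel)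
          then show ?thesis using elim(1) True by simp
        qed (simp add: r(4))
      qed
    qed
    have energy: "AE t in lborel. (\<integral>\<^sup>+x. ennreal ((1 / 2 * r (t, x) * (v (t, x))\<^sup>2
      + internal_energy \<gamma> (r (t, x))) * (indicat_real (domain G) x * A x)) \<partial>lborel) \<le> ennreal E"
    proof -
      have "AE t\<in>{0..} in lebesgue. total_energy \<gamma> (domain G) A (\<lambda>x. \<rho> n (t, x)) (\<lambda>x. u n (t, x)) \<le> ennreal E"
      proof -
        have "total_energy \<gamma> (domain G) A (r0n n) (v0n n)
          \<le> (SUP n\<in>{1..}. total_energy \<gamma> (domain G) (approx_weight G n) (r0n n) (v0n n))"
          unfolding A_def by (rule SUP_upper[OF n])
        also have "\<dots> \<le> ennreal E"
          using data(2) E(2) by (simp add: approximate_data_def)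
        finally have le: "total_energy \<gamma> (domain G) A (r0n n) (v0n n) \<le> ennreal E" .
        have "AE t\<in>{0..} in lebesgue. total_energy \<gamma> (domain G) A (\<lambda>x. \<rho> n (t, x)) (\<lambda>x. u n (t, x))
          \<le> total_energy \<gamma> (domain G) A (r0n n) (v0n n)" using sol_n by blast
        then show ?thesis by eventually_elim (use le in \<open>auto intro: order_trans\<close>)
      qed
      then have "AE t in lborel. t \<in> {0..} \<longrightarrow>
          total_energy \<gamma> (domain G) A (\<lambda>x. \<rho> n (t, x)) (\<lambda>x. u n (t, x)) \<le> ennreal E"
        by (simp add: AE_completion_iff)
      then show ?thesis
        using rep_t
      proof eventually_elim
        case (elim t)
        show ?case
        proof (cases "0 \<le> t")
          case True
          have "AE x in lborel. ennreal ((1 / 2 * \<rho> n (t, x) * (u n (t, x))\<^sup>2 + internal_energy \<gamma> (\<rho> n (t, x))) * A x)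
              * indicator (domain G) x
            = ennreal ((1 / 2 * r (t, x) * (v (t, x))\<^sup>2 + internal_energy \<gamma> (r (t, x))) * (indicat_real (domain G) x * A x))"
            using elim(2) by eventually_elim (use True in \<open>auto simp: indicator_def\<close>)
          then have "total_energy \<gamma> (domain G) A (\<lambda>x. \<rho> n (t, x)) (\<lambda>x. u n (t, x))
            = (\<integral>\<^sup>+x. ennreal ((1 / 2 * r (t, x) * (v (t, x))\<^sup>2 + internal_energy \<gamma> (r (t, x)))
              * (indicat_real (domain G) x * A x)) \<partial>lborel)"
            unfolding total_energy_def by (rule nn_integral_lebesgue_eq_lborel)
          then show ?thesis using elim(1) True by simp
        qed (use assms(1) in \<open>simp add: r(4) internal_energy_def\<close>)
      qed
    qed
    note reg' = approx_weight_regularity[OF assms(2) n1, folded A_def]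
    note reg = reg'[THEN conjunct1] reg'[THEN conjunct2, THEN conjunct1]
      reg'[THEN conjunct2, THEN conjunct2, THEN conjunct1, rule_format]
      reg'[THEN conjunct2, THEN conjunct2, THEN conjunct2, THEN conjunct1]
      reg'[THEN conjunct2, THEN conjunct2, THEN conjunct2, THEN conjunct2]
    interpret finite_energy_flow \<gamma> "domain G" A r v B M E K
    proof
      show "open (domain G)" by (cases G) auto
      show "\<bar>v z\<bar> \<le> B" for z using v(2,3)[of z] by linarith
      show "AE x in lborel. x \<in> domain G \<longrightarrow> - deriv A x \<le> K * A x" unfolding A_def by (rule K(2)[OF n1])
      show "0 \<le> A x" if "x \<in> domain G" for x using reg(3)[OF that] by linarith
    qed (fact assms(1) reg(1) reg(2) reg(4) reg(5) M(1) E(1) K(1) r(1) v(1) r(2) r(3) mass energy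
      | (erule r(4)))+
    have flux_left: "(\<lambda>k. LINT z|lborel. p z * \<tau> (fst z) * deriv (left_cutoff G k) (snd z)) \<longlonglongrightarrow> 0"
      if \<tau>: "test_function {0<..} \<tau>" for \<tau>
    proof (cases G)
      case (Nozzle A')
      then show ?thesis using flux_left_nozzle[OF \<tau>] by simp
    next
      case (Spherical \<alpha>)
      have dom: "domain G = {0<..}" using Spherical by simp
      have [measurable]: "\<tau> \<in> borel_measurable borel"
        using \<tau> by (intro smooth_measurable test_function_smooth)
      have "vanishes_at_origin (\<lambda>z. \<rho> n z * u n z * A (snd z))"
        using sol_n Spherical by simp
      then have lim: "((\<lambda>\<epsilon>. 1 / \<epsilon> * (LINT z:{0..} \<times> {0<..<\<epsilon>}|lebesgue. \<rho> n z * u n z * A (snd z) * \<tau> (fst z)))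
        \<longlongrightarrow> 0) (at_right 0)"
        using \<tau> by (simp add: vanishes_at_origin_def)
      \<comment> \<open>The boundary condition speaks of \<rho>, \<open>u\<close> and the layer
        \<open>{0<..<\<epsilon>}\<close>. For \<open>p\<close>, which vanishes outside the domain
        and at negative times, the half plane to the left of \<epsilon> gives the same
        integral.\<close>
      have "(LINT z:{0..} \<times> {0<..<\<epsilon>}|lebesgue. \<rho> n z * u n z * A (snd z) * \<tau> (fst z))
        = (LINT z|lborel. indicat_real {..<\<epsilon>} (snd z) * (p z * \<tau> (fst z)))" for \<epsilon>
        unfolding set_lebesgue_integral_def
      proof (rule integral_lebesgue_eq_lborel)
        show "AE z in lborel. indicat_real ({0..} \<times> {0<..<\<epsilon>}) z *\<^sub>R (\<rho> n z * u n z * A (snd z) * \<tau> (fst z))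
          = indicat_real {..<\<epsilon>} (snd z) * (p z * \<tau> (fst z))"
          using rep
        proof eventually_elim
          case (elim z)
          show ?case
          proof (cases "z \<in> {0..} \<times> domain G")
            case True
            then have "p z = r z * v z * A (snd z)" by (auto simp: p_def W_def)
            then show ?thesis
              using elim True by (auto simp: dom indicator_def mem_Times_iff)
          next
            case False
            then have "z \<notin> {0..} \<times> {0<..<\<epsilon>}" by (auto simp: dom)
            then show ?thesis using fields_eq_0(2)[OF False] by simp
          qed
        qed
      qed simp
      then have "((\<lambda>\<epsilon>. 1 / \<epsilon> * (LINT z|lborel. indicat_real {..<\<epsilon>} (snd z) * (p z * \<tau> (fst z)))) \<longlongrightarrow> 0) (at_right 0)"
        using lim by simp
      moreover have "left_cutoff G = left_cutoff (Spherical \<alpha>)" by (simp only: Spherical)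
      ultimately show ?thesis using flux_left_spherical[OF dom \<tau>, of \<alpha>] by metis
    qed
    have "(\<integral>\<^sup>+z\<in>{0..T} \<times> domain G. ennreal (\<rho> n z powr (\<gamma> + 1) * (weight G (snd z))\<^sup>2) \<partial>lebesgue)
      \<le> ennreal (1 / pressure_coeff \<gamma>)
        * ennreal (M * ((M + E) * 2 + (flux_const * E * K' + K * (flux_const * E)) * (T + 2)))"
      using K' assms(4) reg(3) flux_left by (intro higher_integrability[OF sol rep]) auto
    also have "\<dots> = ennreal C"
      unfolding C_def flux_const_def F_def[symmetric]
      using pressure_coeff_pos[OF assms(1)] M(1) E(1) K(1) K'(1) F assms(4)
      by (intro ennreal_mult[symmetric]) auto
    finally show ?thesis .
  qed
  \<comment> \<open>\<open>C\<close> may be zero, for instance without mass; the maximum makes the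
    constant positive.\<close>
  have "(SUP n\<in>{1..}. \<integral>\<^sup>+z\<in>{0..T} \<times> domain G.
           ennreal (\<rho> n z powr (\<gamma> + 1) * (weight G (snd z))\<^sup>2) \<partial>lebesgue) \<le> ennreal (max C 1)"
    by (rule SUP_least, rule order_trans[OF bound]) (auto intro: ennreal_leI)
  then show ?thesis by (intro exI[of _ "max C 1"]) simp
qed

end
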